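(* Let $\mathcal X=[0,1]^d$. (i) For any Borel probability measures $\mu,\nu$ on $\mathcal X$, any $\phi\in\{\phi_{\mathsf S},\phi_{\mathsf R}\}$, any $0<\rho<1$ and any sequence $(k_n)_{n\in\mathbb N}$ with $k_n\to\infty$ and $k_n=O(n^{(1-\rho)/2})$, with $\mathcal G_n=\bar{\mathcal G}^*_{k_n}(\phi)$, $$\hat\delta_{\mathcal G_n}(X^n,Y^n)\xrightarrow[n\to\infty]{}\delta_{\mathsf{TV}}(\mu,\nu)\quad\mathbb P\text{-a.s.}$$ (ii) For every $0<s\le1$ and $M\ge0$ there is a constant $C$ depending only on $d,M,s$ such that, with $\tilde c_k:=\tilde c_{k,d,s,M,\|\mathcal X\|}$ (defined in the context; it is of order $k^{(d+2)/(2(s+d+2))}$ in $k$) and $\mathcal G_k=\bar{\mathcal G}_k^{\mathsf R}(\tilde c_k)$, for all $k,n\in\mathbb N$, $$\sup_{\substack{(\mu,\nu)\in\mathcal P^2_{\mathsf{TV}}(M,\mathcal X):\\ f_{\mathsf{TV}}\in\mathsf{Lip}_{s,1,M}(\mathcal X)}}\mathbb E\Big[\big|\hat\delta_{\mathcal G_k}(X^n,Y^n)-\delta_{\mathsf{TV}}(\mu,\nu)\big|\Big]\le C\Big(k^{-\frac{s}{2(s+d+2)}}+k^{\frac{d+2}{2(s+d+2)}}n^{-1/2}\Big).$$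
   Context: $\delta_{\mathsf{TV}}(\mu,\nu)=\sup_{\mathcal C}2|\mu(\mathcal C)-\nu(\mathcal C)|$ over Borel sets $\mathcal C\subseteq\mathcal X$ (so it lies in $[0,2]$). $\lambda$ is Lebesgue measure. $\mathcal P^2_{\mathsf{TV}}(M,\mathcal X)$ is the set of pairs of Borel probability measures $\mu,\nu$ on $\mathcal X$ with $\mu,\nu\ll\lambda$, with Lebesgue densities $p,q$ satisfying $\|p\vee q\|_{\infty,\mathcal X}\le M$. $f_{\mathsf{TV}}=\mathbf 1_{\mathcal C^*}-\mathbf 1_{\mathcal X\setminus\mathcal C^*}$ with $\mathcal C^*=\{x\in\mathcal X:p(x)\ge q(x)\}$, extended by $0$ outside $\mathcal X$. Lipschitz class: for $f\in L^1(\mathbb R^d)$, $\xi_{1,1}(f,t)=\sup_{\|u\|\le t}\|f(\cdot+u)-f\|_{L^1(\mathbb R^d)}$, $\|f\|_{\mathsf{Lip}(s,1)}=\|f\|_{L^1}+\sup_{t>0}t^{-s}\xi_{1,1}(f,t)$, and $\mathsf{Lip}_{s,1,b}(\mathcal X)=\{f\in L^1(\mathbb R^d):\|f\|_{\mathsf{Lip}(s,1)}\le b,\ \mathrm{supp}(f)=\mathcal X\}$. Constant: $\|\mathcal X\|:=\sup_{x\in\mathcal X}\|x\|_\infty$. For $t>0$ let $c_{d,M,\|\mathcal X\|,t}=\|\mathcal X\|Md\int_{\mathbb R^d}\|\omega\|^2e^{-t^2\|\omega\|^2/2}d\omega$ and $\hat c_{d,M,\|\mathcal X\|,t}=c_{d,M,\|\mathcal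 X\|,t}\vee1\vee\big((2d\pi^{-d})^{1/2}\Gamma(\tfrac{d+1}2)t^{-1}\big)$. Then $\tilde c_{k,d,s,M,\|\mathcal X\|}:=\hat c_{d,M,\|\mathcal X\|,t_k^*}$ with $t_k^*=k^{-1/(2(s+d+2))}$. Neural networks: $\mathcal G_k(a_1,a_2,a_3,a_4,\phi)$ is the set of $g(x)=\sum_{i=1}^k\beta_i\phi(w_i\cdot x+b_i)+w_0\cdot x+b_0$ on $\mathbb R^d$ with $\|w_i\|_1\vee|b_i|\le a_1$, $|\beta_i|\le a_2$ ($1\le i\le k$), $|b_0|\le a_3$, $\|w_0\|_1\le a_4$. $\phi_{\mathsf S}(z)=(1+e^{-z})^{-1}$, $\phi_{\mathsf R}(z)=\max\{z,0\}$. $\bar{\mathcal G}_k(\mathbf a,\phi)$ is the set of functions $\max\{-1,\min\{1,\tilde g\}\}$, $\tilde g\in\mathcal G_k(\mathbf a,\phi)$; $\bar{\mathcal G}_k^{\mathsf R}(a)=\bar{\mathcal G}_k(1,2k^{-1}a,a,a,\phi_{\mathsf R})$; $\bar{\mathcal G}_k^*(\phi)=\bar{\mathcal G}_k(1,1,1,0,\phi)$. Estimator: $\hat\delta_{\mathcal G}(X^n,Y^n)=\sup_{g\in\mathcal G}\frac1n\sum_{i=1}^n[g(X_i)-g(Y_i)]$, where $(X_i)$ are i.i.d. from $\mu$ and $(Y_i)$ i.i.d. from $\nu$ (independent samples). *)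

theory Defs
  imports
    "HOL-Probability.Probability"
    "HOL-Library.Landau_Symbols"
begin

definition unit_cube :: "(real ^ 'd) set" where
  "unit_cube = {x. \<forall>i. 0 \<le> x $ i \<and> x $ i \<le> 1}"

text \<open>A Borel probability measure on \<open>X\<close> is encoded as a Borel probability measure on the whole
  space that is carried by \<open>X\<close>, so that no measure is ever restricted to a subspace.\<close>

definition prob_measure_on :: "(real ^ 'd) set \<Rightarrow> (real ^ 'd) measure \<Rightarrow> bool" where
  "prob_measure_on X \<mu> \<longleftrightarrow> prob_space \<mu> \<and> sets \<mu> = sets borel \<and> measure \<mu> X = 1"

definition tv_dist :: "(real ^ 'd) set \<Rightarrow> (real ^ 'd) measure \<Rightarrow> (real ^ 'd) measure \<Rightarrow> real" where
  "tv_dist X \<mu> \<nu> = (SUP C\<in>{C \<in> sets borel. C \<subseteq> X}. 2 * \<bar>measure \<mu> C - measure \<nu> C\<bar>)"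

definition tv_pairs ::
  "real \<Rightarrow> (real ^ 'd) set \<Rightarrow> ((real ^ 'd) measure \<times> (real ^ 'd) measure) set" where
  "tv_pairs M X = {(\<mu>, \<nu>). prob_measure_on X \<mu> \<and> prob_measure_on X \<nu> \<and>
      absolutely_continuous lborel \<mu> \<and> absolutely_continuous lborel \<nu> \<and>
      esssup (restrict_space lborel X) (\<lambda>x. max (RN_deriv lborel \<mu> x) (RN_deriv lborel \<nu> x))
        \<le> ennreal M}"

text \<open>\<^const>\<open>RN_deriv\<close> picks one version of each density. Another version changes \<open>f_tv\<close> on a
  Lebesgue null set only, which neither \<open>tv_pairs\<close> nor \<open>Lip1_class\<close> below can detect.\<close>

definition f_tv ::
  "(real ^ 'd) set \<Rightarrow> (real ^ 'd) measure \<Rightarrow> (real ^ 'd) measure \<Rightarrow> real ^ 'd \<Rightarrow> real" where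
  "f_tv X \<mu> \<nu> =
    (let C = {x \<in> X. RN_deriv lborel \<mu> x \<ge> RN_deriv lborel \<nu> x}
     in (\<lambda>x. indicator C x - indicator (X - C) x))"

definition L1_modulus :: "(real ^ 'd \<Rightarrow> real) \<Rightarrow> real \<Rightarrow> ennreal" where
  "L1_modulus f t = (SUP u\<in>{u. norm u \<le> t}. \<integral>\<^sup>+ x. ennreal \<bar>f (x + u) - f x\<bar> \<partial>lborel)"

definition Lip1_norm :: "real \<Rightarrow> (real ^ 'd \<Rightarrow> real) \<Rightarrow> ennreal" where
  "Lip1_norm s f = (\<integral>\<^sup>+ x. ennreal \<bar>f x\<bar> \<partial>lborel) +
      (SUP t\<in>{0<..}. ennreal (t powr (- s)) * L1_modulus f t)"

text \<open>The support of an \<open>L\<^sup>1\<close> class is the essential one: the complement of the largest open set on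
  which the function vanishes almost everywhere.\<close>

definition ess_support :: "(real ^ 'd \<Rightarrow> real) \<Rightarrow> (real ^ 'd) set" where
  "ess_support f = - \<Union>{U. open U \<and> (AE x in lborel. x \<in> U \<longrightarrow> f x = 0)}"

definition Lip1_class :: "real \<Rightarrow> real \<Rightarrow> (real ^ 'd) set \<Rightarrow> (real ^ 'd \<Rightarrow> real) set" where
  "Lip1_class s b X =
    {f. integrable lborel f \<and> Lip1_norm s f \<le> ennreal b \<and> ess_support f = X}"

definition set_sup_norm :: "(real ^ 'd) set \<Rightarrow> real" where
  "set_sup_norm X = (SUP x\<in>X. infnorm x)"

definition c_const :: "(real ^ 'd) set \<Rightarrow> real \<Rightarrow> real \<Rightarrow> real" where
  "c_const X M t = set_sup_norm X * M * real CARD('d) *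
      (\<integral>\<omega>. (norm (\<omega> :: real ^ 'd))\<^sup>2 * exp (- (t\<^sup>2 * (norm \<omega>)\<^sup>2 / 2)) \<partial>lborel)"

definition c_hat :: "(real ^ 'd) set \<Rightarrow> real \<Rightarrow> real \<Rightarrow> real" where
  "c_hat X M t = max (max (c_const X M t) 1)
      (sqrt (2 * real CARD('d) / pi ^ CARD('d)) * Gamma ((real CARD('d) + 1) / 2) / t)"

definition c_tilde :: "(real ^ 'd) set \<Rightarrow> real \<Rightarrow> real \<Rightarrow> nat \<Rightarrow> real" where
  "c_tilde X s M k = c_hat X M (real k powr (- (1 / (2 * (s + real CARD('d) + 2)))))"

definition sigmoid :: "real \<Rightarrow> real" where
  "sigmoid z = 1 / (1 + exp (- z))"

definition relu :: "real \<Rightarrow> real" where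
  "relu z = max z 0"

definition norm1 :: "real ^ 'd \<Rightarrow> real" where
  "norm1 w = (\<Sum>i\<in>UNIV. \<bar>w $ i\<bar>)"

definition nets ::
  "nat \<Rightarrow> real \<Rightarrow> real \<Rightarrow> real \<Rightarrow> real \<Rightarrow> (real \<Rightarrow> real) \<Rightarrow> (real ^ 'd \<Rightarrow> real) set" where
  "nets k a1 a2 a3 a4 \<phi> =
    {\<lambda>x. (\<Sum>i=1..k. \<beta> i * \<phi> (w i \<bullet> x + b i)) + w0 \<bullet> x + b0 | \<beta> w b w0 b0.
      (\<forall>i\<in>{1..k}. max (norm1 (w i)) \<bar>b i\<bar> \<le> a1 \<and> \<bar>\<beta> i\<bar> \<le> a2) \<and> \<bar>b0\<bar> \<le> a3 \<and> norm1 w0 \<le> a4}"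

definition clipped_nets ::
  "nat \<Rightarrow> real \<Rightarrow> real \<Rightarrow> real \<Rightarrow> real \<Rightarrow> (real \<Rightarrow> real) \<Rightarrow> (real ^ 'd \<Rightarrow> real) set" where
  "clipped_nets k a1 a2 a3 a4 \<phi> = (\<lambda>g x. max (- 1) (min 1 (g x))) ` nets k a1 a2 a3 a4 \<phi>"

definition clipped_nets_relu :: "nat \<Rightarrow> real \<Rightarrow> (real ^ 'd \<Rightarrow> real) set" where
  "clipped_nets_relu k a = clipped_nets k 1 (2 * a / real k) a a relu"

definition clipped_nets_star :: "nat \<Rightarrow> (real \<Rightarrow> real) \<Rightarrow> (real ^ 'd \<Rightarrow> real) set" where
  "clipped_nets_star k \<phi> = clipped_nets k 1 1 1 0 \<phi>"

text \<open>The samples of size \<open>n\<close> are the first \<open>n\<close> terms of the sequences \<open>x\<close> and \<open>y\<close>.\<close>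

definition tv_estimator ::
  "(real ^ 'd \<Rightarrow> real) set \<Rightarrow> nat \<Rightarrow> (nat \<Rightarrow> real ^ 'd) \<Rightarrow> (nat \<Rightarrow> real ^ 'd) \<Rightarrow> real" where
  "tv_estimator G n x y = (SUP g\<in>G. 1 / real n * (\<Sum>i<n. g (x i) - g (y i)))"

definition iid_samples ::
  "'w measure \<Rightarrow> (real ^ 'd) measure \<Rightarrow> (real ^ 'd) measure \<Rightarrow>
    (nat \<Rightarrow> 'w \<Rightarrow> real ^ 'd) \<Rightarrow> (nat \<Rightarrow> 'w \<Rightarrow> real ^ 'd) \<Rightarrow> bool" where
  "iid_samples P \<mu> \<nu> X Y \<longleftrightarrow> prob_space P \<and>
    prob_space.indep_vars P (\<lambda>_. borel) (case_sum X Y) UNIV \<and>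
    (\<forall>i. distr P borel (X i) = \<mu>) \<and> (\<forall>i. distr P borel (Y i) = \<nu>)"

text \<open>The joint law of the two independent i.i.d. sequences: \<open>X i\<close> is the coordinate \<open>Inl i\<close>
  and \<open>Y i\<close> the coordinate \<open>Inr i\<close>.\<close>

definition sample_law ::
  "(real ^ 'd) measure \<Rightarrow> (real ^ 'd) measure \<Rightarrow> (nat + nat \<Rightarrow> real ^ 'd) measure" where
  "sample_law \<mu> \<nu> = (\<Pi>\<^sub>M j\<in>UNIV. case_sum (\<lambda>_. \<mu>) (\<lambda>_. \<nu>) j)"

text \<open>The expected error depends on the samples only through their joint law and is computed on the
  coordinate model. By \<open>tv_estimator_measurable\<close> and \<open>expected_error_eq\<close> below, for the classes of
  networks above the nonnegative integral is the usual expectation, and any other probability space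
  carrying i.i.d. samples gives the same value.\<close>

definition expected_error ::
  "(real ^ 'd) set \<Rightarrow> (real ^ 'd \<Rightarrow> real) set \<Rightarrow> nat \<Rightarrow>
    (real ^ 'd) measure \<Rightarrow> (real ^ 'd) measure \<Rightarrow> ennreal" where
  "expected_error X G n \<mu> \<nu> =
    (\<integral>\<^sup>+ \<omega>. ennreal \<bar>tv_estimator G n (\<lambda>i. \<omega> (Inl i)) (\<lambda>i. \<omega> (Inr i)) - tv_dist X \<mu> \<nu>\<bar>
      \<partial>sample_law \<mu> \<nu>)"

lemma sigmoid_continuous: "continuous_on A sigmoid"
  unfolding sigmoid_def
  by (intro continuous_intros) (metis add_pos_pos exp_gt_zero less_numeral_extra(1,3))

lemma relu_continuous: "continuous_on A relu"
  unfolding relu_def by (intro continuous_intros)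

lemma clipped_nets_continuous:
  assumes "continuous_on UNIV \<phi>" "g \<in> clipped_nets k a1 a2 a3 a4 \<phi>"
  shows "continuous_on UNIV g"
proof -
  have *: "continuous_on UNIV (\<lambda>x. \<phi> (h x))" if "continuous_on UNIV h" for h :: "real ^ 'd \<Rightarrow> real"
    using continuous_on_compose2[OF assms(1) that] by simp
  show ?thesis
    using assms(2) unfolding clipped_nets_def nets_def
    by (auto intro!: continuous_intros *)
qed

lemma clipped_nets_bounded: "g \<in> clipped_nets k a1 a2 a3 a4 \<phi> \<Longrightarrow> \<bar>g x\<bar> \<le> 1"
  unfolding clipped_nets_def by auto

lemma tv_estimator_measurable:
  fixes G :: "(real ^ 'd \<Rightarrow> real) set"
  assumes G: "\<And>g. g \<in> G \<Longrightarrow> continuous_on UNIV g" "\<And>g x. g \<in> G \<Longrightarrow> \<bar>g x\<bar> \<le> 1"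
  shows "(\<lambda>\<omega>. tv_estimator G n (\<lambda>i. \<omega> (Inl i)) (\<lambda>i. \<omega> (Inr i)))
    \<in> borel_measurable (\<Pi>\<^sub>M j\<in>(UNIV :: (nat + nat) set). borel)"
proof (cases "G = {}")
  case True
  then show ?thesis by (simp add: tv_estimator_def)
next
  case False
  define F :: "(real ^ 'd \<Rightarrow> real) \<Rightarrow> (nat + nat \<Rightarrow> real ^ 'd) \<Rightarrow> real"
    where "F g \<omega> = 1 / real n * (\<Sum>i<n. g (\<omega> (Inl i)) - g (\<omega> (Inr i)))" for g \<omega>
  have cont: "continuous_on UNIV (F g)" if "g \<in> G" for g
  proof -
    have "continuous_on UNIV (\<lambda>\<omega> :: nat + nat \<Rightarrow> real ^ 'd. g (\<omega> j))" for j
      using continuous_on_compose2[OF G(1)[OF that] continuous_on_product_coordinates] by simp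
    then show ?thesis unfolding F_def by (intro continuous_intros)
  qed
  have bdd: "bdd_above ((\<lambda>g. F g \<omega>) ` G)" for \<omega>
  proof (rule bdd_aboveI2)
    fix g assume "g \<in> G"
    then have "g (\<omega> (Inl i)) - g (\<omega> (Inr i)) \<le> 2" for i
      using G(2)[of g "\<omega> (Inl i)"] G(2)[of g "\<omega> (Inr i)"] by linarith
    then have "(\<Sum>i<n. g (\<omega> (Inl i)) - g (\<omega> (Inr i))) \<le> (\<Sum>i<n. 2)" by (intro sum_mono)
    then show "F g \<omega> \<le> 1 / real n * (\<Sum>i<n. 2)"
      unfolding F_def by (intro mult_left_mono) auto
  qed
  have "(\<lambda>\<omega>. SUP g\<in>G. F g \<omega>) \<in> borel_measurable borel"
  proof (rule borel_measurableI_greater)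
    fix a
    have "{\<omega>. a < (SUP g\<in>G. F g \<omega>)} = (\<Union>g\<in>G. {\<omega>. a < F g \<omega>})"
      using less_cSUP_iff[OF False bdd] by auto
    also have "open \<dots>"
      using cont by (intro open_UN ballI open_Collect_less continuous_on_const)
    finally show "{\<omega> \<in> space borel. a < (SUP g\<in>G. F g \<omega>)} \<in> sets borel" by simp
  qed
  moreover have "sets (\<Pi>\<^sub>M j\<in>(UNIV :: (nat + nat) set). (borel :: (real ^ 'd) measure)) = sets borel"
    by (rule sets_PiM_equal_borel)
  ultimately show ?thesis
    unfolding tv_estimator_def F_def by (simp cong: measurable_cong_sets)
qed

lemma iid_samples_law:
  assumes "iid_samples P \<mu> \<nu> X Y"
  shows "(\<lambda>\<omega> j. case_sum X Y j \<omega>) \<in> P \<rightarrow>\<^sub>M (\<Pi>\<^sub>M j\<in>UNIV. borel)"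
    and "distr P (\<Pi>\<^sub>M j\<in>UNIV. borel) (\<lambda>\<omega> j. case_sum X Y j \<omega>) = sample_law \<mu> \<nu>"
proof -
  interpret prob_space P using assms by (simp add: iid_samples_def)
  have iv: "indep_vars (\<lambda>_. borel) (case_sum X Y) UNIV"
    using assms by (simp add: iid_samples_def)
  then have m: "case_sum X Y j \<in> P \<rightarrow>\<^sub>M borel" for j
    by (simp add: indep_vars_def)
  show "(\<lambda>\<omega> j. case_sum X Y j \<omega>) \<in> P \<rightarrow>\<^sub>M (\<Pi>\<^sub>M j\<in>UNIV. borel)"
    by (rule measurable_PiM_single') (use m in auto)
  have "distr P (\<Pi>\<^sub>M j\<in>UNIV. borel) (\<lambda>\<omega>. \<lambda>j\<in>UNIV. case_sum X Y j \<omega>)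
      = (\<Pi>\<^sub>M j\<in>UNIV. distr P borel (case_sum X Y j))"
    using iv m by (subst (asm) indep_vars_iff_distr_eq_PiM) auto
  moreover have "distr P borel (case_sum X Y j) = case_sum (\<lambda>_. \<mu>) (\<lambda>_. \<nu>) j" for j
    using assms by (cases j) (simp_all add: iid_samples_def)
  ultimately show "distr P (\<Pi>\<^sub>M j\<in>UNIV. borel) (\<lambda>\<omega> j. case_sum X Y j \<omega>) = sample_law \<mu> \<nu>"
    by (simp add: sample_law_def restrict_def)
qed

lemma sample_law_iid_samples:
  assumes "prob_measure_on A \<mu>" "prob_measure_on A \<nu>"
  shows "iid_samples (sample_law \<mu> \<nu>) \<mu> \<nu> (\<lambda>i \<omega>. \<omega> (Inl i)) (\<lambda>i \<omega>. \<omega> (Inr i))"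
proof -
  let ?M = "case_sum (\<lambda>_. \<mu>) (\<lambda>_. \<nu>) :: nat + nat \<Rightarrow> _"
  have ps: "prob_space (?M j)" and st: "sets (?M j) = sets borel" for j
    using assms by (cases j; simp add: prob_measure_on_def)+
  interpret S: prob_space "sample_law \<mu> \<nu>"
    unfolding sample_law_def by (rule prob_space_PiM) (rule ps)
  have eq: "case_sum (\<lambda>i \<omega>. \<omega> (Inl i)) (\<lambda>i \<omega>. \<omega> (Inr i)) = (\<lambda>j \<omega>. \<omega> j)"
    by (auto simp: fun_eq_iff split: sum.split)
  have d: "distr (sample_law \<mu> \<nu>) borel (\<lambda>\<omega>. \<omega> j) = ?M j" for j
  proof -
    have "distr (sample_law \<mu> \<nu>) borel (\<lambda>\<omega>. \<omega> j) = distr (sample_law \<mu> \<nu>) (?M j) (\<lambda>\<omega>. \<omega> j)"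
      by (rule distr_cong) (simp_all add: st)
    also have "\<dots> = ?M j"
      unfolding sample_law_def by (rule distr_PiM_component) (auto intro: ps)
    finally show ?thesis .
  qed
  have sts: "sets (sample_law \<mu> \<nu>) = sets (\<Pi>\<^sub>M j\<in>UNIV. borel)"
    unfolding sample_law_def by (rule sets_PiM_cong) (simp_all add: st)
  have m: "(\<lambda>\<omega>. \<omega> j) \<in> sample_law \<mu> \<nu> \<rightarrow>\<^sub>M borel" for j
    unfolding measurable_cong_sets[OF sts refl] by simp
  have "S.indep_vars (\<lambda>_. borel) (\<lambda>j \<omega>. \<omega> j) UNIV"
  proof (subst S.indep_vars_iff_distr_eq_PiM)
    have "distr (sample_law \<mu> \<nu>) (\<Pi>\<^sub>M j\<in>UNIV. borel) (\<lambda>\<omega>. \<lambda>j\<in>UNIV. \<omega> j) = sample_law \<mu> \<nu>"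
      by (simp add: restrict_def distr_id2 sts)
    then show "distr (sample_law \<mu> \<nu>) (\<Pi>\<^sub>M j\<in>UNIV. borel) (\<lambda>\<omega>. \<lambda>j\<in>UNIV. \<omega> j)
        = (\<Pi>\<^sub>M j\<in>UNIV. distr (sample_law \<mu> \<nu>) borel (\<lambda>\<omega>. \<omega> j))"
      by (simp add: d) (simp add: sample_law_def)
  qed (use m in auto)
  then show ?thesis
    unfolding iid_samples_def eq using d[of "Inl _"] d[of "Inr _"] S.prob_space_axioms by auto
qed

lemma expected_error_eq:
  fixes G :: "(real ^ 'd \<Rightarrow> real) set"
  assumes "iid_samples P \<mu> \<nu> X Y"
    and "\<And>g. g \<in> G \<Longrightarrow> continuous_on UNIV g" "\<And>g x. g \<in> G \<Longrightarrow> \<bar>g x\<bar> \<le> 1"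
  shows "expected_error A G n \<mu> \<nu> =
    (\<integral>\<^sup>+ \<omega>. ennreal \<bar>tv_estimator G n (\<lambda>i. X i \<omega>) (\<lambda>i. Y i \<omega>) - tv_dist A \<mu> \<nu>\<bar> \<partial>P)"
proof -
  have [measurable]: "(\<lambda>\<omega>. tv_estimator G n (\<lambda>i. \<omega> (Inl i)) (\<lambda>i. \<omega> (Inr i)))
      \<in> borel_measurable (\<Pi>\<^sub>M j\<in>(UNIV :: (nat + nat) set). borel)"
    using assms(2,3) by (rule tv_estimator_measurable)
  show ?thesis
    unfolding expected_error_def iid_samples_law(2)[OF assms(1), symmetric]
    by (subst nn_integral_distr[OF iid_samples_law(1)[OF assms(1)]]) simp_all
qed

end

theory Submission
  imports Defs "HOL-Computational_Algebra.Polynomial" "HOL-Real_Asymp.Real_Asymp"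
begin

text \<open>
  Deviations: with \<open>D g\<close> the centred sum of \<open>g (X i) - g (Y i)\<close> over \<open>i < n\<close>, exponential
  moments of \<open>sup \<bar>D g\<bar> / (B sqrt n)\<close> are bounded uniformly in \<open>n\<close> by symmetrization,
  contraction (first the clipping, then the activation function) and the cosh bound for Rademacher sums. The
  supremum over networks reduces to one over affine functions because a network lies in a multiple
  of the absolutely convex hull of ridge functions. This gives the \<open>n powr (- 1/2)\<close> term in (ii) and,
  by summing the moments against \<open>1 / n\<^sup>2\<close>, the almost sure statement (i).

  Bias in (i): finite sums of \<open>exp (w \<bullet> x)\<close> are dense in the continuous functions by
  Stone--Weierstrass, and each \<open>exp (c v)\<close> is a uniform limit of ridge sums of the activation function.

  Bias in (ii): \<open>f_tv\<close> is convolved with the product of the kernels \<open>cos\<^sup>2\<^sup>m (u / 2)\<close>, whose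
  expansion into cosines and sines of integer frequencies turns the result into a ridge sum whose
  total weight is controlled by the second moment of the frequencies; Maurey's lemma compresses it to \<open>k\<close> units.
  As the densities are at most \<open>M\<close>, an \<open>L\<^sup>1\<close> error of size \<open>e\<close> costs at most \<open>M e\<close>.
\<close>

section \<open>Rademacher averages and contraction\<close>

text \<open>The weight bound \<open>B\<close> of a ridge hull is the only feature of a network class
  that the deviation bound sees: \<open>10 * k\<close> in (i), \<open>4 * c_tilde\<close> in (ii).
  In (i) the deviation is thus of order \<open>k * ln n / sqrt n\<close>, where the logarithm is the
  price of an almost sure bound, and the condition on \<open>k\<close> leaves
  \<open>n powr (- \<rho> / 2) * ln n\<close>. In (ii) let \<open>T\<close> be \<open>k\<close> to
  the power \<open>1 / (2 * (s + d + 2))\<close>; then \<open>c_tilde\<close> is of order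
  \<open>T powr (d + 2)\<close> and \<open>sqrt k = T powr (s + d + 2)\<close>. The kernel of order
  \<open>m\<close> has height at most \<open>(m + 1) powr (d / 2)\<close> and frequencies of mean
  square of order \<open>m\<close>, so the ridge sum has total weight at most of order
  \<open>(m + 1) powr (d / 2 + 1)\<close>. This fits below \<open>c_tilde\<close> for
  \<open>m\<close> about \<open>T\<^sup>2\<close>. Smoothing then costs
  \<open>m powr (- s / 2)\<close>, about \<open>T powr (- s)\<close>, and compression costs
  \<open>c_tilde / sqrt k\<close>, again about \<open>T powr (- s)\<close>. The kernel agrees with a
  trigonometric polynomial on the differences of points of the cube, so the expansion is finite, and
  it may have any number of units before compression.\<close>

text \<open>A Rademacher process is the list of its increments, each a function on the index set, and the
  average over all signs is taken one increment at a time. Values in \<^typ>\<open>ennreal\<close> make the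
  supremum and the integrals below unconditional.\<close>

primrec rademacher_avg :: "('g \<Rightarrow> real) list \<Rightarrow> (('g \<Rightarrow> real) \<Rightarrow> ennreal) \<Rightarrow> ('g \<Rightarrow> real) \<Rightarrow> ennreal" where
  "rademacher_avg [] \<Phi> a = \<Phi> a"
| "rademacher_avg (t # ts) \<Phi> a =
    (rademacher_avg ts \<Phi> (\<lambda>g. a g + t g) + rademacher_avg ts \<Phi> (\<lambda>g. a g - t g)) / 2"

text \<open>With the exponential inside, a supremum dominated by finitely many alternatives is at
  most the sum of their exponentials, and averaging over signs acts on each summand.\<close>

definition exp_sup :: "'g set \<Rightarrow> ('g \<Rightarrow> real) \<Rightarrow> ennreal" where
  "exp_sup G a = (SUP g\<in>G. ennreal (exp (a g)))"

text \<open>The comparison is only needed at the sums that accumulate along the list, and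
  \<open>P\<close> is an invariant of these. It is instantiated with linearity, without which a
  supremum over a hull could not be reduced to ridge functions.\<close>

lemma rademacher_avg_mono:
  assumes "P a" "\<And>a t. P a \<Longrightarrow> t \<in> set ts \<Longrightarrow> P (\<lambda>g. a g + t g) \<and> P (\<lambda>g. a g - t g)"
    and "\<And>a. P a \<Longrightarrow> \<Phi> a \<le> \<Psi> a"
  shows "rademacher_avg ts \<Phi> a \<le> rademacher_avg ts \<Psi> a"
  using assms(1,2)
proof (induction ts arbitrary: a)
  case Nil
  then show ?case using assms(3) by simp
next
  case (Cons t ts)
  then show ?case
    by (auto intro!: divide_right_mono_ennreal add_mono)
qed

lemma rademacher_avg_add:
  "rademacher_avg ts (\<lambda>a. \<Phi> a + \<Psi> a) a = rademacher_avg ts \<Phi> a + rademacher_avg ts \<Psi> a"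
  by (induction ts arbitrary: a) (simp_all add: add_divide_distrib_ennreal ac_simps)

lemma rademacher_avg_sum:
  "rademacher_avg ts (\<lambda>a. \<Sum>i\<in>I. \<Phi> i a) a = (\<Sum>i\<in>I. rademacher_avg ts (\<Phi> i) a)"
proof -
  have "rademacher_avg ts (\<lambda>a. 0) a = 0" for a :: "'a \<Rightarrow> real"
    by (induction ts arbitrary: a) simp_all
  then show ?thesis
    by (induction I rule: infinite_finite_induct) (simp_all add: rademacher_avg_add)
qed

lemma rademacher_avg_map:
  assumes "\<And>a t. L (\<lambda>g. a g + t g) = (\<lambda>h. L a h + L t h)" "\<And>a t. L (\<lambda>g. a g - t g) = (\<lambda>h. L a h - L t h)"
  shows "rademacher_avg (map L ts) \<Phi> (L a) = rademacher_avg ts (\<lambda>a. \<Phi> (L a)) a"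
  by (induction ts arbitrary: a) (simp_all flip: assms)

text \<open>The product \<open>cosh x * exp (- (x\<^sup>2 / 2))\<close> equals 1 at 0 and decreases
  for nonnegative arguments, because \<open>sinh y \<le> y * cosh y\<close> there. Evenness covers
  the negative arguments.\<close>

lemma cosh_le_exp_half_square: "cosh (x::real) \<le> exp (x\<^sup>2 / 2)"
proof -
  have *: "cosh x \<le> exp (x\<^sup>2 / 2)" if "x \<ge> 0" for x :: real
  proof -
    have s: "sinh y \<le> y * cosh y" if "y \<ge> 0" for y :: real
    proof -
      have "(\<lambda>y. y * cosh y - sinh y) 0 \<le> y * cosh y - sinh y"
      proof (rule DERIV_nonneg_imp_nondecreasing[OF that])
        fix z :: real assume "0 \<le> z"
        have "((\<lambda>y. y * cosh y - sinh y) has_real_derivative z * sinh z) (at z)"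
          by (auto intro!: derivative_eq_intros)
        with \<open>0 \<le> z\<close> show "\<exists>D. ((\<lambda>y. y * cosh y - sinh y) has_real_derivative D) (at z) \<and> 0 \<le> D"
          by (intro exI[of _ "z * sinh z"]) simp
      qed
      then show ?thesis by simp
    qed
    have "(\<lambda>x. cosh x * exp (- (x\<^sup>2 / 2))) x \<le> (\<lambda>x. cosh x * exp (- (x\<^sup>2 / 2))) 0"
    proof (rule DERIV_nonpos_imp_nonincreasing[OF that])
      fix z :: real assume z: "0 \<le> z"
      have "((\<lambda>x. cosh x * exp (- (x\<^sup>2 / 2))) has_real_derivative
          (sinh z - z * cosh z) * exp (- (z\<^sup>2 / 2))) (at z)"
        by (auto intro!: derivative_eq_intros simp: algebra_simps)
      moreover have "(sinh z - z * cosh z) * exp (- (z\<^sup>2 / 2)) \<le> 0"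
        using s[OF z] by (simp add: mult_nonpos_nonneg)
      ultimately show "\<exists>D. ((\<lambda>x. cosh x * exp (- (x\<^sup>2 / 2))) has_real_derivative D) (at z) \<and> D \<le> 0"
        by blast
    qed
    then show ?thesis by (simp add: exp_minus field_simps)
  qed
  show ?thesis
    using *[of x] *[of "-x"] by (cases "x \<ge> 0") auto
qed

text \<open>Hoeffding's moment bound at a single index \<open>p\<close>: averaging over one sign
  produces a factor \<open>cosh (c * t p)\<close>, which adds half of a squared increment to the
  exponent.\<close>

lemma rademacher_avg_exp_le:
  "rademacher_avg ts (\<lambda>a. ennreal (exp (c * a p))) a
    \<le> ennreal (exp (c * a p + (\<Sum>t\<leftarrow>ts. (c * t p)\<^sup>2 / 2)))"
proof (induction ts arbitrary: a)
  case Nil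
  then show ?case by simp
next
  case (Cons t ts)
  let ?S = "\<Sum>t\<leftarrow>ts. (c * t p)\<^sup>2 / 2"
  have "rademacher_avg (t # ts) (\<lambda>a. ennreal (exp (c * a p))) a
      \<le> (ennreal (exp (c * (a p + t p) + ?S)) + ennreal (exp (c * (a p - t p) + ?S))) / 2"
    unfolding rademacher_avg.simps by (intro divide_right_mono_ennreal add_mono Cons)
  also have "\<dots> = ennreal (exp (c * a p + ?S) * cosh (c * t p))"
    by (simp add: divide_ennreal cosh_def exp_add exp_diff exp_minus
        field_simps flip: ennreal_plus ennreal_numeral)
  also have "\<dots> \<le> ennreal (exp (c * a p + ?S) * exp ((c * t p)\<^sup>2 / 2))"
    by (intro ennreal_leI mult_left_mono cosh_le_exp_half_square) simp
  also have "\<dots> = ennreal (exp (c * a p + (\<Sum>t\<leftarrow>t # ts. (c * t p)\<^sup>2 / 2)))"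
    by (simp add: exp_add[symmetric] ac_simps)
  finally show ?case .
qed

section \<open>The contraction principle for exponential suprema\<close>

lemma exp_increment_mono:
  fixes x y d e :: real
  assumes "x \<le> y" "0 \<le> d" "d \<le> e"
  shows "exp (x + d) - exp x \<le> exp (y + e) - exp y"
proof -
  have "exp (x + d) - exp x = exp x * (exp d - 1)" by (simp add: exp_add algebra_simps)
  also have "\<dots> \<le> exp y * (exp e - 1)"
    using assms by (intro mult_mono) auto
  also have "\<dots> = exp (y + e) - exp y" by (simp add: exp_add algebra_simps)
  finally show ?thesis .
qed

text \<open>\<open>cosh\<close> is even and increasing on the nonnegative reals; \<open>b\<close>
  only contributes a factor.\<close>

lemma exp_add_exp_minus_mono:
  fixes b u v :: real
  assumes "\<bar>u\<bar> \<le> \<bar>v\<bar>"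
  shows "exp (b + u) + exp (b - u) \<le> exp (b + v) + exp (b - v)"
proof -
  have "cosh \<bar>u\<bar> \<le> cosh \<bar>v\<bar>"
    using assms by (subst cosh_real_nonneg_le_iff) auto
  then have "cosh u \<le> cosh v" by (simp add: abs_if split: if_splits)
  then have "exp b * (2 * cosh u) \<le> exp b * (2 * cosh v)" by simp
  then show ?thesis by (simp add: cosh_def exp_add exp_diff exp_minus field_simps)
qed

text \<open>The two-point inequality behind the Ledoux--Talagrand contraction principle.\<close>

lemma exp_contraction_two_point_ordered:
  fixes a b s t p q :: real
  assumes p: "\<bar>p\<bar> \<le> \<bar>s\<bar>" and q: "\<bar>q\<bar> \<le> \<bar>t\<bar>" and pq: "\<bar>p - q\<bar> \<le> \<bar>s - t\<bar>"
    and st: "0 \<le> s \<and> 0 \<le> t \<or> s * t \<le> 0"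
  shows "exp (a + p) + exp (b - q)
    \<le> max (exp (a + s)) (exp (b + t)) + max (exp (a - s)) (exp (b - t))"
proof -
  \<comment> \<open>In the first two cases one of the two points is the better one for both signs,
    and monotonicity of \<open>cosh\<close> at this point suffices. Only the third case involves
    both points.\<close>
  consider "a + p < b + q" | "b - q < a - p" | "b + q \<le> a + p" "a - p \<le> b - q" by linarith
  then show ?thesis
  proof cases
    case 1
    then have "exp (a + p) \<le> exp (b + q)" by simp
    with exp_add_exp_minus_mono[OF q, of b] show ?thesis by linarith
  next
    case 2
    then have "exp (b - q) \<le> exp (a - p)" by simp
    with exp_add_exp_minus_mono[OF p, of a] show ?thesis by linarith
  next
    case 3
    \<comment> \<open>If \<open>s\<close> and \<open>t\<close> are both nonnegative, the point with
      the larger of them gains at least what the other one loses, since its increment is longer and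
      starts higher. For opposite signs each term is bounded separately.\<close>
    consider "0 \<le> t" "t \<le> s" | "0 \<le> s" "s \<le> t" | "0 \<le> s" "t \<le> 0" | "s \<le> 0" "0 \<le> t"
      using st by (fastforce simp: mult_le_0_iff)
    then show ?thesis
    proof cases
      case 1
      have "exp (b - t + (t - q)) - exp (b - t) \<le> exp (a + p + (s - p)) - exp (a + p)"
        using 1 3 p q pq by (intro exp_increment_mono) auto
      then have "exp (a + p) + exp (b - q) \<le> exp (a + s) + exp (b - t)" by simp
      then show ?thesis by linarith
    next
      case 2
      have "exp (a - s + (s + p)) - exp (a - s) \<le> exp (b - q + (t + q)) - exp (b - q)"
        using 2 3 p q pq by (intro exp_increment_mono) auto
      then have "exp (a + p) + exp (b - q) \<le> exp (b + t) + exp (a - s)" by simp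
      then show ?thesis by linarith
    next
      case 3
      then have "exp (a + p) \<le> exp (a + s)" "exp (b - q) \<le> exp (b - t)" using p q by auto
      then show ?thesis by linarith
    next
      case 4
      then have "exp (a + p) \<le> exp (a - s)" "exp (b - q) \<le> exp (b + t)" using p q by auto
      then show ?thesis by linarith
    qed
  qed
qed

text \<open>If \<open>s\<close> and \<open>t\<close> are both negative, exchanging the two points
  and reversing all signs turns the claim into an instance with nonnegative arguments.\<close>

lemma exp_contraction_two_point:
  fixes a b s t p q :: real
  assumes p: "\<bar>p\<bar> \<le> \<bar>s\<bar>" and q: "\<bar>q\<bar> \<le> \<bar>t\<bar>" and pq: "\<bar>p - q\<bar> \<le> \<bar>s - t\<bar>"
  shows "exp (a + p) + exp (b - q)
    \<le> max (exp (a + s)) (exp (b + t)) + max (exp (a - s)) (exp (b - t))"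
proof (cases "0 \<le> s \<and> 0 \<le> t \<or> s * t \<le> 0")
  case True
  then show ?thesis
    using exp_contraction_two_point_ordered[OF p q pq] by auto
next
  case False
  then have "0 \<le> -t \<and> 0 \<le> -s" by (auto simp: mult_le_0_iff)
  then have "exp (b + - q) + exp (a - - p)
    \<le> max (exp (b + - t)) (exp (a + - s)) + max (exp (b - - t)) (exp (a - - s))"
    using p q pq by (intro exp_contraction_two_point_ordered) auto
  then show ?thesis by (simp add: max.commute algebra_simps)
qed

lemma SUP_add_SUP_le_ennreal:
  fixes F H :: "_ \<Rightarrow> ennreal"
  assumes "\<And>g h. g \<in> G \<Longrightarrow> h \<in> G \<Longrightarrow> F g + H h \<le> R"
  shows "(SUP g\<in>G. F g) + (SUP h\<in>G. H h) \<le> R"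
proof (cases "G = {}")
  case False
  have "(SUP g\<in>G. F g) + (SUP h\<in>G. H h) = (SUP g\<in>G. SUP h\<in>G. F g + H h)"
    using False by (simp flip: ennreal_SUP_add_left ennreal_SUP_add_right)
  also have "\<dots> \<le> R"
    by (intro SUP_least assms)
  finally show ?thesis .
qed simp

text \<open>The two suprema on the left are tested at separate indices \<open>g\<close> and
  \<open>h\<close>. The two-point inequality then needs only these same two indices on the right,
  each supremum there taking the better of them.\<close>

lemma exp_sup_contraction:
  fixes \<phi> :: "real \<Rightarrow> real"
  assumes "\<phi> 0 = 0" "\<And>x y. \<bar>\<phi> x - \<phi> y\<bar> \<le> \<bar>x - y\<bar>"
  shows "exp_sup G (\<lambda>g. a g + \<phi> (t g)) + exp_sup G (\<lambda>g. a g - \<phi> (t g))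
    \<le> exp_sup G (\<lambda>g. a g + t g) + exp_sup G (\<lambda>g. a g - t g)"
  unfolding exp_sup_def
proof (rule SUP_add_SUP_le_ennreal)
  fix g h assume gh: "g \<in> G" "h \<in> G"
  let ?m = "\<lambda>x y :: real. max (exp x) (exp y)"
  have m: "ennreal (?m (a g + f g) (a h + f h)) \<le> (SUP g\<in>G. ennreal (exp (a g + f g)))" for f
    using gh by (auto simp: max_def intro: SUP_upper)
  have "ennreal (exp (a g + \<phi> (t g))) + ennreal (exp (a h - \<phi> (t h)))
      = ennreal (exp (a g + \<phi> (t g)) + exp (a h - \<phi> (t h)))" by simp
  also have "\<dots> \<le> ennreal (?m (a g + t g) (a h + t h) + ?m (a g - t g) (a h - t h))"
    using assms(2)[of "t g" 0] assms(2)[of "t h" 0] assms(2)[of "t g" "t h"]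
    by (intro ennreal_leI exp_contraction_two_point) (simp_all add: assms(1))
  also have "\<dots> = ennreal (?m (a g + t g) (a h + t h)) + ennreal (?m (a g - t g) (a h - t h))"
    by (simp add: max_def)
  also have "\<dots> \<le> (SUP g\<in>G. ennreal (exp (a g + t g))) + (SUP g\<in>G. ennreal (exp (a g - t g)))"
    using m[of t] m[of "\<lambda>g. - t g"] by (intro add_mono) auto
  finally show "ennreal (exp (a g + \<phi> (t g))) + ennreal (exp (a h - \<phi> (t h))) \<le> \<dots>" .
qed

lemma rademacher_avg_contraction:
  fixes \<phi> :: "real \<Rightarrow> real"
  assumes "\<phi> 0 = 0" "\<And>x y. \<bar>\<phi> x - \<phi> y\<bar> \<le> \<bar>x - y\<bar>"
  shows "rademacher_avg (map (\<lambda>t g. \<phi> (t g)) ts) (exp_sup G) a \<le> rademacher_avg ts (exp_sup G) a"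
proof (induction ts arbitrary: a)
  case (Cons t ts)
  \<comment> \<open>The first increment can only be contracted once all other signs are fixed,
    whereas the recursion averages over it first. Induction on the remaining increments moves its
    average to the innermost place.\<close>
  have swap: "rademacher_avg ts (exp_sup G) (\<lambda>g. a g + \<phi> (t g)) + rademacher_avg ts (exp_sup G) (\<lambda>g. a g - \<phi> (t g))
      \<le> rademacher_avg ts (exp_sup G) (\<lambda>g. a g + t g) + rademacher_avg ts (exp_sup G) (\<lambda>g. a g - t g)" for a
  proof (induction ts arbitrary: a)
    case Nil
    then show ?case using exp_sup_contraction[OF assms, of G a t] by simp
  next
    case (Cons u us)
    let ?R = "rademacher_avg us (exp_sup G)"
    have "(?R (\<lambda>g. a g + u g + \<phi> (t g)) + ?R (\<lambda>g. a g + u g - \<phi> (t g))) +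
          (?R (\<lambda>g. a g - u g + \<phi> (t g)) + ?R (\<lambda>g. a g - u g - \<phi> (t g)))
      \<le> (?R (\<lambda>g. a g + u g + t g) + ?R (\<lambda>g. a g + u g - t g)) +
          (?R (\<lambda>g. a g - u g + t g) + ?R (\<lambda>g. a g - u g - t g))"
      by (intro add_mono Cons)
    then show ?case
      by (auto simp: add_divide_distrib_ennreal[symmetric] algebra_simps intro!: divide_right_mono_ennreal)
  qed
  have "rademacher_avg (map (\<lambda>t g. \<phi> (t g)) (t # ts)) (exp_sup G) a
      \<le> (rademacher_avg ts (exp_sup G) (\<lambda>g. a g + \<phi> (t g)) +
         rademacher_avg ts (exp_sup G) (\<lambda>g. a g - \<phi> (t g))) / 2"
    by (auto intro!: divide_right_mono_ennreal add_mono Cons)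
  also have "\<dots> \<le> rademacher_avg (t # ts) (exp_sup G) a"
    by (auto intro!: divide_right_mono_ennreal swap)
  finally show ?case .
qed simp

section \<open>Symmetrization\<close>

text \<open>The index set may be uncountable, but the superlevel sets of a supremum of continuous
  functions are unions of open sets.\<close>

lemma exp_sup_measurable:
  fixes a :: "'z::topological_space \<Rightarrow> 'g \<Rightarrow> real"
  assumes "\<And>g. g \<in> G \<Longrightarrow> continuous_on UNIV (\<lambda>z. a z g)"
  shows "(\<lambda>z. exp_sup G (a z)) \<in> borel_measurable borel"
proof (rule borel_measurableI_greater)
  fix c
  have "open {z. c < ennreal (exp (a z g))}" if "g \<in> G" for g
    using assms[OF that] by (intro open_Collect_less continuous_on_ennreal continuous_intros)
  then have "open (\<Union>g\<in>G. {z. c < ennreal (exp (a z g))})" by auto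
  also have "(\<Union>g\<in>G. {z. c < ennreal (exp (a z g))}) = {z. c < exp_sup G (a z)}"
    by (auto simp: exp_sup_def less_SUP_iff)
  finally show "{z \<in> space borel. c < exp_sup G (a z)} \<in> sets borel" by simp
qed

lemma rademacher_avg_measurable:
  fixes a :: "'z::topological_space \<Rightarrow> 'g \<Rightarrow> real"
  assumes "\<And>g. g \<in> G \<Longrightarrow> continuous_on UNIV (\<lambda>z. a z g)"
    and "\<And>g t. g \<in> G \<Longrightarrow> t \<in> set ts \<Longrightarrow> continuous_on UNIV (\<lambda>z. t z g)"
  shows "(\<lambda>z. rademacher_avg (map (\<lambda>t. t z) ts) (exp_sup G) (a z)) \<in> borel_measurable borel"
  using assms
proof (induction ts arbitrary: a)
  case Nil
  then show ?case by (simp add: exp_sup_measurable)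
next
  case (Cons t ts)
  have "(\<lambda>z. rademacher_avg (map (\<lambda>t. t z) ts) (exp_sup G) (\<lambda>g. a z g + t z g)) \<in> borel_measurable borel"
    "(\<lambda>z. rademacher_avg (map (\<lambda>t. t z) ts) (exp_sup G) (\<lambda>g. a z g - t z g)) \<in> borel_measurable borel"
    using Cons.prems by (auto intro!: Cons.IH continuous_intros)
  then show ?case by simp
qed

text \<open>Continuity arguments give measurability on the full product space, whose product sigma
  algebra is the Borel one since the index type is countable. A function of the coordinates in
  \<open>J\<close> is carried over to \<open>PiM J M\<close> by extending arguments with
  \<open>undefined\<close>.\<close>

lemma measurable_PiM_if_borel:
  fixes M :: "'j::countable \<Rightarrow> 'x::second_countable_topology measure" and f :: "('j \<Rightarrow> 'x) \<Rightarrow> ennreal"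
  assumes f: "f \<in> borel_measurable borel" and M: "\<And>j. sets (M j) = sets borel"
    and dep: "\<And>w v. (\<And>j. j \<in> J \<Longrightarrow> w j = v j) \<Longrightarrow> f w = f v"
  shows "f \<in> borel_measurable (PiM J M)"
proof -
  let ?E = "\<lambda>w j. if j \<in> J then w j else undefined"
  have sp: "space (M j) = UNIV" for j using sets_eq_imp_space_eq[OF M[of j]] by simp
  have sB: "sets (PiM UNIV (\<lambda>_::'j. borel :: 'x measure)) = sets borel" by (rule sets_PiM_equal_borel)
  have "(\<lambda>w. w j) \<in> PiM J M \<rightarrow>\<^sub>M borel" if "j \<in> J" for j
    using measurable_component_singleton[OF that, of M] by (simp add: measurable_cong_sets[OF refl M])
  then have "(\<lambda>w. ?E w j) \<in> PiM J M \<rightarrow>\<^sub>M borel" for j by (cases "j \<in> J") auto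
  then have "?E \<in> PiM J M \<rightarrow>\<^sub>M PiM UNIV (\<lambda>_. borel)"
    by (intro measurable_PiM_single') simp_all
  then have "?E \<in> PiM J M \<rightarrow>\<^sub>M borel" by (simp add: measurable_cong_sets[OF refl sB])
  from measurable_compose[OF this f] have "(\<lambda>w. f (?E w)) \<in> borel_measurable (PiM J M)" .
  moreover have "f (?E w) = f w" for w by (rule dep) simp
  ultimately show ?thesis by simp
qed

lemma ennreal_integral_le: "ennreal (\<integral>x. f x \<partial>M) \<le> (\<integral>\<^sup>+ x. ennreal (f x) \<partial>M)"
  by (cases "\<integral>\<^sup>+ x. ennreal (f x) \<partial>M") (auto intro!: ennreal_leI integral_real_bounded)

text \<open>Jensen's inequality, obtained by integrating the tangent of \<open>exp\<close> at the
  mean \<open>m\<close>. The right-hand side is a nonnegative integral and may be infinite.\<close>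

lemma exp_le_nn_integral_exp:
  assumes "prob_space \<mu>" "integrable \<mu> u" "(\<lambda>x. exp (u x)) \<in> borel_measurable \<mu>"
  shows "ennreal (exp (\<integral>x. u x \<partial>\<mu>)) \<le> (\<integral>\<^sup>+ x. ennreal (exp (u x)) \<partial>\<mu>)"
proof -
  interpret prob_space \<mu> by fact
  define m where "m = (\<integral>x. u x \<partial>\<mu>)"
  have "exp m = (\<integral>x. exp m * (1 + (u x - m)) \<partial>\<mu>)"
    using assms(2) by (simp add: m_def prob_space)
  also have "ennreal \<dots> \<le> (\<integral>\<^sup>+ x. ennreal (exp m * (1 + (u x - m))) \<partial>\<mu>)"
    by (rule ennreal_integral_le)
  also have "\<dots> \<le> (\<integral>\<^sup>+ x. ennreal (exp (u x)) \<partial>\<mu>)"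
  proof (intro nn_integral_mono ennreal_leI)
    fix x
    have "exp m * (1 + (u x - m)) \<le> exp m * exp (u x - m)"
      by (intro mult_left_mono) auto
    then show "exp m * (1 + (u x - m)) \<le> exp (u x)" by (simp flip: exp_add)
  qed
  finally show ?thesis by (simp add: m_def)
qed

text \<open>Centring is undone by an independent copy \<open>y'\<close>. Splitting
  \<open>c (g y - g y')\<close> by convexity then decouples \<open>y\<close> from \<open>y'\<close> and produces both signs at once.\<close>

lemma symmetrization_one_coordinate:
  fixes \<mu> :: "'x::topological_space measure"
  assumes \<mu>: "prob_space \<mu>" "sets \<mu> = sets borel"
    and G: "\<And>g. g \<in> G \<Longrightarrow> continuous_on UNIV g" "\<And>g x. g \<in> G \<Longrightarrow> \<bar>g x\<bar> \<le> 1"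
  shows "(\<integral>\<^sup>+ y. exp_sup G (\<lambda>g. a g + c * (g y - (\<integral>x. g x \<partial>\<mu>))) \<partial>\<mu>)
    \<le> (\<integral>\<^sup>+ y. (exp_sup G (\<lambda>g. a g + 2 * c * g y) + exp_sup G (\<lambda>g. a g - 2 * c * g y)) / 2 \<partial>\<mu>)"
proof -
  interpret prob_space \<mu> by fact
  define P N where "P y = exp_sup G (\<lambda>g. a g + 2 * c * g y)" and "N y = exp_sup G (\<lambda>g. a g - 2 * c * g y)" for y
  have ms: "borel_measurable \<mu> = borel_measurable (borel :: 'x measure)"
    by (intro measurable_cong_sets \<mu>) simp
  have m[measurable]: "P \<in> borel_measurable \<mu>" "N \<in> borel_measurable \<mu>"
    unfolding P_def N_def ms by (intro exp_sup_measurable continuous_intros G; assumption)+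
  have point: "exp_sup G (\<lambda>g. a g + c * (g y - (\<integral>x. g x \<partial>\<mu>))) \<le> (P y + (\<integral>\<^sup>+ x. N x \<partial>\<mu>)) / 2" for y
    unfolding exp_sup_def
  proof (rule SUP_least)
    fix g assume g: "g \<in> G"
    have gm[measurable]: "g \<in> borel_measurable \<mu>"
      unfolding ms using G(1)[OF g] by (rule borel_measurable_continuous_onI)
    have gi: "integrable \<mu> g"
      by (rule integrable_const_bound[where B = 1]) (use G(2)[OF g] in auto)
    have "ennreal (exp (a g + c * (g y - (\<integral>x. g x \<partial>\<mu>))))
        = ennreal (exp (\<integral>x. a g + c * (g y - g x) \<partial>\<mu>))"
      using gi by (simp add: prob_space)
    also have "\<dots> \<le> (\<integral>\<^sup>+ x. ennreal (exp (a g + c * (g y - g x))) \<partial>\<mu>)"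
      using gi by (intro exp_le_nn_integral_exp \<mu>) auto
    also have "\<dots> \<le> (\<integral>\<^sup>+ x. (P y + N x) / 2 \<partial>\<mu>)"
    proof (intro nn_integral_mono)
      fix x
      let ?u = "a g + 2 * c * g y" and ?v = "a g - 2 * c * g x"
      have "exp ((1/2) * ?u + (1/2) * ?v) \<le> (1/2) * exp ?u + (1/2) * exp ?v"
        using convex_onD[OF exp_convex, of "1/2" ?u ?v] by simp
      moreover have "(1/2) * ?u + (1/2) * ?v = a g + c * (g y - g x)" by (simp add: field_simps)
      ultimately have "exp (a g + c * (g y - g x)) \<le> (exp ?u + exp ?v) / 2" by simp
      then have "ennreal (exp (a g + c * (g y - g x))) \<le> ennreal ((exp ?u + exp ?v) / 2)"
        by (rule ennreal_leI)
      also have "\<dots> = (ennreal (exp ?u) + ennreal (exp ?v)) / 2"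
        by (simp add: divide_ennreal flip: ennreal_plus ennreal_numeral)
      also have "\<dots> \<le> (P y + N x) / 2"
        unfolding P_def N_def exp_sup_def
        by (intro divide_right_mono_ennreal add_mono SUP_upper[OF g])
      finally show "ennreal (exp (a g + c * (g y - g x))) \<le> (P y + N x) / 2" .
    qed
    also have "\<dots> = (P y + (\<integral>\<^sup>+ x. N x \<partial>\<mu>)) / 2"
      by (simp add: nn_integral_divide nn_integral_add emeasure_space_1)
    finally show "ennreal (exp (a g + c * (g y - (\<integral>x. g x \<partial>\<mu>)))) \<le> (P y + (\<integral>\<^sup>+ x. N x \<partial>\<mu>)) / 2" .
  qed
  have "(\<integral>\<^sup>+ y. exp_sup G (\<lambda>g. a g + c * (g y - (\<integral>x. g x \<partial>\<mu>))) \<partial>\<mu>)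
      \<le> (\<integral>\<^sup>+ y. (P y + (\<integral>\<^sup>+ x. N x \<partial>\<mu>)) / 2 \<partial>\<mu>)"
    by (intro nn_integral_mono point)
  \<comment> \<open>Both copies have the law \<open>\<mu>\<close>, so after decoupling the integral
    of \<open>N\<close> over the second copy can be taken over \<open>y\<close> again.\<close>
  also have "\<dots> = (\<integral>\<^sup>+ y. (P y + N y) / 2 \<partial>\<mu>)"
    by (simp add: nn_integral_divide nn_integral_add emeasure_space_1)
  finally show ?thesis unfolding P_def N_def .
qed

text \<open>Coordinates are treated one at a time. The first one is symmetrized while the centred
  sum of the others sits in the offset; then the other coordinates are symmetrized with
  \<open>w j\<close> fixed, which needs the induction hypothesis for a shifted offset. Hence the
  arbitrary \<open>a\<close>. The weights \<open>c j\<close> admit opposite signs for the two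
  samples.\<close>

lemma symmetrization:
  fixes M :: "'j::countable \<Rightarrow> 'x::second_countable_topology measure"
  assumes M: "\<And>j. prob_space (M j)" "\<And>j. sets (M j) = sets borel"
    and G: "\<And>g. g \<in> G \<Longrightarrow> continuous_on UNIV g" "\<And>g x. g \<in> G \<Longrightarrow> \<bar>g x\<bar> \<le> 1"
    and "distinct js"
  shows "(\<integral>\<^sup>+ w. exp_sup G (\<lambda>g. a g + (\<Sum>j\<in>set js. c j * (g (w j) - (\<integral>x. g x \<partial>M j)))) \<partial>PiM (set js) M)
    \<le> (\<integral>\<^sup>+ w. rademacher_avg (map (\<lambda>j g. 2 * c j * g (w j)) js) (exp_sup G) a \<partial>PiM (set js) M)"
  using \<open>distinct js\<close>
proof (induction js arbitrary: a)
  case Nil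
  then show ?case by simp
next
  case (Cons j js)
  interpret product_sigma_finite M
    using M(1) by (intro product_sigma_finite.intro prob_space_imp_sigma_finite)
  have cont: "continuous_on UNIV (\<lambda>w :: 'j \<Rightarrow> 'x. g (w j))" if "g \<in> G" for g j
    using continuous_on_compose2[OF G(1)[OF that] continuous_on_product_coordinates] by simp
  define R where "R a w = rademacher_avg (map (\<lambda>j g. 2 * c j * g (w j)) js) (exp_sup G) a" for a and w :: "'j \<Rightarrow> 'x"
  define S where "S w = (\<lambda>g. \<Sum>j\<in>set js. c j * (g (w j) - (\<integral>x. g x \<partial>M j)))" for w :: "'j \<Rightarrow> 'x"
  let ?I = "set js"
  have j: "j \<notin> ?I" "distinct js" using Cons.prems by auto
  have rad_meas: "(\<lambda>w :: 'j \<Rightarrow> 'x. rademacher_avg (map (\<lambda>j g. 2 * c j * g (w j)) ls) (exp_sup G) (b w)) \<in> borel_measurable borel"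
    if "\<And>g. g \<in> G \<Longrightarrow> continuous_on UNIV (\<lambda>w. b w g)" for ls b
  proof -
    have "(\<lambda>w. rademacher_avg (map (\<lambda>t. t w) (map (\<lambda>j w g. 2 * c j * g (w j)) ls)) (exp_sup G) (b w))
        \<in> borel_measurable borel"
    proof (rule rademacher_avg_measurable)
      fix g and t :: "('j \<Rightarrow> 'x) \<Rightarrow> ('x \<Rightarrow> real) \<Rightarrow> real" assume "g \<in> G" "t \<in> set (map (\<lambda>j w g. 2 * c j * g (w j)) ls)"
      then show "continuous_on UNIV (\<lambda>z. t z g)"
        by auto (intro continuous_on_mult continuous_on_const cont, assumption)
    qed (rule that)
    then show ?thesis by (simp add: comp_def)
  qed
  have es_meas: "(\<lambda>w. exp_sup G (\<lambda>g. b g + f g * g (w j) + S w g)) \<in> borel_measurable borel" for b f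
    unfolding S_def by (intro exp_sup_measurable continuous_on_add continuous_on_sum
      continuous_on_mult continuous_on_diff continuous_on_const cont)
  have S_upd: "S (w(j := y)) = S w" for w y
    using j unfolding S_def by (intro ext sum.cong) auto
  have R_upd: "R b (w(j := y)) = R b w" for b w y
    unfolding R_def using j by (intro arg_cong2[where f = "\<lambda>l. rademacher_avg l _"] map_cong) auto
  have R_cong: "R b w = R b v" if "\<And>i. i \<in> ?I \<Longrightarrow> w i = v i" for b w v
    unfolding R_def using that by (intro arg_cong2[where f = "\<lambda>l. rademacher_avg l _"] map_cong) auto
  have es_meas': "(\<lambda>w. exp_sup G (\<lambda>g. b g + f g * g (w j) + S w g)) \<in> borel_measurable (PiM (insert j ?I) M)" for b f
    using es_meas by (rule measurable_PiM_if_borel[OF _ M(2)]) (simp add: S_def)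
  note es_minus = es_meas'[of a "\<lambda>_. - 2 * c j", simplified]
  have R_meas: "R b \<in> borel_measurable (PiM ?I M)" for b
    unfolding R_def by (rule measurable_PiM_if_borel[OF rad_meas M(2)])
      (auto intro!: arg_cong2[where f = "\<lambda>l. rademacher_avg l _"])
  have R_meas2: "(\<lambda>w. R (\<lambda>g. a g + e * (2 * c j * g (w j))) w) \<in> borel_measurable (PiM (insert j ?I) M)" for e
  proof (rule measurable_PiM_if_borel[OF _ M(2)])
    show "(\<lambda>w. R (\<lambda>g. a g + e * (2 * c j * g (w j))) w) \<in> borel_measurable borel"
      unfolding R_def
      by (rule rad_meas) (intro continuous_on_add continuous_on_mult continuous_on_const cont, assumption)
    show "R (\<lambda>g. a g + e * (2 * c j * g (w j))) w = R (\<lambda>g. a g + e * (2 * c j * g (v j))) v"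
      if "\<And>i. i \<in> insert j ?I \<Longrightarrow> w i = v i" for w v
      using that R_cong[of w v] by simp
  qed
  have "(\<integral>\<^sup>+ w. exp_sup G (\<lambda>g. a g + (\<Sum>j\<in>set (j # js). c j * (g (w j) - (\<integral>x. g x \<partial>M j)))) \<partial>PiM (set (j # js)) M)
     = (\<integral>\<^sup>+ w. exp_sup G (\<lambda>g. (a g - c j * (\<integral>x. g x \<partial>M j)) + c j * g (w j) + S w g) \<partial>PiM (insert j ?I) M)"
    using j by (simp add: S_def algebra_simps)
  also have "\<dots> = (\<integral>\<^sup>+ w. (\<integral>\<^sup>+ y. exp_sup G (\<lambda>g. (a g - c j * (\<integral>x. g x \<partial>M j)) + c j * g y + S w g) \<partial>M j) \<partial>PiM ?I M)"
    using j by (subst product_nn_integral_insert[OF _ _ es_meas']) (simp_all add: S_upd)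
  also have "\<dots> = (\<integral>\<^sup>+ w. (\<integral>\<^sup>+ y. exp_sup G (\<lambda>g. (a g + S w g) + c j * (g y - (\<integral>x. g x \<partial>M j))) \<partial>M j) \<partial>PiM ?I M)"
    by (simp add: algebra_simps)
  also have "\<dots> \<le> (\<integral>\<^sup>+ w. (\<integral>\<^sup>+ y. (exp_sup G (\<lambda>g. (a g + S w g) + 2 * c j * g y) + exp_sup G (\<lambda>g. (a g + S w g) - 2 * c j * g y)) / 2 \<partial>M j) \<partial>PiM ?I M)"
    by (intro nn_integral_mono symmetrization_one_coordinate M G)
  also have "\<dots> = (\<integral>\<^sup>+ w. (\<integral>\<^sup>+ y. (exp_sup G (\<lambda>g. a g + 2 * c j * g y + S w g) + exp_sup G (\<lambda>g. a g + (- 2 * c j) * g y + S w g)) / 2 \<partial>M j) \<partial>PiM ?I M)"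
    by (simp add: algebra_simps)
  also have "\<dots> = (\<integral>\<^sup>+ w. (exp_sup G (\<lambda>g. a g + 2 * c j * g (w j) + S w g) + exp_sup G (\<lambda>g. a g + (- 2 * c j) * g (w j) + S w g)) / 2 \<partial>PiM (insert j ?I) M)"
    using j by (subst product_nn_integral_insert) (auto simp: S_upd intro!: borel_measurable_add borel_measurable_divide_ennreal es_meas' es_minus)
  \<comment> \<open>Fubini: the remaining coordinates become the inner integral, where the induction
    hypothesis applies for every fixed value \<open>y\<close> of coordinate
    \<open>j\<close>.\<close>
  also have "\<dots> = (\<integral>\<^sup>+ y. (\<integral>\<^sup>+ w. (exp_sup G (\<lambda>g. a g + 2 * c j * g y + S w g) + exp_sup G (\<lambda>g. a g + (- 2 * c j) * g y + S w g)) / 2 \<partial>PiM ?I M) \<partial>M j)"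
    using j by (subst product_nn_integral_insert_rev) (auto simp: S_upd intro!: borel_measurable_add borel_measurable_divide_ennreal es_meas' es_minus)
  also have "\<dots> \<le> (\<integral>\<^sup>+ y. (\<integral>\<^sup>+ w. (R (\<lambda>g. a g + 2 * c j * g y) w + R (\<lambda>g. a g - 2 * c j * g y) w) / 2 \<partial>PiM ?I M) \<partial>M j)"
  proof (rule nn_integral_mono)
    fix y
    have mS: "(\<lambda>w. exp_sup G (\<lambda>g. b g + S w g)) \<in> borel_measurable (PiM ?I M)" for b
    proof (rule measurable_PiM_if_borel[OF _ M(2)])
      show "(\<lambda>w. exp_sup G (\<lambda>g. b g + S w g)) \<in> borel_measurable borel"
        unfolding S_def by (intro exp_sup_measurable continuous_on_add continuous_on_sum
          continuous_on_mult continuous_on_diff continuous_on_const cont)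
    qed (simp add: S_def)
    have "(\<integral>\<^sup>+ w. (exp_sup G (\<lambda>g. a g + 2 * c j * g y + S w g) + exp_sup G (\<lambda>g. a g + (- 2 * c j) * g y + S w g)) / 2 \<partial>PiM ?I M)
       = ((\<integral>\<^sup>+ w. exp_sup G (\<lambda>g. (a g + 2 * c j * g y) + S w g) \<partial>PiM ?I M)
         + (\<integral>\<^sup>+ w. exp_sup G (\<lambda>g. (a g + (- 2 * c j) * g y) + S w g) \<partial>PiM ?I M)) / 2"
      using mS[of "\<lambda>g. a g + 2 * c j * g y"] mS[of "\<lambda>g. a g - 2 * c j * g y"]
      by (simp add: nn_integral_divide nn_integral_add)
    also have "\<dots> \<le> ((\<integral>\<^sup>+ w. R (\<lambda>g. a g + 2 * c j * g y) w \<partial>PiM ?I M) + (\<integral>\<^sup>+ w. R (\<lambda>g. a g + (- 2 * c j) * g y) w \<partial>PiM ?I M)) / 2"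
      unfolding S_def R_def by (intro divide_right_mono_ennreal add_mono Cons.IH j)
    also have "\<dots> = (\<integral>\<^sup>+ w. (R (\<lambda>g. a g + 2 * c j * g y) w + R (\<lambda>g. a g - 2 * c j * g y) w) / 2 \<partial>PiM ?I M)"
      using R_meas[of "\<lambda>g. a g + 2 * c j * g y"] R_meas[of "\<lambda>g. a g - 2 * c j * g y"]
      by (simp add: nn_integral_divide nn_integral_add)
    finally show "(\<integral>\<^sup>+ w. (exp_sup G (\<lambda>g. a g + 2 * c j * g y + S w g) + exp_sup G (\<lambda>g. a g + (- 2 * c j) * g y + S w g)) / 2 \<partial>PiM ?I M)
      \<le> \<dots>" .
  qed
  also have "\<dots> = (\<integral>\<^sup>+ w. (R (\<lambda>g. a g + 1 * (2 * c j * g (w j))) w + R (\<lambda>g. a g + (-1) * (2 * c j * g (w j))) w) / 2 \<partial>PiM (insert j ?I) M)"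
    using j by (subst product_nn_integral_insert_rev) (auto simp: R_upd intro!: borel_measurable_add borel_measurable_divide_ennreal
        R_meas2[of 1, simplified] R_meas2[of "-1", simplified])
  finally show ?case by (simp add: R_def)
qed

lemma exp_sup_image: "exp_sup (F ` H) a = exp_sup H (\<lambda>h. a (F h))"
  by (simp add: exp_sup_def image_image)

lemma rademacher_avg_image:
  "rademacher_avg ts (exp_sup (F ` H)) a = rademacher_avg (map (\<lambda>t h. t (F h)) ts) (exp_sup H) (\<lambda>h. a (F h))"
  by (induction ts arbitrary: a) (simp_all add: exp_sup_image)

text \<open>A factor -1 only exchanges the two branches of an average. This removes the opposite
  signs of the two samples, which then act as one sample of size \<open>2 * n\<close>.\<close>

lemma rademacher_avg_signs:
  assumes "\<And>j. j \<in> set js \<Longrightarrow> s j = 1 \<or> s j = (-1::real)"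
  shows "rademacher_avg (map (\<lambda>j g. s j * t j g) js) \<Phi> a = rademacher_avg (map t js) \<Phi> a"
  using assms
proof (induction js arbitrary: a)
  case (Cons j js)
  have IH: "rademacher_avg (map (\<lambda>j g. s j * t j g) js) \<Phi> b = rademacher_avg (map t js) \<Phi> b" for b
    using Cons by simp
  have "s j = 1 \<or> s j = -1" using Cons.prems by simp
  then show ?case by (auto simp: IH add.commute)
qed simp

lemma rademacher_avg_scale:
  "rademacher_avg (map (\<lambda>t g. c * t g) ts) \<Phi> (\<lambda>g. c * a g) = rademacher_avg ts (\<lambda>a. \<Phi> (\<lambda>g. c * a g)) a"
  by (rule rademacher_avg_map) (simp_all add: algebra_simps)

section \<open>Networks and the hull of ridge functions\<close>

definition clip :: "real \<Rightarrow> real" where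
  "clip z = max (- 1) (min 1 z)"

lemma clip_simps [simp]: "clip 0 = 0" "\<bar>clip z\<bar> \<le> 1"
  by (auto simp: clip_def)

lemma clip_lipschitz: "\<bar>clip x - clip y\<bar> \<le> \<bar>x - y\<bar>"
  by (auto simp: clip_def)

lemma clip_id: "\<bar>z\<bar> \<le> 1 \<Longrightarrow> clip z = z"
  by (auto simp: clip_def)

lemma clipped_nets_eq: "clipped_nets k a1 a2 a3 a4 \<phi> = (\<lambda>g x. clip (g x)) ` nets k a1 a2 a3 a4 \<phi>"
  by (simp add: clipped_nets_def clip_def)

definition ridge :: "(real \<Rightarrow> real) \<Rightarrow> (real ^ 'd \<Rightarrow> real) set" where
  "ridge \<phi> = {\<lambda>x. \<phi> (w \<bullet> x + b) | w b. norm1 w \<le> 1 \<and> \<bar>b\<bar> \<le> 1}"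

definition ridge_sum :: "(real \<Rightarrow> real) \<Rightarrow> (real \<times> (real ^ 'd) \<times> real) list \<Rightarrow> real ^ 'd \<Rightarrow> real" where
  "ridge_sum \<phi> ps x = (\<Sum>(\<gamma>, w, b)\<leftarrow>ps. \<gamma> * \<phi> (w \<bullet> x + b))"

definition ridge_params :: "real \<Rightarrow> (real \<times> (real ^ 'd) \<times> real) list \<Rightarrow> bool" where
  "ridge_params B ps \<longleftrightarrow> (\<forall>(\<gamma>, w, b)\<in>set ps. norm1 w \<le> 1 \<and> \<bar>b\<bar> \<le> 1) \<and> (\<Sum>(\<gamma>, w, b)\<leftarrow>ps. \<bar>\<gamma>\<bar>) \<le> B"

text \<open>\<open>B\<close> times the absolutely convex hull of \<open>ridge \<phi>\<close>. The
  number of units is left free: the deviation bound depends on the total weight alone.\<close>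

definition ridge_hull :: "real \<Rightarrow> (real \<Rightarrow> real) \<Rightarrow> (real ^ 'd \<Rightarrow> real) set" where
  "ridge_hull B \<phi> = {ridge_sum \<phi> ps | ps. ridge_params B ps}"

lemma ridge_sum_simps [simp]:
  "ridge_sum \<phi> [] x = 0"
  "ridge_sum \<phi> ((\<gamma>, w, b) # ps) x = \<gamma> * \<phi> (w \<bullet> x + b) + ridge_sum \<phi> ps x"
  "ridge_sum \<phi> (ps @ qs) x = ridge_sum \<phi> ps x + ridge_sum \<phi> qs x"
  by (simp_all add: ridge_sum_def)

lemma norm1_nonneg: "0 \<le> norm1 w"
  by (simp add: norm1_def sum_nonneg)

lemma norm1_zero [simp]: "norm1 0 = 0"
  by (simp add: norm1_def)

lemma norm1_scale: "norm1 (c *\<^sub>R w) = \<bar>c\<bar> * norm1 w"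
  by (simp add: norm1_def abs_mult sum_distrib_left)

lemma norm1_triangle: "norm1 (v + w) \<le> norm1 v + norm1 w"
  by (simp add: norm1_def sum.distrib[symmetric] sum_mono)

lemma inner_abs_le_norm1:
  assumes "\<And>i. \<bar>x $ i\<bar> \<le> 1"
  shows "\<bar>w \<bullet> x\<bar> \<le> norm1 w"
proof -
  have "\<bar>w \<bullet> x\<bar> \<le> (\<Sum>i\<in>UNIV. \<bar>w $ i * x $ i\<bar>)" unfolding inner_vec_def by (simp add: sum_abs)
  also have "\<dots> \<le> norm1 w" unfolding norm1_def
    using assms by (intro sum_mono) (simp add: abs_mult mult_left_le)
  finally show ?thesis .
qed

text \<open>Signed sums of point evaluations are linear in the evaluated function, and linearity is
  what pushes a supremum over a hull to its generators.\<close>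

definition additive_functional :: "(('x \<Rightarrow> real) \<Rightarrow> real) \<Rightarrow> bool" where
  "additive_functional A \<longleftrightarrow> (\<forall>f g. A (\<lambda>x. f x + g x) = A f + A g) \<and> (\<forall>c f. A (\<lambda>x. c * f x) = c * A f)"

lemma additive_functional_zero:
  assumes "additive_functional A"
  shows "A (\<lambda>x. 0) = 0"
proof -
  have "\<forall>c f. A (\<lambda>x. c * f x) = c * A f" using assms by (simp add: additive_functional_def)
  from this[rule_format, of 0 "\<lambda>_. 0"] show ?thesis by simp
qed

lemma additive_functional_sum:
  assumes "additive_functional A"
  shows "A (\<lambda>x. \<Sum>i\<in>I. f i x) = (\<Sum>i\<in>I. A (f i))"
proof -
  show ?thesis
    using assms additive_functional_zero[OF assms] by (induction I rule: infinite_finite_induct) (simp_all add: additive_functional_def)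
qed

lemma additive_functional_ridge_sum:
  assumes "additive_functional A"
  shows "A (ridge_sum \<phi> ps) = (\<Sum>(\<gamma>, w, b)\<leftarrow>ps. \<gamma> * A (\<lambda>x. \<phi> (w \<bullet> x + b)))"
proof (induction ps)
  case Nil
  then show ?case by (simp add: ridge_sum_def additive_functional_zero[OF assms])
next
  case (Cons p ps)
  obtain \<gamma> w b where p: "p = (\<gamma>, w, b)" by (cases p)
  have "ridge_sum \<phi> (p # ps) = (\<lambda>x. \<gamma> * \<phi> (w \<bullet> x + b) + ridge_sum \<phi> ps x)"
    by (simp add: fun_eq_iff p)
  then have "A (ridge_sum \<phi> (p # ps)) = A (\<lambda>x. \<gamma> * \<phi> (w \<bullet> x + b)) + A (ridge_sum \<phi> ps)"
    using assms by (simp add: additive_functional_def)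
  then show ?case using assms Cons by (simp add: p additive_functional_def)
qed

lemma sum_list_weighted_le:
  fixes f :: "'a \<Rightarrow> real"
  assumes "\<And>x. x \<in> set xs \<Longrightarrow> \<bar>f x\<bar> \<le> m" "0 \<le> m"
  shows "\<bar>\<Sum>x\<leftarrow>xs. c x * f x\<bar> \<le> (\<Sum>x\<leftarrow>xs. \<bar>c x\<bar>) * m"
  using assms(1)
proof (induction xs)
  case (Cons x xs)
  have "\<bar>c x * f x\<bar> \<le> \<bar>c x\<bar> * m" using Cons.prems by (simp add: abs_mult mult_left_mono)
  moreover have "\<bar>\<Sum>x\<leftarrow>xs. c x * f x\<bar> \<le> (\<Sum>x\<leftarrow>xs. \<bar>c x\<bar>) * m" using Cons by auto
  ultimately show ?case by (simp add: algebra_simps)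
qed simp

lemma finite_obtains_max:
  fixes f :: "'a \<Rightarrow> real"
  assumes "finite S" "S \<noteq> {}"
  obtains x where "x \<in> S" "\<And>y. y \<in> S \<Longrightarrow> f y \<le> f x"
proof -
  have "Max (f ` S) \<in> f ` S" using assms by (intro Max_in) auto
  then obtain x where "x \<in> S" "f x = Max (f ` S)" by auto
  then show ?thesis using assms by (intro that[of x]) auto
qed

text \<open>A linear functional on a combination of total weight \<open>B\<close> is at most
  \<open>B\<close> times its largest absolute value on the generators. The two terms on the right
  account for the sign of that value.\<close>

lemma exp_sup_ridge_hull_le:
  fixes A :: "(real ^ 'd \<Rightarrow> real) \<Rightarrow> real"
  assumes A: "additive_functional A" and B: "0 \<le> B"
  shows "exp_sup (ridge_hull B \<phi>) A \<le> exp_sup (ridge \<phi>) (\<lambda>h. B * A h) + exp_sup (ridge \<phi>) (\<lambda>h. - B * A h)"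
  unfolding exp_sup_def[of "ridge_hull B \<phi>"]
proof (rule SUP_least)
  fix h :: "real ^ 'd \<Rightarrow> real" assume "h \<in> ridge_hull B \<phi>"
  then obtain ps :: "(real \<times> (real ^ 'd) \<times> real) list" where h: "h = ridge_sum \<phi> ps" and ps: "ridge_params B ps"
    unfolding ridge_hull_def by auto
  define F where "F = (\<lambda>(\<gamma>::real, w::real^'d, b). \<bar>A (\<lambda>x. \<phi> (w \<bullet> x + b))\<bar>)"
  \<comment> \<open>The extra parameter triple is admissible and makes the maximum exist for an
    empty combination too.\<close>
  let ?T = "insert (0, 0, 0) (set ps)"
  obtain q where q: "q \<in> ?T" and max: "\<And>p. p \<in> ?T \<Longrightarrow> F p \<le> F q"
    using finite_obtains_max[of ?T F] by auto
  obtain \<gamma> w b where q': "q = (\<gamma>, w, b)" by (cases q)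
  have wb: "norm1 w \<le> 1" "\<bar>b\<bar> \<le> 1"
    using q ps unfolding q' ridge_params_def by auto
  let ?f = "\<lambda>x. \<phi> (w \<bullet> x + b)"
  have f: "?f \<in> ridge \<phi>" unfolding ridge_def using wb by blast
  have "A h = (\<Sum>p\<leftarrow>ps. fst p * A (\<lambda>x. \<phi> (fst (snd p) \<bullet> x + snd (snd p))))"
    by (simp add: h additive_functional_ridge_sum[OF A] case_prod_unfold)
  also have "\<dots> \<le> \<bar>\<dots>\<bar>" by simp
  also have "\<dots> \<le> (\<Sum>p\<leftarrow>ps. \<bar>fst p\<bar>) * F q"
  proof (rule sum_list_weighted_le)
    fix p assume "p \<in> set ps"
    then have "F p \<le> F q" by (intro max) simp
    then show "\<bar>A (\<lambda>x. \<phi> (fst (snd p) \<bullet> x + snd (snd p)))\<bar> \<le> F q"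
      by (simp add: F_def case_prod_unfold)
  qed (simp add: F_def q')
  also have "\<dots> \<le> B * F q"
    using ps by (intro mult_right_mono) (simp_all add: ridge_params_def case_prod_unfold F_def)
  finally have "exp (A h) \<le> exp (B * \<bar>A ?f\<bar>)" by (simp add: F_def q')
  also have "\<dots> \<le> exp (B * A ?f) + exp (- B * A ?f)"
    by (cases "A ?f \<ge> 0") (auto intro: add_increasing add_increasing2)
  finally have "ennreal (exp (A h)) \<le> ennreal (exp (B * A ?f)) + ennreal (exp (- B * A ?f))"
    by (simp flip: ennreal_plus)
  also have "\<dots> \<le> exp_sup (ridge \<phi>) (\<lambda>h. B * A h) + exp_sup (ridge \<phi>) (\<lambda>h. - B * A h)"
    unfolding exp_sup_def by (intro add_mono SUP_upper[OF f])
  finally show "ennreal (exp (A h)) \<le> \<dots>" .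
qed

definition affine_basis :: "'d option \<Rightarrow> real ^ 'd \<Rightarrow> real" where
  "affine_basis p x = (case p of None \<Rightarrow> 1 | Some i \<Rightarrow> x $ i)"

text \<open>An affine function with \<open>norm1 w \<le> 1\<close> and
  \<open>\<bar>b\<bar> \<le> 1\<close> has coefficients of total weight at most 2 in the constant
  and the coordinate functions. Hence the factor 2, and a maximum over finitely many functions,
  which is bounded by the sum.\<close>

lemma exp_sup_ridge_id_le:
  fixes A :: "(real ^ 'd \<Rightarrow> real) \<Rightarrow> real"
  assumes A: "additive_functional A"
  shows "exp_sup (ridge (\<lambda>z. z)) A
    \<le> (\<Sum>p\<in>UNIV. ennreal (exp (2 * A (affine_basis p))) + ennreal (exp (- 2 * A (affine_basis p))))"
  unfolding exp_sup_def
proof (rule SUP_least)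
  fix h :: "real ^ 'd \<Rightarrow> real" assume "h \<in> ridge (\<lambda>z. z)"
  then obtain w :: "real ^ 'd" and b where h: "h = (\<lambda>x. w \<bullet> x + b)" and wb: "norm1 w \<le> 1" "\<bar>b\<bar> \<le> 1"
    unfolding ridge_def by auto
  obtain q :: "'d option" where max: "\<And>p. \<bar>A (affine_basis p)\<bar> \<le> \<bar>A (affine_basis q)\<bar>"
    using finite_obtains_max[of UNIV "\<lambda>p. \<bar>A (affine_basis p)\<bar>"] by auto
  let ?a = "A (affine_basis q)"
  have "h = (\<lambda>x. (\<Sum>i\<in>UNIV. w $ i * affine_basis (Some i) x) + b * affine_basis None x)"
    by (simp add: h inner_vec_def affine_basis_def)
  then have "A h = A (\<lambda>x. \<Sum>i\<in>UNIV. w $ i * affine_basis (Some i) x) + A (\<lambda>x. b * affine_basis None x)"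
    using A by (simp add: additive_functional_def)
  also have "\<dots> = (\<Sum>i\<in>UNIV. w $ i * A (affine_basis (Some i))) + b * A (affine_basis None)"
    using A by (simp add: additive_functional_sum[OF A] additive_functional_def)
  also have "\<dots> \<le> (\<Sum>i\<in>UNIV. \<bar>w $ i\<bar> * \<bar>?a\<bar>) + \<bar>b\<bar> * \<bar>?a\<bar>"
  proof (intro add_mono sum_mono)
    have "u * A (affine_basis p) \<le> \<bar>u\<bar> * \<bar>?a\<bar>" for u p
      using mult_left_mono[OF max[of p] abs_ge_zero[of u]] abs_ge_self[of "u * A (affine_basis p)"]
      by (simp add: abs_mult)
    then show "w $ i * A (affine_basis (Some i)) \<le> \<bar>w $ i\<bar> * \<bar>?a\<bar>"
      "b * A (affine_basis None) \<le> \<bar>b\<bar> * \<bar>?a\<bar>" for i by blast+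
  qed
  also have "\<dots> = norm1 w * \<bar>?a\<bar> + \<bar>b\<bar> * \<bar>?a\<bar>" by (simp add: norm1_def sum_distrib_right)
  also have "\<dots> \<le> 1 * \<bar>?a\<bar> + 1 * \<bar>?a\<bar>" using wb by (intro add_mono mult_right_mono) auto
  finally have "exp (A h) \<le> exp (2 * \<bar>?a\<bar>)" by simp
  also have "\<dots> \<le> exp (2 * ?a) + exp (- 2 * ?a)"
    by (cases "?a \<ge> 0") (auto intro: add_increasing add_increasing2)
  finally have "ennreal (exp (A h)) \<le> ennreal (exp (2 * ?a)) + ennreal (exp (- 2 * ?a))"
    by (simp flip: ennreal_plus)
  also have "\<dots> \<le> (\<Sum>p\<in>UNIV. ennreal (exp (2 * A (affine_basis p))) + ennreal (exp (- 2 * A (affine_basis p))))"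
    by (rule member_le_sum[where f = "\<lambda>p. ennreal (exp (2 * A (affine_basis p))) + ennreal (exp (- 2 * A (affine_basis p)))"]) auto
  finally show "ennreal (exp (A h)) \<le> \<dots>" .
qed

text \<open>After the reduction to \<open>CARD('d) + 1\<close> basis functions and two signs,
  Hoeffding's bound applies to each of them. All basis functions are at most 1 in absolute value on
  the cube, so each sample point contributes at most \<open>(2 * c)\<^sup>2 / 2\<close>.\<close>

lemma rademacher_avg_affine_le:
  fixes xs :: "(real ^ 'd) list"
  assumes xs: "\<And>x. x \<in> set xs \<Longrightarrow> x \<in> unit_cube"
  shows "rademacher_avg (map (\<lambda>x h. c * h x) xs) (exp_sup (ridge (\<lambda>z. z))) (\<lambda>_. 0)
    \<le> ennreal (2 * (real CARD('d) + 1) * exp (2 * c\<^sup>2 * length xs))"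
proof -
  let ?ts = "map (\<lambda>x h. c * h x) xs :: ((real ^ 'd \<Rightarrow> real) \<Rightarrow> real) list"
  let ?L = "\<lambda>e p a. ennreal (exp (e * a (affine_basis p)))"
  have "rademacher_avg ?ts (exp_sup (ridge (\<lambda>z. z))) (\<lambda>_. 0)
      \<le> rademacher_avg ?ts (\<lambda>a. \<Sum>p\<in>UNIV. ?L 2 p a + ?L (- 2) p a) (\<lambda>_. 0)"
  proof (rule rademacher_avg_mono[where P = additive_functional])
    show "exp_sup (ridge (\<lambda>z. z)) A \<le> (\<Sum>p\<in>UNIV. ?L 2 p A + ?L (- 2) p A)"
      if "additive_functional A" for A :: "(real ^ 'd \<Rightarrow> real) \<Rightarrow> real"
      using exp_sup_ridge_id_le[OF that] by simp
  qed (auto simp: additive_functional_def algebra_simps)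
  also have "\<dots> = (\<Sum>p\<in>UNIV. rademacher_avg ?ts (?L 2 p) (\<lambda>_. 0) + rademacher_avg ?ts (?L (- 2) p) (\<lambda>_. 0))"
    by (simp add: rademacher_avg_sum rademacher_avg_add)
  also have "\<dots> \<le> (\<Sum>p\<in>(UNIV :: 'd option set). ennreal (exp (2 * c\<^sup>2 * length xs)) + ennreal (exp (2 * c\<^sup>2 * length xs)))"
  proof (intro sum_mono add_mono)
    fix p :: "'d option"
    have b: "\<bar>affine_basis p x\<bar> \<le> 1" if "x \<in> unit_cube" for x
      using that by (auto simp: affine_basis_def unit_cube_def split: option.split)
    have "rademacher_avg ?ts (?L e p) (\<lambda>_. 0) \<le> ennreal (exp (2 * c\<^sup>2 * length xs))" if "e\<^sup>2 = 4" for e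
    proof -
      have "(\<Sum>t\<leftarrow>?ts. (e * t (affine_basis p))\<^sup>2 / 2) = (\<Sum>x\<leftarrow>xs. 2 * c\<^sup>2 * (affine_basis p x)\<^sup>2)"
        using that by (simp add: comp_def power_mult_distrib mult.assoc)
      also have "\<dots> \<le> (\<Sum>x\<leftarrow>xs. 2 * c\<^sup>2 * 1)"
        using b xs by (intro sum_list_mono mult_left_mono) (auto simp: abs_square_le_1)
      also have "\<dots> = 2 * c\<^sup>2 * length xs" by (simp add: sum_list_triv)
      finally show ?thesis
        by (intro order_trans[OF rademacher_avg_exp_le] ennreal_leI) simp
    qed
    from this[of 2] this[of "-2"]
    show "rademacher_avg ?ts (?L 2 p) (\<lambda>_. 0) \<le> ennreal (exp (2 * c\<^sup>2 * length xs))"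
      "rademacher_avg ?ts (?L (- 2) p) (\<lambda>_. 0) \<le> ennreal (exp (2 * c\<^sup>2 * length xs))" by simp_all
  qed
  also have "\<dots> = ennreal (2 * (real CARD('d) + 1) * exp (2 * c\<^sup>2 * length xs))"
    by (simp add: ennreal_of_nat_eq_real_of_nat card_UNIV_option algebra_simps flip: ennreal_plus ennreal_mult)
  finally show ?thesis .
qed

lemma rademacher_avg_ridge_le:
  fixes xs :: "(real ^ 'd) list" and \<phi> :: "real \<Rightarrow> real"
  assumes xs: "\<And>x. x \<in> set xs \<Longrightarrow> x \<in> unit_cube"
    and \<phi>: "\<phi> 0 = 0" "\<And>x y. \<bar>\<phi> x - \<phi> y\<bar> \<le> \<bar>x - y\<bar>" and "c \<noteq> 0"
  shows "rademacher_avg (map (\<lambda>x h. c * h x) xs) (exp_sup (ridge \<phi>)) (\<lambda>_. 0)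
    \<le> ennreal (2 * (real CARD('d) + 1) * exp (2 * c\<^sup>2 * length xs))"
proof -
  \<comment> \<open>Rescaling by \<open>\<bar>c\<bar>\<close> keeps the Lipschitz constant at 1, and
    the sign of \<open>c\<close> is absorbed into \<open>\<psi>\<close>.\<close>
  define \<psi> where "\<psi> u = c * \<phi> (u / \<bar>c\<bar>)" for u
  have lip: "\<bar>\<psi> u - \<psi> v\<bar> \<le> \<bar>u - v\<bar>" for u v
  proof -
    have "\<bar>\<psi> u - \<psi> v\<bar> = \<bar>c\<bar> * \<bar>\<phi> (u / \<bar>c\<bar>) - \<phi> (v / \<bar>c\<bar>)\<bar>"
      by (simp add: \<psi>_def flip: abs_mult right_diff_distrib)
    also have "\<dots> \<le> \<bar>c\<bar> * \<bar>u / \<bar>c\<bar> - v / \<bar>c\<bar>\<bar>" by (intro mult_left_mono \<phi>) auto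
    also have "\<dots> = \<bar>u - v\<bar>" using \<open>c \<noteq> 0\<close> by (simp add: diff_divide_distrib[symmetric])
    finally show ?thesis .
  qed
  have "ridge \<phi> = (\<lambda>h x. \<phi> (h x)) ` (ridge (\<lambda>z. z) :: (real ^ 'd \<Rightarrow> real) set)"
    unfolding ridge_def by (auto simp: image_iff) blast
  then have "rademacher_avg (map (\<lambda>x h. c * h x) xs) (exp_sup (ridge \<phi>)) (\<lambda>_. 0)
      = rademacher_avg (map (\<lambda>t h. \<psi> (t h)) (map (\<lambda>x h. \<bar>c\<bar> * h x) xs)) (exp_sup (ridge (\<lambda>z. z))) (\<lambda>_. 0)"
    using \<open>c \<noteq> 0\<close> by (simp add: rademacher_avg_image comp_def \<psi>_def)
  also have "\<dots> \<le> rademacher_avg (map (\<lambda>x h. \<bar>c\<bar> * h x) xs) (exp_sup (ridge (\<lambda>z. z))) (\<lambda>_. 0)"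
    by (rule rademacher_avg_contraction[OF _ lip]) (simp add: \<psi>_def \<phi>)
  also have "\<dots> \<le> ennreal (2 * (real CARD('d) + 1) * exp (2 * c\<^sup>2 * length xs))"
    using rademacher_avg_affine_le[OF xs, of _ "\<bar>c\<bar>"] by simp
  finally show ?thesis .
qed

text \<open>The clipping has to be contracted away first, because clipped networks need not lie in
  the hull. The hull step brings in both signs of \<open>B\<close>, which doubles the constant of
  the ridge bound.\<close>

lemma rademacher_avg_clipped_le:
  fixes xs :: "(real ^ 'd) list" and \<phi> :: "real \<Rightarrow> real"
  assumes xs: "\<And>x. x \<in> set xs \<Longrightarrow> x \<in> unit_cube"
    and \<phi>: "\<phi> 0 = 0" "\<And>x y. \<bar>\<phi> x - \<phi> y\<bar> \<le> \<bar>x - y\<bar>"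
    and H: "H \<subseteq> ridge_hull B \<phi>" and "0 < B" "0 < c"
  shows "rademacher_avg (map (\<lambda>x g. c * g x) xs) (exp_sup ((\<lambda>h x. clip (h x)) ` H)) (\<lambda>_. 0)
    \<le> ennreal (4 * (real CARD('d) + 1) * exp (2 * (B * c)\<^sup>2 * length xs))"
proof -
  let ?K = "2 * (real CARD('d) + 1) * exp (2 * (B * c)\<^sup>2 * length xs)"
  let ?ts = "map (\<lambda>x h. c * h x) xs :: ((real ^ 'd \<Rightarrow> real) \<Rightarrow> real) list"
  define \<psi> where "\<psi> u = c * clip (u / c)" for u
  have lip: "\<bar>\<psi> u - \<psi> v\<bar> \<le> \<bar>u - v\<bar>" for u v
  proof -
    have "\<bar>\<psi> u - \<psi> v\<bar> = c * \<bar>clip (u / c) - clip (v / c)\<bar>"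
      using \<open>0 < c\<close> by (simp add: \<psi>_def abs_mult flip: right_diff_distrib)
    also have "\<dots> \<le> c * \<bar>u / c - v / c\<bar>" using \<open>0 < c\<close> by (intro mult_left_mono clip_lipschitz) auto
    also have "\<dots> = \<bar>u - v\<bar>" using \<open>0 < c\<close> by (simp add: diff_divide_distrib[symmetric])
    finally show ?thesis .
  qed
  have "rademacher_avg ?ts (exp_sup ((\<lambda>h x. clip (h x)) ` H)) (\<lambda>_. 0)
      = rademacher_avg (map (\<lambda>t h. \<psi> (t h)) ?ts) (exp_sup H) (\<lambda>_. 0)"
    using \<open>0 < c\<close> by (simp add: rademacher_avg_image comp_def \<psi>_def)
  also have "\<dots> \<le> rademacher_avg ?ts (exp_sup H) (\<lambda>_. 0)"
    by (rule rademacher_avg_contraction[OF _ lip]) (simp add: \<psi>_def)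
  also have "\<dots> \<le> rademacher_avg ?ts
      (\<lambda>A. exp_sup (ridge \<phi>) (\<lambda>h. B * A h) + exp_sup (ridge \<phi>) (\<lambda>h. - B * A h)) (\<lambda>_. 0)"
  proof (rule rademacher_avg_mono[where P = additive_functional])
    fix A :: "(real ^ 'd \<Rightarrow> real) \<Rightarrow> real" assume A: "additive_functional A"
    have "exp_sup H A \<le> exp_sup (ridge_hull B \<phi>) A"
      unfolding exp_sup_def by (rule SUP_subset_mono[OF H]) simp
    also have "\<dots> \<le> exp_sup (ridge \<phi>) (\<lambda>h. B * A h) + exp_sup (ridge \<phi>) (\<lambda>h. - B * A h)"
      using A \<open>0 < B\<close> by (intro exp_sup_ridge_hull_le) auto
    finally show "exp_sup H A \<le> \<dots>" .
  qed (auto simp: additive_functional_def algebra_simps)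
  also have "\<dots> = rademacher_avg (map (\<lambda>x h. (B * c) * h x) xs) (exp_sup (ridge \<phi>)) (\<lambda>_. 0)
      + rademacher_avg (map (\<lambda>x h. (- B * c) * h x) xs) (exp_sup (ridge \<phi>)) (\<lambda>_. 0)"
    using rademacher_avg_scale[of B ?ts "exp_sup (ridge \<phi>)" "\<lambda>_. 0"]
      rademacher_avg_scale[of "- B" ?ts "exp_sup (ridge \<phi>)" "\<lambda>_. 0"]
    by (simp add: rademacher_avg_add comp_def mult.assoc)
  also have "\<dots> \<le> ennreal ?K + ennreal ?K"
    using \<open>0 < B\<close> \<open>0 < c\<close> rademacher_avg_ridge_le[OF xs \<phi>, of _ "B * c"]
      rademacher_avg_ridge_le[OF xs \<phi>, of _ "- B * c"]
    by (intro add_mono) auto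
  also have "\<dots> = ennreal (4 * (real CARD('d) + 1) * exp (2 * (B * c)\<^sup>2 * length xs))"
    by (simp flip: ennreal_plus)
  finally show ?thesis .
qed

section \<open>Exponential moments of the deviation\<close>

lemma sets_sample_law:
  assumes "prob_measure_on S \<mu>" "prob_measure_on S \<nu>"
  shows "sets (sample_law \<mu> \<nu>) = sets borel"
proof -
  have "sets (sample_law \<mu> \<nu>) = sets (\<Pi>\<^sub>M j\<in>(UNIV :: (nat + nat) set). borel)"
    unfolding sample_law_def
    using assms by (intro sets_PiM_cong) (auto simp: prob_measure_on_def split: sum.split)
  then show ?thesis by (simp add: sets_PiM_equal_borel)
qed

lemma lipschitz_continuous:
  fixes \<phi> :: "real \<Rightarrow> real"
  assumes "\<And>x y. \<bar>\<phi> x - \<phi> y\<bar> \<le> \<bar>x - y\<bar>"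
  shows "continuous_on UNIV \<phi>"
  using assms by (intro lipschitz_on_continuous_on[of 1] lipschitz_onI) (auto simp: dist_real_def)

lemma ridge_sum_continuous:
  assumes \<phi>: "continuous_on UNIV \<phi>"
  shows "continuous_on UNIV (ridge_sum \<phi> ps)"
proof (induction ps)
  case Nil
  then show ?case by (simp add: ridge_sum_def)
next
  case (Cons p ps)
  obtain \<gamma> w b where p: "p = (\<gamma>, w, b)" by (cases p)
  have "continuous_on UNIV (\<lambda>x. \<phi> (w \<bullet> x + b))"
    by (rule continuous_on_compose2[OF \<phi>]) (auto intro!: continuous_intros)
  with Cons show ?case by (simp add: p) (auto intro!: continuous_intros)
qed

lemma clipped_continuous:
  fixes h :: "'a::topological_space \<Rightarrow> real"
  shows "continuous_on UNIV h \<Longrightarrow> continuous_on UNIV (\<lambda>x. clip (h x))"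
  unfolding clip_def by (intro continuous_intros)

definition deviation ::
  "(real ^ 'd) measure \<Rightarrow> (real ^ 'd) measure \<Rightarrow> nat \<Rightarrow> (nat + nat \<Rightarrow> real ^ 'd) \<Rightarrow> (real ^ 'd \<Rightarrow> real) \<Rightarrow> real" where
  "deviation \<mu> \<nu> n w g =
    (\<Sum>i<n. g (w (Inl i)) - g (w (Inr i))) - real n * ((\<integral>x. g x \<partial>\<mu>) - (\<integral>x. g x \<partial>\<nu>))"

definition deviation_sup ::
  "(real ^ 'd) measure \<Rightarrow> (real ^ 'd) measure \<Rightarrow> (real ^ 'd \<Rightarrow> real) set \<Rightarrow> real \<Rightarrow> nat \<Rightarrow> (nat + nat \<Rightarrow> real ^ 'd) \<Rightarrow> ennreal" where
  "deviation_sup \<mu> \<nu> G B n w = exp_sup G (\<lambda>g. \<bar>deviation \<mu> \<nu> n w g\<bar> / (B * sqrt n))"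

lemma deviation_continuous:
  fixes g :: "real ^ 'd \<Rightarrow> real"
  assumes "continuous_on UNIV g"
  shows "continuous_on UNIV (\<lambda>w. deviation \<mu> \<nu> n w g)"
proof -
  have "continuous_on UNIV (\<lambda>w :: nat + nat \<Rightarrow> real ^ 'd. g (w j))" for j
    using continuous_on_compose2[OF assms continuous_on_product_coordinates] by simp
  then show ?thesis unfolding deviation_def by (intro continuous_intros)
qed

lemma deviation_sup_measurable:
  assumes "\<And>g. g \<in> G \<Longrightarrow> continuous_on UNIV g"
  shows "deviation_sup \<mu> \<nu> G B n \<in> borel_measurable borel"
proof -
  have "(\<lambda>w. exp_sup G (\<lambda>g. \<bar>deviation \<mu> \<nu> n w g\<bar> * (1 / (B * sqrt n)))) \<in> borel_measurable borel"
    by (rule exp_sup_measurable)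
      (intro continuous_on_mult continuous_on_rabs continuous_on_const deviation_continuous assms)
  then show ?thesis by (simp add: deviation_sup_def[abs_def])
qed

lemma nn_integral_deviation_sup_le:
  fixes \<mu> \<nu> :: "(real ^ 'd) measure" and \<phi> :: "real \<Rightarrow> real"
  assumes \<mu>: "prob_measure_on unit_cube \<mu>" and \<nu>: "prob_measure_on unit_cube \<nu>"
    and \<phi>: "\<phi> 0 = 0" "\<And>x y. \<bar>\<phi> x - \<phi> y\<bar> \<le> \<bar>x - y\<bar>"
    and H: "H \<subseteq> ridge_hull B \<phi>" and B: "0 < B" and n: "0 < n"
  defines "G \<equiv> (\<lambda>h x. clip (h x)) ` H"
  shows "(\<integral>\<^sup>+ w. deviation_sup \<mu> \<nu> G B n w \<partial>sample_law \<mu> \<nu>)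
    \<le> ennreal (8 * (real CARD('d) + 1) * exp 16)"
proof -
  define M :: "nat + nat \<Rightarrow> (real ^ 'd) measure" where "M = case_sum (\<lambda>_. \<mu>) (\<lambda>_. \<nu>)"
  define js :: "(nat + nat) list" where "js = map Inl [0..<n] @ map Inr [0..<n]"
  define \<theta> where "\<theta> = 1 / (B * sqrt n)"
  have \<theta>: "0 < \<theta>" using B n by (simp add: \<theta>_def)
  have Mps: "prob_space (M j)" and Mset: "sets (M j) = sets borel" and Mcube: "measure (M j) unit_cube = 1" for j
    using \<mu> \<nu> by (cases j; simp add: M_def prob_measure_on_def)+
  have sl: "sample_law \<mu> \<nu> = PiM UNIV M" by (simp add: sample_law_def M_def)
  have G_cont: "continuous_on UNIV g" if "g \<in> G" for g
    using that H unfolding G_def ridge_hull_def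
    by (auto intro!: clipped_continuous ridge_sum_continuous lipschitz_continuous \<phi>)
  have G_bdd: "\<bar>g x\<bar> \<le> 1" if "g \<in> G" for g x using that by (auto simp: G_def)
  have dist: "distinct js" by (auto simp: js_def distinct_map inj_on_def)
  have len: "length js = 2 * n" by (simp add: js_def)
  let ?K = "4 * (real CARD('d) + 1) * exp 16"
  interpret PP: product_prob_space M UNIV
    using Mps by (simp add: product_prob_space_def product_prob_space_axioms_def product_sigma_finite_def prob_space_imp_sigma_finite)
  have one_sided: "(\<integral>\<^sup>+ w. exp_sup G (\<lambda>g. s * \<theta> * deviation \<mu> \<nu> n w g) \<partial>sample_law \<mu> \<nu>) \<le> ennreal ?K"
    if s: "s = 1 \<or> s = -1" for s
  proof -
    \<comment> \<open>The sign of a coordinate tells the two samples apart, so that the deviation is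
      a single weighted sum of \<open>2 * n\<close> centred terms.\<close>
    define \<sigma> :: "nat + nat \<Rightarrow> real" where "\<sigma> = case_sum (\<lambda>_. s) (\<lambda>_. - s)"
    have sum_js: "(\<Sum>j\<in>set js. f j) = (\<Sum>i<n. f (Inl i) + f (Inr i))" for f :: "nat + nat \<Rightarrow> real"
    proof -
      have "(\<Sum>j\<in>set js. f j) = (\<Sum>j\<leftarrow>js. f j)" using dist by (rule sum.distinct_set_conv_list)
      also have "\<dots> = (\<Sum>i<n. f (Inl i) + f (Inr i))"
        by (simp add: js_def comp_def interv_sum_list_conv_sum_set_nat sum.distrib atLeast0LessThan)
      finally show ?thesis .
    qed
    have dev: "s * \<theta> * deviation \<mu> \<nu> n w g = 0 + (\<Sum>j\<in>set js. \<theta> * \<sigma> j * (g (w j) - (\<integral>x. g x \<partial>M j)))" for w g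
      unfolding sum_js
      by (simp add: deviation_def \<sigma>_def M_def sum_subtractf sum.distrib sum_negf sum_distrib_left[symmetric] algebra_simps)
    let ?f = "\<lambda>w. exp_sup G (\<lambda>g. s * \<theta> * deviation \<mu> \<nu> n w g)"
    have f_meas: "?f \<in> borel_measurable (PiM (set js) M)"
    proof (rule measurable_PiM_if_borel[OF _ Mset])
      show "?f \<in> borel_measurable borel"
        by (intro exp_sup_measurable continuous_on_mult continuous_on_const deviation_continuous G_cont)
      show "?f w = ?f v" if "\<And>j. j \<in> set js \<Longrightarrow> w j = v j" for w v
        unfolding dev using that by (simp cong: sum.cong)
    qed
    \<comment> \<open>Only the first \<open>n\<close> terms of each sample occur, so the infinite
      product measure can be replaced by a finite product, where symmetrization applies.\<close>
    have "(\<integral>\<^sup>+ w. ?f w \<partial>sample_law \<mu> \<nu>) = (\<integral>\<^sup>+ w. ?f (restrict w (set js)) \<partial>PiM UNIV M)"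
      unfolding sl dev by (intro nn_integral_cong arg_cong[where f = "exp_sup G"]) simp
    also have "\<dots> = (\<integral>\<^sup>+ w. ?f w \<partial>distr (PiM UNIV M) (PiM (set js) M) (\<lambda>w. restrict w (set js)))"
    proof (rule nn_integral_distr[symmetric])
      show "(\<lambda>w. restrict w (set js)) \<in> PiM UNIV M \<rightarrow>\<^sub>M PiM (set js) M"
        by (rule measurable_restrict_subset) simp
    qed (use f_meas in simp)
    also have "\<dots> = (\<integral>\<^sup>+ w. ?f w \<partial>PiM (set js) M)"
      by (subst PP.distr_PiM_restrict_finite) simp_all
    also have "\<dots> \<le> (\<integral>\<^sup>+ w. rademacher_avg (map (\<lambda>j g. 2 * (\<theta> * \<sigma> j) * g (w j)) js) (exp_sup G) (\<lambda>_. 0) \<partial>PiM (set js) M)"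
      unfolding dev
      by (rule symmetrization[where M = M and G = G and js = js and c = "\<lambda>j. \<theta> * \<sigma> j" and a = "\<lambda>_. 0",
            OF Mps Mset _ _ dist]) (auto intro: G_cont G_bdd)
    also have "\<dots> \<le> (\<integral>\<^sup>+ w. ennreal ?K \<partial>PiM (set js) M)"
    proof (rule nn_integral_mono_AE)
      \<comment> \<open>The Rademacher bound needs sample points in the cube, which holds almost
        surely.\<close>
      have "AE x in M j. x \<in> unit_cube" for j
      proof -
        show ?thesis using prob_space.AE_prob_1[OF Mps Mcube] .
      qed
      then have "AE w in PiM (set js) M. \<forall>j\<in>set js. w j \<in> unit_cube"
        by (intro AE_finite_allI AE_PiM_component Mps) auto
      then show "AE w in PiM (set js) M. rademacher_avg (map (\<lambda>j g. 2 * (\<theta> * \<sigma> j) * g (w j)) js) (exp_sup G) (\<lambda>_. 0) \<le> ennreal ?K"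
      proof eventually_elim
        case (elim w)
        have "rademacher_avg (map (\<lambda>j g. 2 * (\<theta> * \<sigma> j) * g (w j)) js) (exp_sup G) (\<lambda>_. 0)
            = rademacher_avg (map (\<lambda>j g. \<sigma> j * (2 * \<theta> * g (w j))) js) (exp_sup G) (\<lambda>_. 0)"
          by (simp add: mult_ac)
        also have "\<dots> = rademacher_avg (map (\<lambda>x g. 2 * \<theta> * g x) (map w js)) (exp_sup G) (\<lambda>_. 0)"
          using s by (subst rademacher_avg_signs) (auto simp: \<sigma>_def comp_def split: sum.split)
        also have "\<dots> \<le> ennreal (4 * (real CARD('d) + 1) * exp (2 * (B * (2 * \<theta>))\<^sup>2 * length (map w js)))"
          unfolding G_def using elim \<theta> by (intro rademacher_avg_clipped_le[OF _ \<phi> H B]) auto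
        \<comment> \<open>Origin of \<open>exp 16\<close>: symmetrization doubles
          \<open>\<theta>\<close>, there are \<open>2 * n\<close> increments, and
          \<open>\<theta>\<close> is chosen to cancel \<open>B\<close> and \<open>n\<close>.\<close>
        also have "2 * (B * (2 * \<theta>))\<^sup>2 * length (map w js) = 16"
          using B n by (simp add: len \<theta>_def power_mult_distrib power_divide)
        finally show ?case .
      qed
    qed
    also have "\<dots> = ennreal ?K"
      using prob_space.emeasure_space_1[OF prob_space_PiM[of "set js" M]] Mps by simp
    finally show ?thesis .
  qed
  have meas: "(\<lambda>w. exp_sup G (\<lambda>g. s * \<theta> * deviation \<mu> \<nu> n w g)) \<in> borel_measurable (sample_law \<mu> \<nu>)" for s
    unfolding measurable_cong_sets[OF sets_sample_law[OF \<mu> \<nu>] refl]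
    by (intro exp_sup_measurable continuous_on_mult continuous_on_const deviation_continuous G_cont)
  \<comment> \<open>The absolute value costs a factor 2, since
    \<open>exp \<bar>y\<bar> \<le> exp y + exp (- y)\<close>.\<close>
  have "(\<integral>\<^sup>+ w. deviation_sup \<mu> \<nu> G B n w \<partial>sample_law \<mu> \<nu>)
      \<le> (\<integral>\<^sup>+ w. exp_sup G (\<lambda>g. 1 * \<theta> * deviation \<mu> \<nu> n w g)
            + exp_sup G (\<lambda>g. (-1) * \<theta> * deviation \<mu> \<nu> n w g) \<partial>sample_law \<mu> \<nu>)"
  proof (rule nn_integral_mono)
    fix w
    show "deviation_sup \<mu> \<nu> G B n w \<le> exp_sup G (\<lambda>g. 1 * \<theta> * deviation \<mu> \<nu> n w g)
        + exp_sup G (\<lambda>g. (-1) * \<theta> * deviation \<mu> \<nu> n w g)"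
      unfolding deviation_sup_def exp_sup_def[of G "\<lambda>g. \<bar>deviation \<mu> \<nu> n w g\<bar> / (B * sqrt n)"]
    proof (rule SUP_least)
      fix g assume g: "g \<in> G"
      let ?D = "\<theta> * deviation \<mu> \<nu> n w g"
      have "\<bar>deviation \<mu> \<nu> n w g\<bar> / (B * sqrt n) = \<bar>?D\<bar>" using \<theta> by (simp add: abs_mult) (simp add: \<theta>_def)
      then have "exp (\<bar>deviation \<mu> \<nu> n w g\<bar> / (B * sqrt n)) \<le> exp (1 * \<theta> * deviation \<mu> \<nu> n w g) + exp ((-1) * \<theta> * deviation \<mu> \<nu> n w g)"
        by (cases "?D \<ge> 0") (auto intro: add_increasing add_increasing2)
      then have "ennreal (exp (\<bar>deviation \<mu> \<nu> n w g\<bar> / (B * sqrt n)))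
          \<le> ennreal (exp (1 * \<theta> * deviation \<mu> \<nu> n w g)) + ennreal (exp ((-1) * \<theta> * deviation \<mu> \<nu> n w g))"
        by (simp add: ennreal_leI flip: ennreal_plus)
      also have "\<dots> \<le> exp_sup G (\<lambda>g. 1 * \<theta> * deviation \<mu> \<nu> n w g) + exp_sup G (\<lambda>g. (-1) * \<theta> * deviation \<mu> \<nu> n w g)"
        unfolding exp_sup_def by (intro add_mono SUP_upper g)
      finally show "ennreal (exp (\<bar>deviation \<mu> \<nu> n w g\<bar> / (B * sqrt n))) \<le> \<dots>" .
    qed
  qed
  also have "\<dots> = (\<integral>\<^sup>+ w. exp_sup G (\<lambda>g. 1 * \<theta> * deviation \<mu> \<nu> n w g) \<partial>sample_law \<mu> \<nu>)
      + (\<integral>\<^sup>+ w. exp_sup G (\<lambda>g. (-1) * \<theta> * deviation \<mu> \<nu> n w g) \<partial>sample_law \<mu> \<nu>)"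
    by (rule nn_integral_add[OF meas meas])
  also have "\<dots> \<le> ennreal ?K + ennreal ?K"
    by (intro add_mono one_sided) auto
  also have "\<dots> = ennreal (8 * (real CARD('d) + 1) * exp 16)"
    by (simp flip: ennreal_plus)
  finally show ?thesis .
qed

section \<open>Total variation and the bias of the estimator\<close>

lemma unit_cube_eq_cbox: "unit_cube = cbox (0 :: real ^ 'd) (\<chi> i. 1)"
  by (auto simp: unit_cube_def mem_box_cart)

lemma unit_cube_sets [measurable]: "(unit_cube :: (real ^ 'd) set) \<in> sets borel"
  by (simp add: unit_cube_eq_cbox)

lemma unit_cube_compact: "compact (unit_cube :: (real ^ 'd) set)"
  by (simp add: unit_cube_eq_cbox compact_cbox)

text \<open>\<open>Y\<close> is the positive part of a Hahn decomposition of the signed measure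
  \<open>\<mu> - \<nu>\<close>, written with the two measures only.\<close>

definition hahn_set :: "'a measure \<Rightarrow> 'a measure \<Rightarrow> 'a set \<Rightarrow> bool" where
  "hahn_set \<mu> \<nu> Y \<longleftrightarrow> Y \<in> sets \<mu> \<and> (\<forall>A\<in>sets \<mu>. A \<subseteq> Y \<longrightarrow> emeasure \<nu> A \<le> emeasure \<mu> A) \<and>
    (\<forall>A\<in>sets \<mu>. A \<inter> Y = {} \<longrightarrow> emeasure \<mu> A \<le> emeasure \<nu> A)"

lemma hahn_set_swap:
  assumes "sets \<nu> = sets \<mu>" "hahn_set \<mu> \<nu> Y"
  shows "hahn_set \<nu> \<mu> (space \<mu> - Y)"
proof -
  have "A \<subseteq> Y" if "A \<in> sets \<mu>" "A \<inter> (space \<mu> - Y) = {}" for A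
    using that sets.sets_into_space[of A \<mu>] by blast
  moreover have "space \<mu> - Y \<in> sets \<mu>" using assms(2) by (auto simp: hahn_set_def)
  moreover have "A \<inter> Y = {}" if "A \<subseteq> space \<mu> - Y" for A using that by blast
  ultimately show ?thesis
    using assms unfolding hahn_set_def by simp
qed

text \<open>Restricted to \<open>Y\<close>, the measures are ordered, and nonnegative integrals are
  monotone in the measure.\<close>

lemma nn_integral_hahn_le:
  assumes sets: "sets \<nu> = sets \<mu>" and Y: "hahn_set \<mu> \<nu> Y" and f: "f \<in> borel_measurable \<mu>"
  shows "(\<integral>\<^sup>+ x\<in>Y. f x \<partial>\<nu>) \<le> (\<integral>\<^sup>+ x\<in>Y. f x \<partial>\<mu>)"
proof -
  have Ym[measurable]: "Y \<in> sets \<mu>" "Y \<in> sets \<nu>" using Y sets by (auto simp: hahn_set_def)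
  have "density \<nu> (indicator Y) \<le> density \<mu> (indicator Y)"
  proof -
    have "emeasure (density \<nu> (indicator Y)) A \<le> emeasure (density \<mu> (indicator Y)) A" for A
    proof (cases "A \<in> sets \<mu>")
      case True
      then have "emeasure \<nu> (Y \<inter> A) \<le> emeasure \<mu> (Y \<inter> A)" using Y by (auto simp: hahn_set_def)
      then show ?thesis using True sets by (simp add: emeasure_restricted)
    next
      case False
      then show ?thesis using sets by (simp add: emeasure_notin_sets)
    qed
    then show ?thesis
      by (simp add: le_measure_iff le_fun_def sets sets_eq_imp_space_eq[OF sets])
  qed
  then have "(\<integral>\<^sup>+ x. f x \<partial>density \<nu> (indicator Y)) \<le> (\<integral>\<^sup>+ x. f x \<partial>density \<mu> (indicator Y))"
    by (intro nn_integral_mono_measure) (simp_all add: sets)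
  moreover have "f \<in> borel_measurable \<nu>" using f sets by (simp cong: measurable_cong_sets)
  ultimately show ?thesis using f by (simp add: nn_integral_density mult.commute)
qed

text \<open>Compares \<open>g\<close> with the sign function of \<open>Y\<close>: both correction
  terms, the deficit on \<open>Y\<close> and the excess off \<open>Y\<close>, are nonnegative as
  \<open>\<bar>g x\<bar> \<le> 1\<close>. The identity serves the duality bound as well as the bias
  estimate in terms of the densities.\<close>

lemma integral_split_set:
  assumes m: "prob_space m" and g: "g \<in> borel_measurable m" "\<And>x. \<bar>g x\<bar> \<le> 1" and Y: "Y \<in> sets m"
  shows "(\<integral>x. g x \<partial>m) = 2 * measure m Y - 1 - (\<integral>x. (1 - g x) * indicator Y x \<partial>m)
    + (\<integral>x. (1 + g x) * indicator (space m - Y) x \<partial>m)"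
proof -
  interpret m: prob_space m by (rule m)
  note [measurable] = g(1) Y
  have gi: "0 \<le> 1 - g x" "1 - g x \<le> 2" "0 \<le> 1 + g x" "1 + g x \<le> 2" for x using g(2)[of x] by linarith+
  have i1: "integrable m (\<lambda>x. (1 - g x) * indicator Y x)"
    by (rule m.integrable_const_bound[where B = 2]) (use gi in \<open>auto simp: indicator_def\<close>)
  have i2: "integrable m (\<lambda>x. (1 + g x) * indicator (space m - Y) x)"
    by (rule m.integrable_const_bound[where B = 2]) (use gi in \<open>auto simp: indicator_def\<close>)
  have i3: "integrable m (\<lambda>x. 2 * indicator Y x - 1 :: real)"
    by (rule m.integrable_const_bound[where B = 3]) (auto simp: indicator_def)
  have "(\<integral>x. g x \<partial>m) = (\<integral>x. (2 * indicator Y x - 1) - (1 - g x) * indicator Y x + (1 + g x) * indicator (space m - Y) x \<partial>m)"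
    by (intro Bochner_Integration.integral_cong) (auto simp: indicator_def)
  also have "\<dots> = (\<integral>x. 2 * indicator Y x - 1 \<partial>m) - (\<integral>x. (1 - g x) * indicator Y x \<partial>m)
      + (\<integral>x. (1 + g x) * indicator (space m - Y) x \<partial>m)"
    using i1 i2 i3 by simp
  also have "(\<integral>x. 2 * indicator Y x - 1 \<partial>m) = 2 * measure m Y - 1"
    by (subst Bochner_Integration.integral_diff)
      (auto simp: m.prob_space less_top[symmetric] intro!: integrable_real_indicator)
  finally show ?thesis .
qed

text \<open>Passing from the sign function of \<open>Y\<close> to \<open>g\<close> loses on
  \<open>Y\<close>, where \<open>\<mu>\<close> dominates, and gains off \<open>Y\<close>, where
  \<open>\<nu>\<close> dominates; both effects can only lower the difference of the
  integrals.\<close>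

lemma hahn_set_integral_le:
  assumes ps: "prob_space \<mu>" "prob_space \<nu>" and sets: "sets \<nu> = sets \<mu>" and Y: "hahn_set \<mu> \<nu> Y"
    and g: "g \<in> borel_measurable \<mu>" "\<And>x. \<bar>g x\<bar> \<le> 1"
  shows "(\<integral>x. g x \<partial>\<mu>) - (\<integral>x. g x \<partial>\<nu>) \<le> 2 * (measure \<mu> Y - measure \<nu> Y)"
proof -
  interpret M: prob_space \<mu> by fact
  interpret N: prob_space \<nu> by fact
  have Ym[measurable]: "Y \<in> sets \<mu>" "Y \<in> sets \<nu>" using Y sets by (auto simp: hahn_set_def)
  have gm[measurable]: "g \<in> borel_measurable \<mu>" "g \<in> borel_measurable \<nu>"
    using g sets by (simp_all cong: measurable_cong_sets)
  have sp: "space \<nu> = space \<mu>" using sets by (rule sets_eq_imp_space_eq)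
  have half: "(\<integral>x. h x * indicator Z x \<partial>N) \<le> (\<integral>x. h x * indicator Z x \<partial>M)"
    if "finite_measure M" "finite_measure N" "sets N = sets M" "hahn_set M N Z" "h \<in> borel_measurable M" "\<And>x. 0 \<le> h x" "\<And>x. h x \<le> 2"
    for h :: "'a \<Rightarrow> real" and Z and M N :: "'a measure"
  proof -
    interpret M: finite_measure M by fact
    interpret N: finite_measure N by fact
    have Z: "Z \<in> sets M" "Z \<in> sets N" using that by (auto simp: hahn_set_def)
    have h: "h \<in> borel_measurable N" using that by (simp cong: measurable_cong_sets)
    have i: "integrable M (\<lambda>x. h x * indicator Z x)"
      by (rule M.integrable_const_bound[where B = 2]) (use that Z in \<open>auto simp: indicator_def\<close>)
    have i': "integrable N (\<lambda>x. h x * indicator Z x)"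
      by (rule N.integrable_const_bound[where B = 2]) (use that Z h in \<open>auto simp: indicator_def\<close>)
    have "ennreal (\<integral>x. h x * indicator Z x \<partial>N) = (\<integral>\<^sup>+ x\<in>Z. ennreal (h x) \<partial>N)"
      using that by (subst nn_integral_eq_integral[OF i', symmetric]) (auto simp: ennreal_mult' ennreal_indicator intro!: nn_integral_cong)
    also have "\<dots> \<le> (\<integral>\<^sup>+ x\<in>Z. ennreal (h x) \<partial>M)"
      using that by (intro nn_integral_hahn_le) auto
    also have "\<dots> = ennreal (\<integral>x. h x * indicator Z x \<partial>M)"
      using that by (subst nn_integral_eq_integral[OF i, symmetric]) (auto simp: ennreal_mult' ennreal_indicator intro!: nn_integral_cong)
    finally show ?thesis
      using that by (subst (asm) ennreal_le_iff) (auto intro!: integral_nonneg_AE)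
  qed
  let ?Z = "space \<mu> - Y"
  have gi: "0 \<le> 1 - g x" "1 - g x \<le> 2" "0 \<le> 1 + g x" "1 + g x \<le> 2" for x using g(2)[of x] by linarith+
  have "(\<integral>x. (1 - g x) * indicator Y x \<partial>\<nu>) \<le> (\<integral>x. (1 - g x) * indicator Y x \<partial>\<mu>)"
    using gi by (intro half sets Y M.finite_measure_axioms N.finite_measure_axioms) auto
  moreover have "(\<integral>x. (1 + g x) * indicator ?Z x \<partial>\<mu>) \<le> (\<integral>x. (1 + g x) * indicator ?Z x \<partial>\<nu>)"
    using gi by (intro half sets[symmetric] hahn_set_swap sets Y M.finite_measure_axioms N.finite_measure_axioms) auto
  ultimately show ?thesis
    using integral_split_set[OF ps(1) gm(1) g(2) Ym(1)] integral_split_set[OF ps(2) gm(2) g(2) Ym(2)] sp by simp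
qed

lemma hahn_set_exists:
  assumes "prob_space \<mu>" "prob_space \<nu>" "sets \<nu> = sets \<mu>"
  obtains Y where "hahn_set \<mu> \<nu> Y"
  using finite_unsigned_Hahn_decomposition[of \<mu> \<nu>] assms
  by (auto simp: hahn_set_def prob_space_def)

lemma prob_measure_on_AE:
  assumes "prob_measure_on S \<mu>"
  shows "AE x in \<mu>. x \<in> S" "S \<in> sets borel"
proof -
  interpret prob_space \<mu> using assms by (simp add: prob_measure_on_def)
  have "S \<in> sets \<mu>"
    using assms measure_notin_sets[of S \<mu>] by (auto simp: prob_measure_on_def)
  then show "AE x in \<mu>. x \<in> S" "S \<in> sets borel"
    using assms by (auto simp: prob_measure_on_def AE_in_set_eq_1)
qed

text \<open>The Hahn set maximises the difference of the measures over all Borel sets. This turns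
  the supremum in \<open>tv_dist\<close> into an attained value.\<close>

lemma tv_dist_hahn:
  assumes \<mu>: "prob_measure_on S \<mu>" and \<nu>: "prob_measure_on S \<nu>" and Y: "hahn_set \<mu> \<nu> Y"
  shows "tv_dist S \<mu> \<nu> = 2 * (measure \<mu> Y - measure \<nu> Y)"
proof -
  interpret M: prob_space \<mu> using \<mu> by (simp add: prob_measure_on_def)
  interpret N: prob_space \<nu> using \<nu> by (simp add: prob_measure_on_def)
  have st: "sets \<mu> = sets borel" "sets \<nu> = sets borel" using \<mu> \<nu> by (auto simp: prob_measure_on_def)
  have S: "S \<in> sets borel" using prob_measure_on_AE[OF \<mu>] by simp
  have Ym: "Y \<in> sets borel" using Y st by (simp add: hahn_set_def)
  have bound: "measure \<mu> C - measure \<nu> C \<le> measure \<mu> Y - measure \<nu> Y" if "C \<in> sets borel" for C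
  proof -
    \<comment> \<open>The bound for functions is applied to the sign function of
      \<open>C\<close>.\<close>
    have "(\<integral>x. 2 * indicator C x - 1 \<partial>\<mu>) - (\<integral>x. 2 * indicator C x - 1 \<partial>\<nu>) \<le> 2 * (measure \<mu> Y - measure \<nu> Y)"
      using that st by (intro hahn_set_integral_le M.prob_space_axioms N.prob_space_axioms Y) (auto simp: indicator_def)
    moreover have "(\<integral>x. 2 * indicator C x - 1 \<partial>m) = 2 * measure m C - 1"
      if "prob_space m" "sets m = sets borel" for m
    proof -
      interpret prob_space m by fact
      have "integrable m (indicat_real C)"
        using \<open>C \<in> sets borel\<close> that by (intro integrable_real_indicator) (auto simp: less_top[symmetric])
      then show ?thesis
        using \<open>C \<in> sets borel\<close> that by (subst Bochner_Integration.integral_diff) (auto simp: prob_space)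
    qed
    ultimately show ?thesis using st M.prob_space_axioms N.prob_space_axioms by simp
  qed
  have bound2: "\<bar>measure \<mu> C - measure \<nu> C\<bar> \<le> measure \<mu> Y - measure \<nu> Y" if "C \<in> sets borel" for C
  proof -
    have sp: "space \<mu> = UNIV" "space \<nu> = UNIV" using st[THEN sets_eq_imp_space_eq] by auto
    \<comment> \<open>For probability measures the difference changes sign on the complement, which
      yields the absolute value.\<close>
    have "measure \<mu> (- C) = 1 - measure \<mu> C" "measure \<nu> (- C) = 1 - measure \<nu> C"
      using M.prob_compl[of C] N.prob_compl[of C] that st sp by (auto simp: Compl_eq_Diff_UNIV)
    moreover have "measure \<mu> (- C) - measure \<nu> (- C) \<le> measure \<mu> Y - measure \<nu> Y"
      using that by (intro bound) auto
    ultimately show ?thesis using bound[OF that] by (simp add: abs_le_iff)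
  qed
  show ?thesis
  proof (rule antisym)
    show "tv_dist S \<mu> \<nu> \<le> 2 * (measure \<mu> Y - measure \<nu> Y)"
      unfolding tv_dist_def by (rule cSUP_least) (auto simp del: right_diff_distrib_numeral intro!: bound2)
    \<comment> \<open>\<open>Y\<close> may leave \<open>S\<close>, where the supremum is taken, but
      both measures are carried by \<open>S\<close>.\<close>
    have eq: "measure m (Y \<inter> S) = measure m Y" if "prob_measure_on S m" for m
    proof -
      have "sets m = sets borel" using that by (simp add: prob_measure_on_def)
      then show ?thesis using prob_measure_on_AE[OF that] Ym S
        by (intro measure_eq_AE) auto
    qed
    have "2 * \<bar>measure \<mu> (Y \<inter> S) - measure \<nu> (Y \<inter> S)\<bar> \<le> tv_dist S \<mu> \<nu>"
      unfolding tv_dist_def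
      by (rule cSUP_upper) (use Ym S in \<open>auto simp del: right_diff_distrib_numeral intro!: bdd_aboveI2[where M = "2 * (measure \<mu> Y - measure \<nu> Y)"] bound2\<close>)
    then show "2 * (measure \<mu> Y - measure \<nu> Y) \<le> tv_dist S \<mu> \<nu>" using eq[OF \<mu>] eq[OF \<nu>]
        abs_ge_self[of "measure \<mu> Y - measure \<nu> Y"] by simp
  qed
qed

lemma integral_diff_le_tv_dist:
  assumes \<mu>: "prob_measure_on S \<mu>" and \<nu>: "prob_measure_on S \<nu>"
    and g: "g \<in> borel_measurable borel" "\<And>x. \<bar>g x\<bar> \<le> 1"
  shows "(\<integral>x. g x \<partial>\<mu>) - (\<integral>x. g x \<partial>\<nu>) \<le> tv_dist S \<mu> \<nu>"
proof -
  have st: "sets \<mu> = sets borel" "sets \<nu> = sets \<mu>" "prob_space \<mu>" "prob_space \<nu>" using \<mu> \<nu> by (auto simp: prob_measure_on_def)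
  obtain Y where Y: "hahn_set \<mu> \<nu> Y" using hahn_set_exists[of \<mu> \<nu>] st by blast
  have "g \<in> borel_measurable \<mu>" using g st by (simp cong: measurable_cong_sets)
  then show ?thesis unfolding tv_dist_hahn[OF \<mu> \<nu> Y] using st g by (intro hahn_set_integral_le Y) auto
qed

text \<open>No function bounded by 1 exceeds the total variation, so overestimation comes from the
  deviation alone; only underestimation pays the bias \<open>e\<close> of the witness
  \<open>g0\<close>. The argument is pointwise in the sample \<open>w\<close>.\<close>

lemma tv_estimator_error_le:
  fixes G :: "(real ^ 'd \<Rightarrow> real) set"
  assumes \<mu>: "prob_measure_on S \<mu>" and \<nu>: "prob_measure_on S \<nu>"
    and G: "\<And>g. g \<in> G \<Longrightarrow> continuous_on UNIV g" "\<And>g x. g \<in> G \<Longrightarrow> \<bar>g x\<bar> \<le> 1"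
    and n: "0 < n" and B: "0 < B" and u: "deviation_sup \<mu> \<nu> G B n w \<le> ennreal (exp v)" "0 \<le> v"
    and g0: "g0 \<in> G" "tv_dist S \<mu> \<nu> - e \<le> (\<integral>x. g0 x \<partial>\<mu>) - (\<integral>x. g0 x \<partial>\<nu>)" "0 \<le> e"
  shows "\<bar>tv_estimator G n (\<lambda>i. w (Inl i)) (\<lambda>i. w (Inr i)) - tv_dist S \<mu> \<nu>\<bar> \<le> e + B / sqrt n * v"
proof -
  define emp where "emp g = 1 / real n * (\<Sum>i<n. g (w (Inl i)) - g (w (Inr i)))" for g
  have emp: "\<bar>emp g - ((\<integral>x. g x \<partial>\<mu>) - (\<integral>x. g x \<partial>\<nu>))\<bar> \<le> B / sqrt n * v" if "g \<in> G" for g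
  proof -
    have "ennreal (exp (\<bar>deviation \<mu> \<nu> n w g\<bar> / (B * sqrt n))) \<le> ennreal (exp v)"
      by (rule order_trans[OF _ u(1)]) (auto simp: deviation_sup_def exp_sup_def intro: SUP_upper that)
    then have "\<bar>deviation \<mu> \<nu> n w g\<bar> / (B * sqrt n) \<le> v" by simp
    then have d: "\<bar>deviation \<mu> \<nu> n w g\<bar> \<le> v * (B * sqrt n)" using B n by (simp add: field_simps)
    have "emp g - ((\<integral>x. g x \<partial>\<mu>) - (\<integral>x. g x \<partial>\<nu>)) = deviation \<mu> \<nu> n w g / real n"
      using n by (simp add: emp_def deviation_def field_simps)
    then have "\<bar>emp g - ((\<integral>x. g x \<partial>\<mu>) - (\<integral>x. g x \<partial>\<nu>))\<bar> \<le> v * (B * sqrt n) / real n"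
      using d n by (simp add: divide_right_mono)
    also have "\<dots> = B / sqrt n * v" using n by (simp add: field_simps flip: power2_eq_square)
    finally show ?thesis .
  qed
  have upper: "emp g \<le> tv_dist S \<mu> \<nu> + B / sqrt n * v" if "g \<in> G" for g
    using emp[OF that] integral_diff_le_tv_dist[OF \<mu> \<nu> borel_measurable_continuous_onI[OF G(1)[OF that]] G(2)[OF that]]
    by linarith
  have est: "tv_estimator G n (\<lambda>i. w (Inl i)) (\<lambda>i. w (Inr i)) = (SUP g\<in>G. emp g)"
    by (simp add: tv_estimator_def emp_def)
  have "(SUP g\<in>G. emp g) \<le> tv_dist S \<mu> \<nu> + B / sqrt n * v"
    using g0(1) upper by (intro cSUP_least) auto
  moreover have "emp g0 \<le> (SUP g\<in>G. emp g)"
    using g0(1) upper by (intro cSUP_upper bdd_aboveI2) auto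
  ultimately show ?thesis
    unfolding est using emp[OF g0(1)] g0 by linarith
qed

section \<open>Density of ridge functions\<close>

text \<open>Riemann sums for the Taylor formula
  \<open>h v = h (-1) + h' (-1) (v + 1) + \<integral> h'' b relu (v - b) db\<close> over \<open>[-1, 1]\<close>.\<close>

lemma taylor_relu_sum:
  fixes h h' h'' :: "real \<Rightarrow> real"
  assumes h: "\<And>v. (h has_real_derivative h' v) (at v)" and h': "\<And>v. (h' has_real_derivative h'' v) (at v)"
    and H: "\<And>v. \<bar>v\<bar> \<le> 1 \<Longrightarrow> \<bar>h'' v\<bar> \<le> H"
    and L: "\<And>u v. \<bar>u\<bar> \<le> 1 \<Longrightarrow> \<bar>v\<bar> \<le> 1 \<Longrightarrow> \<bar>h'' u - h'' v\<bar> \<le> L * \<bar>u - v\<bar>"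
    and \<epsilon>: "0 < \<epsilon>"
  obtains qs :: "(real \<times> real) list" where
    "\<And>\<gamma> b. (\<gamma>, b) \<in> set qs \<Longrightarrow> \<bar>b\<bar> \<le> 1" "(\<Sum>(\<gamma>, b)\<leftarrow>qs. \<bar>\<gamma>\<bar>) \<le> 2 * H"
    "\<And>v. \<bar>v\<bar> \<le> 1 \<Longrightarrow> \<bar>h v - (h (-1) + h' (-1) * (v + 1) + (\<Sum>(\<gamma>, b)\<leftarrow>qs. \<gamma> * relu (v - b)))\<bar> \<le> \<epsilon>"
proof -
  have H0: "0 \<le> H" using H[of 0] by simp
  have L0: "0 \<le> L" using L[of 0 1] by simp
  \<comment> \<open>A cell of length \<open>\<delta>\<close> left of \<open>v\<close> has error at
    most \<open>(2 * L + H) * \<delta>\<^sup>2\<close>, the cell containing \<open>v\<close> at most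
    \<open>2 * H * \<delta>\<^sup>2\<close>; \<open>K\<close> covers both, and the \<open>J\<close>
    cells add up to \<open>4 * K / J\<close>.\<close>
  define K where "K = 2 * L + 2 * H"
  obtain J :: nat where J: "4 * K / \<epsilon> < J" using reals_Archimedean2 by blast
  then have "0 < J" using H0 L0 \<epsilon> by (cases J) (simp_all add: K_def divide_less_0_iff mult_less_0_iff)
  define \<delta> where "\<delta> = 2 / real J"
  have \<delta>: "0 < \<delta>" "J * \<delta> = 2" using \<open>0 < J\<close> by (simp_all add: \<delta>_def)
  define b where "b j = -1 + real j * \<delta>" for j
  have b_bd: "\<bar>b j\<bar> \<le> 1" if "j \<le> J" for j
  proof -
    have "real j * \<delta> \<le> J * \<delta>" using that \<delta> by (intro mult_right_mono) auto
    then show ?thesis using \<delta> by (simp add: b_def abs_le_iff)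
  qed
  define \<gamma> where "\<gamma> j = h'' (b j) * \<delta>" for j
  define qs where "qs = map (\<lambda>j. (\<gamma> j, b j)) [0..<J]"
  have sum_qs: "(\<Sum>(\<gamma>, b)\<leftarrow>qs. f \<gamma> b) = (\<Sum>j<J. f (\<gamma> j) (b j))" for f :: "real \<Rightarrow> real \<Rightarrow> real"
    by (simp add: qs_def comp_def interv_sum_list_conv_sum_set_nat atLeast0LessThan)
  show ?thesis
  proof (rule that[of qs])
    show "\<bar>b\<bar> \<le> 1" if "(\<gamma>, b) \<in> set qs" for \<gamma> b using that b_bd by (auto simp: qs_def)
    have "(\<Sum>j<J. \<bar>\<gamma> j\<bar>) \<le> (\<Sum>j<J. H * \<delta>)"
      using \<delta> b_bd by (intro sum_mono) (auto simp: \<gamma>_def abs_mult intro!: mult_right_mono H)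
    also have "\<dots> = 2 * H" using \<delta> by simp
    finally show "(\<Sum>(\<gamma>, b)\<leftarrow>qs. \<bar>\<gamma>\<bar>) \<le> 2 * H" by (simp add: sum_qs)
    fix v :: real assume v: "\<bar>v\<bar> \<le> 1"
    \<comment> \<open>\<open>G u\<close> is the value at \<open>v\<close> of the tangent of
      \<open>h\<close> at \<open>u\<close>. It runs from the affine term at \<open>-1\<close> to
      \<open>h v\<close> at \<open>u = v\<close>, and its derivative is the integrand of the Taylor
      formula.\<close>
    define G where "G u = h u + h' u * (v - u)" for u
    have G: "(G has_real_derivative h'' u * (v - u)) (at u)" for u
      unfolding G_def by (auto intro!: derivative_eq_intros h h' simp: algebra_simps)
    \<comment> \<open>Stopping the knots at \<open>v\<close> makes the increments vanish on the
      cells right of \<open>v\<close>, just as \<open>relu (v - b j)\<close> does.\<close>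
    define A where "A j = G (min (b j) v)" for j
    have step: "\<bar>A (Suc j) - A j - \<gamma> j * relu (v - b j)\<bar> \<le> K * \<delta>\<^sup>2" if j: "j < J" for j
    proof -
      have b1: "\<bar>b j\<bar> \<le> 1" "\<bar>b (Suc j)\<bar> \<le> 1" using b_bd j by auto
      have bS: "b (Suc j) = b j + \<delta>" by (simp add: b_def algebra_simps)
      consider "v \<le> b j" | "b (Suc j) \<le> v" | "b j < v" "v < b (Suc j)" by linarith
      then show ?thesis
      proof cases
        case 1
        then have "A (Suc j) - A j - \<gamma> j * relu (v - b j) = 0"
          using bS \<delta> by (simp add: A_def relu_def min_def max_def)
        then show ?thesis using H0 L0 \<delta> by (simp add: K_def)
      next
        case 2
        have "b j < b (Suc j)" using bS \<delta> by simp
        from MVT2[OF this G] obtain z where z: "b j < z" "z < b (Suc j)"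
          and eq: "G (b (Suc j)) - G (b j) = (b (Suc j) - b j) * (h'' z * (v - z))" by blast
        have zb: "\<bar>z\<bar> \<le> 1" using z b1 by linarith
        have "A (Suc j) - A j - \<gamma> j * relu (v - b j) = \<delta> * ((h'' z - h'' (b j)) * (v - z) - h'' (b j) * (z - b j))"
          using 2 bS \<delta> eq by (simp add: A_def relu_def \<gamma>_def min_def algebra_simps)
        then have "\<bar>A (Suc j) - A j - \<gamma> j * relu (v - b j)\<bar>
            = \<delta> * \<bar>(h'' z - h'' (b j)) * (v - z) - h'' (b j) * (z - b j)\<bar>"
          using \<delta> by (simp add: abs_mult)
        also have "\<dots> \<le> \<delta> * (\<bar>h'' z - h'' (b j)\<bar> * \<bar>v - z\<bar> + \<bar>h'' (b j)\<bar> * \<bar>z - b j\<bar>)"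
          using \<delta> abs_triangle_ineq4[of "(h'' z - h'' (b j)) * (v - z)" "h'' (b j) * (z - b j)"]
          by (intro mult_left_mono) (auto simp: abs_mult)
        also have "\<dots> \<le> \<delta> * ((L * \<delta>) * 2 + H * \<delta>)"
        proof (intro mult_left_mono add_mono mult_mono)
          have "\<bar>h'' z - h'' (b j)\<bar> \<le> L * \<bar>z - b j\<bar>" by (intro L zb b1)
          also have "\<dots> \<le> L * \<delta>" using z bS L0 by (intro mult_left_mono) auto
          finally show "\<bar>h'' z - h'' (b j)\<bar> \<le> L * \<delta>" .
        qed (use z bS v zb H0 L0 \<delta> H[OF b1(1)] in auto)
        also have "\<dots> \<le> K * \<delta>\<^sup>2" using H0 \<delta> by (simp add: K_def power2_eq_square algebra_simps)
        finally show ?thesis .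
      next
        case 3
        from MVT2[OF 3(1) G] obtain z where z: "b j < z" "z < v"
          and eq: "G v - G (b j) = (v - b j) * (h'' z * (v - z))" by blast
        have zb: "\<bar>z\<bar> \<le> 1" using z b1 v by linarith
        have "A (Suc j) - A j - \<gamma> j * relu (v - b j) = (v - b j) * (h'' z * (v - z)) - (h'' (b j) * \<delta>) * (v - b j)"
          using 3 eq by (simp add: A_def relu_def \<gamma>_def min_def)
        also have "\<bar>\<dots>\<bar> \<le> \<bar>v - b j\<bar> * (\<bar>h'' z\<bar> * \<bar>v - z\<bar>) + (\<bar>h'' (b j)\<bar> * \<delta>) * \<bar>v - b j\<bar>"
          using \<delta> abs_triangle_ineq4[of "(v - b j) * (h'' z * (v - z))" "(h'' (b j) * \<delta>) * (v - b j)"]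
          by (simp add: abs_mult)
        also have "\<dots> \<le> \<delta> * (H * \<delta>) + (H * \<delta>) * \<delta>"
          using 3 z bS \<delta> H0 H[OF zb] H[OF b1(1)] by (intro add_mono mult_mono) auto
        also have "\<dots> \<le> K * \<delta>\<^sup>2" using L0 \<delta> by (simp add: K_def power2_eq_square algebra_simps)
        finally show ?thesis .
      qed
    qed
    have A0: "A 0 = h (-1) + h' (-1) * (v + 1)" and AJ: "A J = h v"
    proof -
      have "min (-1) v = -1" "min 1 v = v" using v by auto
      then show "A 0 = h (-1) + h' (-1) * (v + 1)" "A J = h v"
        using \<delta> by (simp_all add: A_def G_def b_def)
    qed
    have "h v - (h (-1) + h' (-1) * (v + 1) + (\<Sum>(\<gamma>, b)\<leftarrow>qs. \<gamma> * relu (v - b)))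
        = (\<Sum>j<J. A (Suc j) - A j - \<gamma> j * relu (v - b j))"
      using sum_lessThan_telescope[of A J] by (simp add: sum_qs sum_subtractf A0 AJ)
    also have "\<bar>\<dots>\<bar> \<le> (\<Sum>j<J. K * \<delta>\<^sup>2)"
      using step by (intro order_trans[OF sum_abs] sum_mono) auto
    also have "\<dots> = 4 * K / J" using \<open>0 < J\<close> by (simp add: \<delta>_def power2_eq_square field_simps)
    also have "\<dots> \<le> \<epsilon>" using J \<open>0 < J\<close> \<epsilon> by (simp add: field_simps)
    finally show "\<bar>h v - (h (-1) + h' (-1) * (v + 1) + (\<Sum>(\<gamma>, b)\<leftarrow>qs. \<gamma> * relu (v - b)))\<bar> \<le> \<epsilon>" .
  qed
qed

section \<open>Approximation by units in one variable\<close>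

definition line_sum :: "(real \<Rightarrow> real) \<Rightarrow> (real \<times> real \<times> real) list \<Rightarrow> real \<Rightarrow> real" where
  "line_sum \<phi> qs v = (\<Sum>(\<gamma>, l, b)\<leftarrow>qs. \<gamma> * \<phi> (l * v + b))"

text \<open>Slope and offset obey the constraint of \<open>clipped_nets_star\<close>. The weights
  \<open>\<gamma>\<close> are free, because a large weight can later be spread over several
  units.\<close>

definition line_approximable :: "(real \<Rightarrow> real) \<Rightarrow> (real \<Rightarrow> real) \<Rightarrow> bool" where
  "line_approximable \<phi> h \<longleftrightarrow> (\<forall>\<epsilon>>0. \<exists>qs. (\<forall>(\<gamma>, l, b)\<in>set qs. \<bar>l\<bar> \<le> 1 \<and> \<bar>b\<bar> \<le> 1) \<and>
     (\<forall>v. \<bar>v\<bar> \<le> 1 \<longrightarrow> \<bar>h v - line_sum \<phi> qs v\<bar> \<le> \<epsilon>))"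

lemma line_approximable_add:
  assumes "line_approximable \<phi> f" "line_approximable \<phi> g"
  shows "line_approximable \<phi> (\<lambda>v. f v + g v)"
  unfolding line_approximable_def
proof (intro allI impI)
  fix \<epsilon> :: real assume \<epsilon>: "0 < \<epsilon>"
  obtain ps where ps: "\<forall>(\<gamma>, l, b)\<in>set ps. \<bar>l\<bar> \<le> 1 \<and> \<bar>b\<bar> \<le> 1" "\<And>v. \<bar>v\<bar> \<le> 1 \<Longrightarrow> \<bar>f v - line_sum \<phi> ps v\<bar> \<le> \<epsilon> / 2"
    using assms(1) \<epsilon> unfolding line_approximable_def by (meson half_gt_zero)
  obtain qs where qs: "\<forall>(\<gamma>, l, b)\<in>set qs. \<bar>l\<bar> \<le> 1 \<and> \<bar>b\<bar> \<le> 1" "\<And>v. \<bar>v\<bar> \<le> 1 \<Longrightarrow> \<bar>g v - line_sum \<phi> qs v\<bar> \<le> \<epsilon> / 2"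
    using assms(2) \<epsilon> unfolding line_approximable_def by (meson half_gt_zero)
  have "line_sum \<phi> (ps @ qs) v = line_sum \<phi> ps v + line_sum \<phi> qs v" for v by (simp add: line_sum_def)
  then have "\<bar>f v + g v - line_sum \<phi> (ps @ qs) v\<bar> \<le> \<epsilon>" if "\<bar>v\<bar> \<le> 1" for v
    using ps(2)[OF that] qs(2)[OF that] by (simp only:)
  moreover have "\<forall>(\<gamma>, l, b)\<in>set (ps @ qs). \<bar>l\<bar> \<le> 1 \<and> \<bar>b\<bar> \<le> 1" using ps(1) qs(1) by auto
  ultimately show "\<exists>qs. (\<forall>(\<gamma>, l, b)\<in>set qs. \<bar>l\<bar> \<le> 1 \<and> \<bar>b\<bar> \<le> 1) \<and>
      (\<forall>v. \<bar>v\<bar> \<le> 1 \<longrightarrow> \<bar>f v + g v - line_sum \<phi> qs v\<bar> \<le> \<epsilon>)" by blast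
qed

lemma line_approximable_scale:
  assumes "line_approximable \<phi> f"
  shows "line_approximable \<phi> (\<lambda>v. c * f v)"
  unfolding line_approximable_def
proof (intro allI impI)
  fix \<epsilon> :: real assume \<epsilon>: "0 < \<epsilon>"
  define \<eta> where "\<eta> = \<epsilon> / (\<bar>c\<bar> + 1)"
  have "0 < \<eta>" using \<epsilon> by (simp add: \<eta>_def)
  then obtain ps where ps: "\<forall>(\<gamma>, l, b)\<in>set ps. \<bar>l\<bar> \<le> 1 \<and> \<bar>b\<bar> \<le> 1" "\<And>v. \<bar>v\<bar> \<le> 1 \<Longrightarrow> \<bar>f v - line_sum \<phi> ps v\<bar> \<le> \<eta>"
    using assms unfolding line_approximable_def by meson
  let ?qs = "map (\<lambda>(\<gamma>, l, b). (c * \<gamma>, l, b)) ps"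
  have "line_sum \<phi> ?qs v = c * line_sum \<phi> ps v" for v
    by (simp add: line_sum_def case_prod_unfold comp_def mult.assoc flip: sum_list_const_mult)
  then have "\<bar>c * f v - line_sum \<phi> ?qs v\<bar> \<le> \<epsilon>" if "\<bar>v\<bar> \<le> 1" for v
  proof -
    have "\<bar>c\<bar> * \<bar>f v - line_sum \<phi> ps v\<bar> \<le> (\<bar>c\<bar> + 1) * \<eta>"
      using ps(2)[OF that] by (intro mult_mono) auto
    also have "\<dots> = \<epsilon>" by (simp add: \<eta>_def)
    finally show ?thesis using \<open>\<And>v. line_sum \<phi> ?qs v = c * line_sum \<phi> ps v\<close>
      by (simp flip: abs_mult right_diff_distrib)
  qed
  moreover have "\<forall>(\<gamma>, l, b)\<in>set ?qs. \<bar>l\<bar> \<le> 1 \<and> \<bar>b\<bar> \<le> 1" using ps(1) by auto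
  ultimately show "\<exists>qs. (\<forall>(\<gamma>, l, b)\<in>set qs. \<bar>l\<bar> \<le> 1 \<and> \<bar>b\<bar> \<le> 1) \<and>
      (\<forall>v. \<bar>v\<bar> \<le> 1 \<longrightarrow> \<bar>c * f v - line_sum \<phi> qs v\<bar> \<le> \<epsilon>)" by blast
qed

lemma line_approximable_zero: "line_approximable \<phi> (\<lambda>v. 0)"
  unfolding line_approximable_def by (intro allI impI exI[of _ "[]"]) (simp add: line_sum_def)

lemma line_approximable_sum:
  "(\<And>i. i \<in> I \<Longrightarrow> line_approximable \<phi> (f i)) \<Longrightarrow> line_approximable \<phi> (\<lambda>v. \<Sum>i\<in>I. f i v)"
  by (induction I rule: infinite_finite_induct) (simp_all add: line_approximable_zero line_approximable_add)

lemma line_approximable_base: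
  assumes "\<bar>l\<bar> \<le> 1" "\<bar>b\<bar> \<le> 1"
  shows "line_approximable \<phi> (\<lambda>v. \<phi> (l * v + b))"
  unfolding line_approximable_def
  using assms by (intro allI impI exI[of _ "[(1, l, b)]"]) (simp add: line_sum_def)

lemma line_approximable_limit:
  assumes "\<And>\<epsilon>. 0 < \<epsilon> \<Longrightarrow> \<exists>g. line_approximable \<phi> g \<and> (\<forall>v. \<bar>v\<bar> \<le> 1 \<longrightarrow> \<bar>f v - g v\<bar> \<le> \<epsilon>)"
  shows "line_approximable \<phi> f"
  unfolding line_approximable_def
proof (intro allI impI)
  fix \<epsilon> :: real assume \<epsilon>: "0 < \<epsilon>"
  obtain g where g: "line_approximable \<phi> g" "\<And>v. \<bar>v\<bar> \<le> 1 \<Longrightarrow> \<bar>f v - g v\<bar> \<le> \<epsilon> / 2"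
    using assms[of "\<epsilon> / 2"] \<epsilon> by auto
  obtain qs where qs: "\<forall>(\<gamma>, l, b)\<in>set qs. \<bar>l\<bar> \<le> 1 \<and> \<bar>b\<bar> \<le> 1" "\<And>v. \<bar>v\<bar> \<le> 1 \<Longrightarrow> \<bar>g v - line_sum \<phi> qs v\<bar> \<le> \<epsilon> / 2"
    using g(1) \<epsilon> unfolding line_approximable_def by (meson half_gt_zero)
  have "\<bar>f v - line_sum \<phi> qs v\<bar> \<le> \<epsilon>" if "\<bar>v\<bar> \<le> 1" for v
    using g(2)[OF that] qs(2)[OF that] by linarith
  with qs(1) show "\<exists>qs. (\<forall>(\<gamma>, l, b)\<in>set qs. \<bar>l\<bar> \<le> 1 \<and> \<bar>b\<bar> \<le> 1) \<and>
      (\<forall>v. \<bar>v\<bar> \<le> 1 \<longrightarrow> \<bar>f v - line_sum \<phi> qs v\<bar> \<le> \<epsilon>)" by blast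
qed

lemma line_approximable_relu_exp: "line_approximable relu (\<lambda>v. exp (c * v))"
  unfolding line_approximable_def
proof (intro allI impI)
  fix \<epsilon> :: real assume \<epsilon>: "0 < \<epsilon>"
  define h' h'' where "h' v = c * exp (c * v)" and "h'' v = c\<^sup>2 * exp (c * v)" for v
  have d: "((\<lambda>v. exp (c * v)) has_real_derivative h' v) (at v)" "(h' has_real_derivative h'' v) (at v)"
    "(h'' has_real_derivative c ^ 3 * exp (c * v)) (at v)" for v
    unfolding h'_def h''_def by (auto intro!: derivative_eq_intros simp: power2_eq_square power3_eq_cube)
  have e: "exp (c * v) \<le> exp \<bar>c\<bar>" if "\<bar>v\<bar> \<le> 1" for v
  proof -
    have "c * v \<le> \<bar>c\<bar> * \<bar>v\<bar>" using abs_ge_self[of "c * v"] by (simp add: abs_mult)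
    also have "\<dots> \<le> \<bar>c\<bar>" using that by (simp add: mult_left_le)
    finally show ?thesis by simp
  qed
  have lip: "\<bar>h'' u - h'' v\<bar> \<le> (\<bar>c\<bar> ^ 3 * exp \<bar>c\<bar>) * \<bar>u - v\<bar>" if "\<bar>u\<bar> \<le> 1" "\<bar>v\<bar> \<le> 1" for u v
  proof -
    have "norm (h'' u - h'' v) \<le> (\<bar>c\<bar> ^ 3 * exp \<bar>c\<bar>) * norm (u - v)"
    proof (rule field_differentiable_bound)
      show "convex {-1..1::real}" by simp
      show "(h'' has_field_derivative c ^ 3 * exp (c * z)) (at z within {-1..1})" for z
        by (rule has_field_derivative_at_within[OF d(3)])
      show "norm (c ^ 3 * exp (c * z)) \<le> \<bar>c\<bar> ^ 3 * exp \<bar>c\<bar>" if "z \<in> {-1..1}" for z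
        using that e[of z] by (auto simp: abs_mult power_abs intro!: mult_left_mono)
    qed (use that in auto)
    then show ?thesis by simp
  qed
  have H: "\<bar>h'' v\<bar> \<le> c\<^sup>2 * exp \<bar>c\<bar>" if "\<bar>v\<bar> \<le> 1" for v
    using e[OF that] by (auto simp: h''_def abs_mult intro!: mult_left_mono)
  obtain qs :: "(real \<times> real) list" where qs: "\<And>\<gamma> b. (\<gamma>, b) \<in> set qs \<Longrightarrow> \<bar>b\<bar> \<le> 1"
    and app: "\<And>v. \<bar>v\<bar> \<le> 1 \<Longrightarrow> \<bar>exp (c * v) - (exp (c * (-1)) + h' (-1) * (v + 1) + (\<Sum>(\<gamma>, b)\<leftarrow>qs. \<gamma> * relu (v - b)))\<bar> \<le> \<epsilon>"
    using taylor_relu_sum[OF d(1,2) H lip \<epsilon>] by metis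
  \<comment> \<open>On \<open>[-1, 1]\<close> the unit with slope 0 and offset 1 is the constant 1,
    and the one with slope and offset 1 is \<open>v + 1\<close>. So the affine part of the Taylor
    formula consists of units too.\<close>
  define ps :: "(real \<times> real \<times> real) list" where
    "ps = (exp (c * (-1)), 0, 1) # (h' (-1), 1, 1) # map (\<lambda>(\<gamma>, b). (\<gamma>, 1, - b)) qs"
  have "line_sum relu ps v = exp (c * (-1)) + h' (-1) * (v + 1) + (\<Sum>(\<gamma>, b)\<leftarrow>qs. \<gamma> * relu (v - b))" if "\<bar>v\<bar> \<le> 1" for v
  proof -
    have "relu (v + 1) = v + 1" "relu 1 = 1" using that by (auto simp: relu_def)
    then show ?thesis by (simp add: line_sum_def ps_def comp_def case_prod_unfold)
  qed
  moreover have "\<forall>(\<gamma>, l, b)\<in>set ps. \<bar>l\<bar> \<le> 1 \<and> \<bar>b\<bar> \<le> 1" using qs by (auto simp: ps_def)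
  ultimately show "\<exists>qs. (\<forall>(\<gamma>, l, b)\<in>set qs. \<bar>l\<bar> \<le> 1 \<and> \<bar>b\<bar> \<le> 1) \<and>
      (\<forall>v. \<bar>v\<bar> \<le> 1 \<longrightarrow> \<bar>exp (c * v) - line_sum relu qs v\<bar> \<le> \<epsilon>)" using app by (intro exI[of _ ps]) simp
qed

text \<open>Expand \<open>D 0 (l * v + b)\<close> in powers of \<open>l * v\<close> at a point
  \<open>b\<close> where the \<open>m\<close>-th derivative does not vanish. Removing the lower
  powers, which are approximable by induction, and dividing by the coefficient of
  \<open>v ^ m\<close> leaves an error that tends to 0 with the slope \<open>l\<close>.\<close>

lemma line_approximable_monomial:
  fixes D :: "nat \<Rightarrow> real \<Rightarrow> real"
  assumes D: "\<And>m v. (D m has_real_derivative D (Suc m) v) (at v)"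
    and K: "\<And>m. \<exists>K. \<forall>v. \<bar>D m v\<bar> \<le> K"
    and nz: "\<And>m. \<exists>b. \<bar>b\<bar> \<le> 1 \<and> D m b \<noteq> 0"
  shows "line_approximable (D 0) (\<lambda>v. v ^ m)"
proof (induction m rule: less_induct)
  case (less m)
  obtain b where b: "\<bar>b\<bar> \<le> 1" "D m b \<noteq> 0" using nz by blast
  obtain K where K: "\<And>v. \<bar>D (Suc m) v\<bar> \<le> K" using K by blast
  have K0: "0 \<le> K" using K[of 0] by linarith
  show ?case
  proof (rule line_approximable_limit)
    fix \<epsilon> :: real assume \<epsilon>: "0 < \<epsilon>"
    \<comment> \<open>After division by the coefficient of \<open>v ^ m\<close> the Taylor remainder
      is at most \<open>C * l\<close> on \<open>[-1, 1]\<close>, and \<open>l\<close> is chosen to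
      bring this below \<open>\<epsilon>\<close>.\<close>
    define C where "C = K * fact m / (\<bar>D m b\<bar> * fact (Suc m))"
    have C0: "0 \<le> C" using K0 by (simp add: C_def)
    define l where "l = min 1 (\<epsilon> / (C + 1))"
    have l: "0 < l" "l \<le> 1" using \<epsilon> C0 by (auto simp: l_def)
    have "C * l \<le> (C + 1) * (\<epsilon> / (C + 1))" using C0 l \<epsilon> by (intro mult_mono) (auto simp: l_def)
    then have lC: "C * l \<le> \<epsilon>" using C0 by simp
    define g where "g v = (fact m / (D m b * l ^ m)) * (D 0 (l * v + b) + (\<Sum>i<m. (- (D i b / fact i * l ^ i)) * v ^ i))" for v
    have "line_approximable (D 0) g"
      unfolding g_def using l b
      by (intro line_approximable_scale line_approximable_add line_approximable_sum line_approximable_base less) auto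
    moreover have "\<bar>v ^ m - g v\<bar> \<le> \<epsilon>" if v: "\<bar>v\<bar> \<le> 1" for v
    proof -
      have taylor: "\<exists>t. D 0 (y + b) = (\<Sum>i<Suc m. D i b / fact i * y ^ i) + D (Suc m) t / fact (Suc m) * y ^ Suc m"
        if y: "\<bar>y\<bar> \<le> 1" for y
      proof (cases "y = 0")
        case True
        then have "(\<Sum>i<Suc m. D i b / fact i * y ^ i) = (\<Sum>i<Suc m. if i = 0 then D 0 b else 0)"
          by (intro sum.cong) (auto simp: power_0_left)
        then show ?thesis using True by (simp del: sum.lessThan_Suc)
      next
        case False
        have "\<exists>t. (if y + b < b then y + b < t \<and> t < b else b < t \<and> t < y + b) \<and>
            D 0 (y + b) = (\<Sum>i<Suc m. D i b / fact i * ((y + b) - b) ^ i) + D (Suc m) t / fact (Suc m) * ((y + b) - b) ^ Suc m"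
          using b y False by (intro Taylor[where a = "-2" and b = 2]) (auto simp: D)
        then show ?thesis by auto
      qed
      have "\<bar>l * v\<bar> \<le> 1" using l v by (simp add: abs_mult mult_le_one)
      from taylor[OF this]
      obtain t where t: "D 0 (l * v + b) = (\<Sum>i<Suc m. D i b / fact i * (l * v) ^ i) + D (Suc m) t / fact (Suc m) * (l * v) ^ Suc m"
        by blast
      have "D 0 (l * v + b) + (\<Sum>i<m. (- (D i b / fact i * l ^ i)) * v ^ i)
          = D m b / fact m * (l * v) ^ m + D (Suc m) t / fact (Suc m) * (l * v) ^ Suc m"
        by (simp add: t sum_negf power_mult_distrib mult.assoc)
      then have "g v - v ^ m = fact m / (D m b * l ^ m) * (D (Suc m) t / fact (Suc m) * (l * v) ^ Suc m)"
        using b l by (simp add: g_def distrib_left power_mult_distrib del: power_Suc fact_Suc)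
      also have "\<dots> = (D (Suc m) t * fact m / (D m b * fact (Suc m))) * (l * v ^ Suc m)"
        using b l by (simp add: power_mult_distrib field_simps del: fact_Suc)
      finally have "\<bar>v ^ m - g v\<bar> = \<bar>D (Suc m) t\<bar> * fact m / (\<bar>D m b\<bar> * fact (Suc m)) * (l * \<bar>v\<bar> ^ Suc m)"
        using l by (simp add: abs_mult abs_minus_commute power_abs del: fact_Suc power_Suc)
      also have "\<dots> \<le> C * (l * 1)"
        unfolding C_def using l v K0 K[of t]
        by (intro mult_mono divide_right_mono mult_left_mono power_le_one mult_right_mono) auto
      finally show ?thesis using lC by simp
    qed
    ultimately show "\<exists>g. line_approximable (D 0) g \<and> (\<forall>v. \<bar>v\<bar> \<le> 1 \<longrightarrow> \<bar>v ^ m - g v\<bar> \<le> \<epsilon>)" by blast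
  qed
qed

lemma sigmoid_has_derivative: "(sigmoid has_real_derivative sigmoid v * (1 - sigmoid v)) (at v)"
proof -
  have "1 + exp (- v) \<noteq> 0" using exp_gt_zero[of "- v"] by linarith
  then show ?thesis unfolding sigmoid_def
    by (auto intro!: derivative_eq_intros simp: field_simps power2_eq_square)
qed

lemma sigmoid_bounds: "0 < sigmoid v" "sigmoid v < 1"
  by (simp_all add: sigmoid_def add_pos_pos)

lemma sigmoid_strict_mono: "u < v \<Longrightarrow> sigmoid u < sigmoid v"
  by (simp add: sigmoid_def add_pos_pos divide_strict_left_mono)

text \<open>Since \<open>\<sigma>' = \<sigma> (1 - \<sigma>)\<close>, the \<open>m\<close>-th derivative of the sigmoid is a polynomial
  of degree \<open>m + 1\<close> in \<open>\<sigma>\<close>.\<close>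

primrec sigmoid_poly :: "nat \<Rightarrow> real poly" where
  "sigmoid_poly 0 = [:0, 1:]"
| "sigmoid_poly (Suc m) = pderiv (sigmoid_poly m) * [:0, 1, -1:]"

lemma degree_sigmoid_poly: "degree (sigmoid_poly m) = Suc m"
proof (induction m)
  case (Suc m)
  then have "pderiv (sigmoid_poly m) \<noteq> 0" by (simp add: pderiv_eq_0_iff)
  then show ?case using Suc by (simp add: degree_mult_eq degree_pderiv del: mult_pCons_right)
qed simp

lemma line_approximable_sigmoid_monomial: "line_approximable sigmoid (\<lambda>v. v ^ m)"
proof -
  define D where "D m v = poly (sigmoid_poly m) (sigmoid v)" for m v
  have "line_approximable (D 0) (\<lambda>v. v ^ m)"
  proof (rule line_approximable_monomial)
    show "(D m has_real_derivative D (Suc m) v) (at v)" for m v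
      unfolding D_def
      by (rule DERIV_cong[OF DERIV_chain2[OF poly_DERIV sigmoid_has_derivative]]) (simp add: algebra_simps)
    show "\<exists>K. \<forall>v. \<bar>D m v\<bar> \<le> K" for m
    proof -
      have "compact (poly (sigmoid_poly m) ` {0..1})"
        by (intro compact_continuous_image continuous_intros) simp
      then obtain K where K: "\<And>x. x \<in> {0..1} \<Longrightarrow> \<bar>poly (sigmoid_poly m) x\<bar> \<le> K"
        using compact_imp_bounded[THEN bounded_iff[THEN iffD1]] by (metis imageI real_norm_def)
      show ?thesis using K sigmoid_bounds by (intro exI[of _ K]) (auto simp: D_def less_imp_le)
    qed
    show "\<exists>b. \<bar>b\<bar> \<le> 1 \<and> D m b \<noteq> 0" for m
    proof (rule ccontr)
      assume "\<nexists>b. \<bar>b\<bar> \<le> 1 \<and> D m b \<noteq> 0"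
      \<comment> \<open>The sigmoid takes infinitely many values on \<open>[-1, 1]\<close>, but a
        nonzero polynomial has only finitely many roots.\<close>
      then have "sigmoid ` {-1..1} \<subseteq> {x. poly (sigmoid_poly m) x = 0}" by (auto simp: D_def)
      moreover have "sigmoid_poly m \<noteq> 0" using degree_sigmoid_poly[of m] by auto
      ultimately have "finite (sigmoid ` {-1..1})" using poly_roots_finite finite_subset by blast
      moreover have "inj_on sigmoid {-1..1}"
        by (rule inj_onI) (metis less_irrefl linorder_neqE_linordered_idom sigmoid_strict_mono)
      ultimately have "finite {-1..1::real}" by (rule finite_imageD)
      then show False by (simp add: infinite_Icc)
    qed
  qed
  moreover have "D 0 = sigmoid" by (simp add: D_def fun_eq_iff)
  ultimately show ?thesis by simp
qed

text \<open>Exponentials are reached through polynomials: Weierstrass approximation on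
  \<open>[-1, 1]\<close>, then the result for monomials.\<close>

lemma line_approximable_sigmoid_exp: "line_approximable sigmoid (\<lambda>v. exp (c * v))"
proof (rule line_approximable_limit)
  fix \<epsilon> :: real assume \<epsilon>: "0 < \<epsilon>"
  obtain g where g: "real_polynomial_function g" "\<And>x. x \<in> {-1..1} \<Longrightarrow> \<bar>exp (c * x) - g x\<bar> < \<epsilon>"
    by (rule Stone_Weierstrass_real_polynomial_function[of "{-1..1}" "\<lambda>x. exp (c * x)" \<epsilon>])
      (auto intro!: continuous_intros \<epsilon>)
  then obtain a n where "g = (\<lambda>x. \<Sum>i\<le>n. a i * x ^ i)" by (auto simp: real_polynomial_function_iff_sum)
  then have "line_approximable sigmoid g"
    by (simp only:) (intro line_approximable_sum line_approximable_scale line_approximable_sigmoid_monomial)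
  moreover have "\<bar>exp (c * v) - g v\<bar> \<le> \<epsilon>" if "\<bar>v\<bar> \<le> 1" for v
    using g(2)[of v] that by (auto simp: abs_le_iff)
  ultimately show "\<exists>g. line_approximable sigmoid g \<and> (\<forall>v. \<bar>v\<bar> \<le> 1 \<longrightarrow> \<bar>exp (c * v) - g v\<bar> \<le> \<epsilon>)"
    by blast
qed

section \<open>From one variable to continuous functions on the cube\<close>

lemma norm1_eq_0_iff: "norm1 w = 0 \<longleftrightarrow> w = 0"
  by (simp add: norm1_def sum_nonneg_eq_0_iff vec_eq_iff)

definition ridge_approximable :: "(real \<Rightarrow> real) \<Rightarrow> (real ^ 'd \<Rightarrow> real) \<Rightarrow> bool" where
  "ridge_approximable \<phi> f \<longleftrightarrow> (\<forall>\<epsilon>>0. \<exists>ps. (\<forall>(\<gamma>, w, b)\<in>set ps. norm1 w \<le> 1 \<and> \<bar>b\<bar> \<le> 1) \<and>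
     (\<forall>x\<in>unit_cube. \<bar>f x - ridge_sum \<phi> ps x\<bar> \<le> \<epsilon>))"

lemma ridge_approximable_add:
  assumes "ridge_approximable \<phi> f" "ridge_approximable \<phi> g"
  shows "ridge_approximable \<phi> (\<lambda>v. f v + g v)"
  unfolding ridge_approximable_def
proof (intro allI impI)
  fix \<epsilon> :: real assume \<epsilon>: "0 < \<epsilon>"
  obtain ps where ps: "\<forall>(\<gamma>, w, b)\<in>set ps. norm1 w \<le> 1 \<and> \<bar>b\<bar> \<le> 1" "\<And>x. x \<in> unit_cube \<Longrightarrow> \<bar>f x - ridge_sum \<phi> ps x\<bar> \<le> \<epsilon> / 2"
    using assms(1) \<epsilon> unfolding ridge_approximable_def by (meson half_gt_zero)
  obtain qs where qs: "\<forall>(\<gamma>, w, b)\<in>set qs. norm1 w \<le> 1 \<and> \<bar>b\<bar> \<le> 1" "\<And>x. x \<in> unit_cube \<Longrightarrow> \<bar>g x - ridge_sum \<phi> qs x\<bar> \<le> \<epsilon> / 2"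
    using assms(2) \<epsilon> unfolding ridge_approximable_def by (meson half_gt_zero)
  have "\<bar>f x + g x - ridge_sum \<phi> (ps @ qs) x\<bar> \<le> \<epsilon>" if "x \<in> unit_cube" for x
    unfolding ridge_sum_simps using ps(2)[OF that] qs(2)[OF that] by linarith
  moreover have "\<forall>(\<gamma>, w, b)\<in>set (ps @ qs). norm1 w \<le> 1 \<and> \<bar>b\<bar> \<le> 1" using ps(1) qs(1) by auto
  ultimately show "\<exists>ps. (\<forall>(\<gamma>, w, b)\<in>set ps. norm1 w \<le> 1 \<and> \<bar>b\<bar> \<le> 1) \<and>
     (\<forall>x\<in>unit_cube. \<bar>f x + g x - ridge_sum \<phi> ps x\<bar> \<le> \<epsilon>)" by blast
qed

lemma ridge_approximable_line:
  fixes w :: "real ^ 'd"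
  assumes "line_approximable \<phi> h" "norm1 w \<le> 1"
  shows "ridge_approximable \<phi> (\<lambda>x. h (w \<bullet> x))"
  unfolding ridge_approximable_def
proof (intro allI impI)
  fix \<epsilon> :: real assume "0 < \<epsilon>"
  with assms(1) obtain qs where qs: "\<forall>(\<gamma>, l, b)\<in>set qs. \<bar>l\<bar> \<le> 1 \<and> \<bar>b\<bar> \<le> 1" "\<And>v. \<bar>v\<bar> \<le> 1 \<Longrightarrow> \<bar>h v - line_sum \<phi> qs v\<bar> \<le> \<epsilon>"
    unfolding line_approximable_def by meson
  let ?ps = "map (\<lambda>(\<gamma>, l, b). (\<gamma>, l *\<^sub>R w, b)) qs"
  have "ridge_sum \<phi> ?ps x = line_sum \<phi> qs (w \<bullet> x)" for x
    by (simp add: ridge_sum_def line_sum_def case_prod_unfold comp_def)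
  moreover have "\<bar>w \<bullet> x\<bar> \<le> 1" if "x \<in> unit_cube" for x
    using inner_abs_le_norm1[of x w] that assms(2) by (auto simp: unit_cube_def)
  moreover have "\<forall>(\<gamma>, v, b)\<in>set ?ps. norm1 v \<le> 1 \<and> \<bar>b\<bar> \<le> 1"
    using qs(1) assms(2) by (auto simp: norm1_scale intro!: mult_le_one norm1_nonneg)
  ultimately show "\<exists>ps. (\<forall>(\<gamma>, w, b)\<in>set ps. norm1 w \<le> 1 \<and> \<bar>b\<bar> \<le> 1) \<and>
     (\<forall>x\<in>unit_cube. \<bar>h (w \<bullet> x) - ridge_sum \<phi> ps x\<bar> \<le> \<epsilon>)" using qs(2) by (intro exI[of _ ?ps]) simp
qed

text \<open>Closure under sums is enough to obtain an algebra, since a product of two exponentials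
  is an exponential. Each generator depends on \<open>x\<close> through \<open>w \<bullet> x\<close>
  only, hence reduces to one variable.\<close>

inductive_set exp_sums :: "(real ^ 'd \<Rightarrow> real) set" where
  exp: "(\<lambda>x. c * exp (w \<bullet> x)) \<in> exp_sums"
| add: "f \<in> exp_sums \<Longrightarrow> g \<in> exp_sums \<Longrightarrow> (\<lambda>x. f x + g x) \<in> exp_sums"

lemma exp_sums_mult:
  assumes "f \<in> exp_sums" "g \<in> exp_sums"
  shows "(\<lambda>x. f x * g x) \<in> exp_sums"
  using assms(1)
proof induction
  case (exp c v)
  from assms(2) show ?case
  proof induction
    case (exp d w)
    have "(\<lambda>x. c * exp (v \<bullet> x) * (d * exp (w \<bullet> x))) = (\<lambda>x. (c * d) * exp ((v + w) \<bullet> x))"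
      by (simp add: fun_eq_iff inner_add_left exp_add)
    then show ?case by (metis exp_sums.exp)
  next
    case (add f g)
    then show ?case using exp_sums.add by (simp add: distrib_left)
  qed
next
  case (add f g)
  then show ?case using exp_sums.add by (simp add: distrib_right)
qed

lemma exp_sums_continuous: "f \<in> exp_sums \<Longrightarrow> continuous_on S f"
  by (induction rule: exp_sums.induct) (auto intro!: continuous_intros)

lemma exp_sums_dense:
  fixes f :: "real ^ 'd \<Rightarrow> real"
  assumes "continuous_on unit_cube f" "0 < \<epsilon>"
  shows "\<exists>g\<in>exp_sums. \<forall>x\<in>unit_cube. \<bar>f x - g x\<bar> < \<epsilon>"
proof -
  interpret function_ring_on exp_sums "unit_cube :: (real ^ 'd) set"
  proof
    show "compact (unit_cube :: (real ^ 'd) set)" by (rule unit_cube_compact)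
  next
    fix c :: real
    show "(\<lambda>_. c) \<in> exp_sums" using exp_sums.exp[of c 0] by simp
  next
    fix x y :: "real ^ 'd" assume "x \<noteq> y"
    then obtain i where "x $ i \<noteq> y $ i" by (auto simp: vec_eq_iff)
    then have "1 * exp (axis i 1 \<bullet> x) \<noteq> 1 * exp (axis i 1 \<bullet> y)" by (simp add: inner_axis' )
    then show "\<exists>f\<in>exp_sums. f x \<noteq> f y" by (rule bexI[OF _ exp_sums.exp])
  qed (rule exp_sums_continuous exp_sums.add exp_sums_mult; assumption)+
  obtain F where F: "F \<in> UNIV \<rightarrow> exp_sums" "uniform_limit unit_cube F f sequentially"
    using Stone_Weierstrass[OF assms(1)] by blast
  from uniform_limitD[OF F(2) assms(2)] obtain n where "\<forall>x\<in>unit_cube. dist (F n x) (f x) < \<epsilon>"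
    by (auto simp: eventually_sequentially)
  then show ?thesis using F(1) by (intro bexI[of _ "F n"]) (auto simp: dist_real_def abs_minus_commute)
qed

lemma ridge_approximable_continuous:
  fixes f :: "real ^ 'd \<Rightarrow> real"
  assumes \<phi>: "\<phi> \<in> {sigmoid, relu}" and f: "continuous_on unit_cube f"
  shows "ridge_approximable \<phi> f"
proof -
  have ex: "line_approximable \<phi> (\<lambda>v. exp (c * v))" for c
    using \<phi> line_approximable_sigmoid_exp line_approximable_relu_exp by auto
  have E: "ridge_approximable \<phi> g" if "g \<in> exp_sums" for g :: "real ^ 'd \<Rightarrow> real"
    using that
  proof induction
    case (exp c w)
    \<comment> \<open>The direction is scaled to \<open>norm1\<close> at most 1, so that the inner
      product stays in \<open>[-1, 1]\<close> on the cube, and the length goes into the exponent.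
      For \<open>w = 0\<close> division by zero gives direction 0, which is correct.\<close>
    have "ridge_approximable \<phi> (\<lambda>x. c * exp (norm1 w * (((1 / norm1 w) *\<^sub>R w) \<bullet> x)))"
    proof (rule ridge_approximable_line)
      show "line_approximable \<phi> (\<lambda>v. c * exp (norm1 w * v))" by (rule line_approximable_scale[OF ex])
      show "norm1 ((1 / norm1 w) *\<^sub>R w) \<le> 1" using norm1_nonneg[of w] by (simp add: norm1_scale divide_le_eq_1)
    qed
    moreover have "norm1 w * (((1 / norm1 w) *\<^sub>R w) \<bullet> x) = w \<bullet> x" for x
    proof (cases "norm1 w = 0")
      case True
      then have "w = 0" by (simp add: norm1_eq_0_iff)
      then show ?thesis by simp
    qed simp
    ultimately show ?case by simp
  next
    case (add f g)
    then show ?case by (intro ridge_approximable_add)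
  qed
  show ?thesis
    unfolding ridge_approximable_def
  proof (intro allI impI)
    fix \<epsilon> :: real assume \<epsilon>: "0 < \<epsilon>"
    obtain g where g: "g \<in> exp_sums" "\<And>x. x \<in> unit_cube \<Longrightarrow> \<bar>f x - g x\<bar> < \<epsilon> / 2"
      using exp_sums_dense[OF f, of "\<epsilon> / 2"] \<epsilon> by auto
    obtain ps where ps: "\<forall>(\<gamma>, w, b)\<in>set ps. norm1 w \<le> 1 \<and> \<bar>b\<bar> \<le> 1" "\<And>x. x \<in> unit_cube \<Longrightarrow> \<bar>g x - ridge_sum \<phi> ps x\<bar> \<le> \<epsilon> / 2"
      using E[OF g(1)] \<epsilon> unfolding ridge_approximable_def by (meson half_gt_zero)
    have "\<bar>f x - ridge_sum \<phi> ps x\<bar> \<le> \<epsilon>" if "x \<in> unit_cube" for x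
      using g(2)[OF that] ps(2)[OF that] by linarith
    with ps(1) show "\<exists>ps. (\<forall>(\<gamma>, w, b)\<in>set ps. norm1 w \<le> 1 \<and> \<bar>b\<bar> \<le> 1) \<and>
       (\<forall>x\<in>unit_cube. \<bar>f x - ridge_sum \<phi> ps x\<bar> \<le> \<epsilon>)" by blast
  qed
qed

section \<open>Consistency\<close>

lemma ridge_sum_affine_in_nets:
  fixes qs :: "(real \<times> (real ^ 'd) \<times> real) list"
  assumes qs: "\<forall>(\<gamma>, w, b)\<in>set qs. norm1 w \<le> a1 \<and> \<bar>b\<bar> \<le> a1 \<and> \<bar>\<gamma>\<bar> \<le> a2"
    and "length qs \<le> k" "0 \<le> a1" "0 \<le> a2" "\<bar>b0\<bar> \<le> a3" "norm1 w0 \<le> a4"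
  shows "(\<lambda>x. ridge_sum \<phi> qs x + w0 \<bullet> x + b0) \<in> nets k a1 a2 a3 a4 \<phi>"
proof -
  \<comment> \<open>Networks number their units from 1 and lists from 0; the missing units are
    padded with weight 0.\<close>
  define p where "p i = (if i - 1 < length qs then qs ! (i - 1) else (0, 0, 0))" for i :: nat
  define \<beta> w b where "\<beta> i = fst (p i)" and "w i = fst (snd (p i))" and "b i = snd (snd (p i))" for i
  have "(\<Sum>i=1..k. \<beta> i * \<phi> (w i \<bullet> x + b i)) = ridge_sum \<phi> qs x" for x
  proof -
    let ?F = "\<lambda>p :: real \<times> (real ^ 'd) \<times> real. fst p * \<phi> (fst (snd p) \<bullet> x + snd (snd p))"
    have "(\<Sum>i=1..k. \<beta> i * \<phi> (w i \<bullet> x + b i)) = (\<Sum>i<k. ?F (p (Suc i)))"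
      by (simp add: sum.atLeast1_atMost_eq \<beta>_def w_def b_def)
    also have "\<dots> = (\<Sum>i<length qs. ?F (qs ! i))"
      using assms(2) by (intro sum.mono_neutral_cong_right) (auto simp: p_def)
    also have "\<dots> = ridge_sum \<phi> qs x"
      by (simp add: ridge_sum_def case_prod_unfold sum_list_sum_nth atLeast0LessThan)
    finally show ?thesis .
  qed
  moreover have "max (norm1 (w i)) \<bar>b i\<bar> \<le> a1 \<and> \<bar>\<beta> i\<bar> \<le> a2" for i
  proof (cases "i - 1 < length qs")
    case True
    then have "p i \<in> set qs" by (simp add: p_def)
    then show ?thesis using qs by (auto simp: \<beta>_def w_def b_def case_prod_unfold)
  qed (use assms in \<open>auto simp: \<beta>_def w_def b_def p_def\<close>)
  ultimately show ?thesis
    unfolding nets_def using assms(5,6)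
    by (intro CollectI exI[of _ \<beta>] exI[of _ w] exI[of _ b] exI[of _ w0] exI[of _ b0]) auto
qed

text \<open>Splitting every unit into \<open>R\<close> equal copies trades large weights for many
  units. This is how sums with arbitrary weights enter \<open>clipped_nets_star\<close>, whose
  weights are at most 1 while \<open>k\<close> grows.\<close>

lemma ridge_sum_concat_replicate:
  assumes "0 < R"
  shows "ridge_sum \<phi> (concat (map (\<lambda>(\<gamma>, w, b). replicate R (\<gamma> / real R, w, b)) ps)) x = ridge_sum \<phi> ps x"
proof (induction ps)
  case (Cons p ps)
  have "ridge_sum \<phi> (replicate r (\<gamma>, w, b)) x = real r * (\<gamma> * \<phi> (w \<bullet> x + b))" for r \<gamma> w b
    by (induction r) (simp_all add: algebra_simps)
  with Cons assms show ?case by (cases p) simp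
qed simp

lemma abs_le_sum_list:
  fixes f :: "'a \<Rightarrow> real"
  shows "x \<in> set xs \<Longrightarrow> \<bar>f x\<bar> \<le> (\<Sum>x\<leftarrow>xs. \<bar>f x\<bar>)"
proof (induction xs)
  case (Cons y ys)
  have "0 \<le> (\<Sum>x\<leftarrow>ys. \<bar>f x\<bar>)" by (intro sum_list_nonneg) auto
  then show ?case using Cons by auto
qed simp

lemma ridge_sum_in_nets_star:
  fixes ps :: "(real \<times> (real ^ 'd) \<times> real) list"
  assumes ps: "\<forall>(\<gamma>, w, b)\<in>set ps. norm1 w \<le> 1 \<and> \<bar>b\<bar> \<le> 1"
  shows "\<exists>k0. \<forall>k\<ge>k0. ridge_sum \<phi> ps \<in> nets k 1 1 1 0 \<phi>"
proof -
  obtain R :: nat where R: "(\<Sum>p\<leftarrow>ps. \<bar>fst p\<bar>) < R" using reals_Archimedean2 by blast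
  have "0 \<le> (\<Sum>p\<leftarrow>ps. \<bar>fst p\<bar>)" by (intro sum_list_nonneg) auto
  then have R0: "0 < R" using R by linarith
  let ?qs = "concat (map (\<lambda>(\<gamma>, w, b). replicate R (\<gamma> / real R, w, b)) ps)"
  have le: "\<bar>\<gamma>\<bar> \<le> R" if "(\<gamma>, w, b) \<in> set ps" for \<gamma> w b
    using abs_le_sum_list[OF that, of fst] R by simp
  have "ridge_sum \<phi> ps \<in> nets k 1 1 1 0 \<phi>" if "length ?qs \<le> k" for k
  proof -
    have "(\<lambda>x. ridge_sum \<phi> ?qs x + 0 \<bullet> x + 0) \<in> nets k 1 1 1 0 \<phi>"
    proof (rule ridge_sum_affine_in_nets)
      show "\<forall>(\<gamma>, w, b)\<in>set ?qs. norm1 w \<le> 1 \<and> \<bar>b\<bar> \<le> 1 \<and> \<bar>\<gamma>\<bar> \<le> 1"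
        using ps le R0 by (auto simp: divide_le_eq_1)
    qed (use that in auto)
    then show ?thesis by (simp add: ridge_sum_concat_replicate[OF R0])
  qed
  then show ?thesis by blast
qed

text \<open>Contraction asks for an activation vanishing at 0, hence
  \<open>\<phi> z - \<phi> 0\<close>. The constants split off by this are added to \<open>b0\<close>
  and carried by one unit with \<open>w = 0\<close> and offset 1, whose value
  \<open>\<phi> 1 - \<phi> 0\<close> is at least \<open>1 / 6\<close>. Its weight is at most
  \<open>6 + 3 * k\<close>, the other weights sum to at most \<open>k\<close>, and
  \<open>10 * k\<close> covers both for positive \<open>k\<close>.\<close>

lemma nets_star_subset_hull:
  fixes \<phi> :: "real \<Rightarrow> real"
  assumes \<phi>: "\<phi> \<in> {sigmoid, relu}" and k: "0 < k"
  shows "(nets k 1 1 1 0 \<phi> :: (real ^ 'd \<Rightarrow> real) set) \<subseteq> ridge_hull (10 * real k) (\<lambda>z. \<phi> z - \<phi> 0)"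
proof
  fix g :: "real ^ 'd \<Rightarrow> real" assume "g \<in> nets k 1 1 1 0 \<phi>"
  then obtain \<beta> b w0 b0 and w :: "nat \<Rightarrow> real ^ 'd" where
    g: "g = (\<lambda>x. (\<Sum>i=1..k. \<beta> i * \<phi> (w i \<bullet> x + b i)) + w0 \<bullet> x + b0)"
    and p: "\<And>i. i \<in> {1..k} \<Longrightarrow> norm1 (w i) \<le> 1 \<and> \<bar>b i\<bar> \<le> 1 \<and> \<bar>\<beta> i\<bar> \<le> 1" and b0: "\<bar>b0\<bar> \<le> 1" and "norm1 w0 \<le> 0"
    unfolding nets_def by auto
  have w0: "w0 = 0" using \<open>norm1 w0 \<le> 0\<close> norm1_nonneg[of w0] norm1_eq_0_iff[of w0] by linarith
  have \<phi>1: "1 / 6 \<le> \<phi> 1 - \<phi> 0"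
  proof -
    have "exp (- 1 :: real) \<le> 1 / 2" using exp_ge_add_one_self[of "1 :: real"] by (simp add: exp_minus field_simps)
    then have "1 / (3 / 2) \<le> 1 / (1 + exp (- 1 :: real))" by (intro divide_left_mono) (auto intro!: mult_pos_pos add_pos_pos)
    then show ?thesis using \<phi> by (auto simp: sigmoid_def relu_def)
  qed
  have \<phi>0: "0 \<le> \<phi> 0" "\<phi> 0 \<le> 1 / 2" using \<phi> by (auto simp: sigmoid_def relu_def)
  define c where "c = (b0 + (\<Sum>i=1..k. \<beta> i) * \<phi> 0) / (\<phi> 1 - \<phi> 0)"
  have "\<bar>\<Sum>i=1..k. \<beta> i\<bar> \<le> (\<Sum>i=1..k. 1)" using p by (intro order_trans[OF sum_abs] sum_mono) auto
  then have s: "\<bar>\<Sum>i=1..k. \<beta> i\<bar> \<le> k" by simp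
  have "\<bar>b0 + (\<Sum>i=1..k. \<beta> i) * \<phi> 0\<bar> \<le> 1 + k * (1 / 2)"
  proof -
    have "\<bar>\<Sum>i=1..k. \<beta> i\<bar> * \<phi> 0 \<le> k * (1 / 2)" using s \<phi>0 by (intro mult_mono) auto
    then have "\<bar>(\<Sum>i=1..k. \<beta> i) * \<phi> 0\<bar> \<le> k * (1 / 2)" using \<phi>0 by (simp add: abs_mult)
    then show ?thesis using b0 by linarith
  qed
  then have "\<bar>c\<bar> \<le> (1 + k * (1 / 2)) / (1 / 6)"
    unfolding c_def abs_divide using \<phi>1 by (intro frac_le) auto
  then have c: "\<bar>c\<bar> \<le> 6 + 3 * real k" by simp
  define ps where "ps = (c, 0 :: real ^ 'd, 1) # map (\<lambda>i. (\<beta> i, w i, b i)) [1..<Suc k]"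
  have "(\<Sum>i=1..k. \<bar>\<beta> i\<bar>) \<le> (\<Sum>i=1..k. 1)" using p by (intro sum_mono) auto
  then have "ridge_params (10 * real k) ps"
    using p c k by (auto simp: ridge_params_def ps_def comp_def interv_sum_list_conv_sum_set_nat atLeastLessThanSuc_atLeastAtMost simp del: upt_Suc)
  moreover have "g = ridge_sum (\<lambda>z. \<phi> z - \<phi> 0) ps"
  proof
    fix x
    have "c * (\<phi> 1 - \<phi> 0) = b0 + (\<Sum>i=1..k. \<beta> i) * \<phi> 0" using \<phi>1 by (simp add: c_def)
    then show "g x = ridge_sum (\<lambda>z. \<phi> z - \<phi> 0) ps x"
      by (simp add: g w0 ps_def ridge_sum_def comp_def interv_sum_list_conv_sum_set_nat atLeastLessThanSuc_atLeastAtMost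
          right_diff_distrib sum_subtractf sum_distrib_right del: upt_Suc)
  qed
  ultimately show "g \<in> ridge_hull (10 * real k) (\<lambda>z. \<phi> z - \<phi> 0)" unfolding ridge_hull_def by blast
qed

text \<open>The outer weights sum to at most \<open>2 * a\<close>. The affine part is
  \<open>relu z - relu (- z)\<close> for a rescaled argument, two units of weight \<open>a\<close>
  each.\<close>

lemma nets_relu_subset_hull:
  fixes a :: real
  assumes a: "0 < a" and k: "0 < k"
  shows "(nets k 1 (2 * a / k) a a relu :: (real ^ 'd \<Rightarrow> real) set) \<subseteq> ridge_hull (4 * a) relu"
proof
  fix g :: "real ^ 'd \<Rightarrow> real" assume "g \<in> nets k 1 (2 * a / k) a a relu"
  then obtain \<beta> b w0 b0 and w :: "nat \<Rightarrow> real ^ 'd" where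
    g: "g = (\<lambda>x. (\<Sum>i=1..k. \<beta> i * relu (w i \<bullet> x + b i)) + w0 \<bullet> x + b0)"
    and p: "\<And>i. i \<in> {1..k} \<Longrightarrow> norm1 (w i) \<le> 1 \<and> \<bar>b i\<bar> \<le> 1 \<and> \<bar>\<beta> i\<bar> \<le> 2 * a / k" and b0: "\<bar>b0\<bar> \<le> a" and w0: "norm1 w0 \<le> a"
    unfolding nets_def by auto
  define v where "v = (1 / a) *\<^sub>R w0"
  have v: "norm1 v \<le> 1" "norm1 (- v) \<le> 1" using w0 a norm1_scale[of "-1" v] by (simp_all add: v_def norm1_scale)
  define ps where "ps = (a, v, b0 / a) # (- a, - v, - (b0 / a)) # map (\<lambda>i. (\<beta> i, w i, b i)) [1..<Suc k]"
  have "(\<Sum>i=1..k. \<bar>\<beta> i\<bar>) \<le> (\<Sum>i=1..k. 2 * a / k)" using p by (intro sum_mono) auto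
  then have "ridge_params (4 * a) ps"
    using p v b0 a k by (auto simp: ridge_params_def ps_def comp_def interv_sum_list_conv_sum_set_nat atLeastLessThanSuc_atLeastAtMost simp del: upt_Suc)
  moreover have "g = ridge_sum relu ps"
  proof
    fix x
    have rr: "relu z - relu (- z) = z" for z by (auto simp: relu_def)
    have "a * relu (v \<bullet> x + b0 / a) - a * relu (- (b0 / a) - v \<bullet> x) = a * (v \<bullet> x + b0 / a)"
    proof -
      have "- (b0 / a) - v \<bullet> x = - (v \<bullet> x + b0 / a)" by simp
      then show ?thesis using rr[of "v \<bullet> x + b0 / a"] by (metis right_diff_distrib)
    qed
    also have "\<dots> = w0 \<bullet> x + b0" using a by (simp add: v_def distrib_left)
    finally show "g x = ridge_sum relu ps x"
      by (simp add: g ps_def ridge_sum_def comp_def interv_sum_list_conv_sum_set_nat atLeastLessThanSuc_atLeastAtMost del: upt_Suc)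
  qed
  ultimately show "g \<in> ridge_hull (4 * a) relu" unfolding ridge_hull_def by blast
qed

section \<open>Almost optimal test functions\<close>

lemma inner_regular_measure:
  fixes \<mu> :: "'a::{second_countable_topology, complete_space} measure"
  assumes \<mu>: "finite_measure \<mu>" "sets \<mu> = sets borel" and B: "B \<in> sets borel" and \<epsilon>: "0 < \<epsilon>"
  shows "\<exists>K. compact K \<and> K \<subseteq> B \<and> measure \<mu> (B - K) \<le> \<epsilon>"
proof -
  interpret finite_measure \<mu> by fact
  show ?thesis
  proof (cases "measure \<mu> B \<le> \<epsilon>")
    case True
    then show ?thesis by (intro exI[of _ "{}"]) simp
  next
    case False
    have "ennreal (measure \<mu> B - \<epsilon>) < emeasure \<mu> B"
      using False \<epsilon> by (simp add: emeasure_eq_measure ennreal_lessI)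
    also have "emeasure \<mu> B = (SUP K \<in> {K. K \<subseteq> B \<and> compact K}. emeasure \<mu> K)"
      using \<mu> B by (intro inner_regular) (auto simp: emeasure_finite)
    finally obtain K where K: "K \<subseteq> B" "compact K" "ennreal (measure \<mu> B - \<epsilon>) < emeasure \<mu> K"
      by (auto simp: less_SUP_iff)
    then have "measure \<mu> B - \<epsilon> < measure \<mu> K"
      using False by (simp add: emeasure_eq_measure ennreal_less_iff)
    moreover have "measure \<mu> (B - K) = measure \<mu> B - measure \<mu> K"
      using K B \<mu> by (intro finite_measure_Diff) (auto simp: borel_compact)
    ultimately show ?thesis using K by (intro exI[of _ K]) auto
  qed
qed

text \<open>Lusin-type argument: compact sets \<open>K\<close> inside the Hahn set and
  \<open>L\<close> inside its complement exhaust both up to small mass under both measures, and a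
  Urysohn function equal to 1 on \<open>K\<close> and -1 on \<open>L\<close> replaces the sign
  function.\<close>

lemma tv_dist_continuous_witness:
  fixes \<mu> \<nu> :: "(real ^ 'd) measure"
  assumes \<mu>: "prob_measure_on S \<mu>" and \<nu>: "prob_measure_on S \<nu>" and \<epsilon>: "0 < \<epsilon>"
  shows "\<exists>g. continuous_on UNIV g \<and> (\<forall>x. \<bar>g x\<bar> \<le> 1) \<and> tv_dist S \<mu> \<nu> - \<epsilon> \<le> (\<integral>x. g x \<partial>\<mu>) - (\<integral>x. g x \<partial>\<nu>)"
proof -
  have st: "sets \<mu> = sets borel" "sets \<nu> = sets borel" "prob_space \<mu>" "prob_space \<nu>"
    using \<mu> \<nu> by (auto simp: prob_measure_on_def)
  obtain Y where Y: "hahn_set \<mu> \<nu> Y" using hahn_set_exists[of \<mu> \<nu>] st by auto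
  have Ym: "Y \<in> sets borel" using Y st by (simp add: hahn_set_def)
  \<comment> \<open>The Urysohn function differs from the sign function by at most 2, on a set of
    mass at most \<open>2 * \<eta>\<close>. This costs \<open>4 * \<eta>\<close> for each of the two
    measures.\<close>
  define \<eta> where "\<eta> = \<epsilon> / 8"
  have \<eta>: "0 < \<eta>" using \<epsilon> by (simp add: \<eta>_def)
  have reg: "\<exists>K. compact K \<and> K \<subseteq> B \<and> measure \<mu> (B - K) \<le> \<eta> \<and> measure \<nu> (B - K) \<le> \<eta>" if B: "B \<in> sets borel" for B
  proof -
    obtain K1 where K1: "compact K1" "K1 \<subseteq> B" "measure \<mu> (B - K1) \<le> \<eta>"
      using inner_regular_measure[of \<mu> B \<eta>] st B \<eta> by (auto simp: prob_space_def)
    obtain K2 where K2: "compact K2" "K2 \<subseteq> B" "measure \<nu> (B - K2) \<le> \<eta>"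
      using inner_regular_measure[of \<nu> B \<eta>] st B \<eta> by (auto simp: prob_space_def)
    interpret M: prob_space \<mu> by (rule st)
    interpret N: prob_space \<nu> by (rule st)
    have "measure \<mu> (B - (K1 \<union> K2)) \<le> measure \<mu> (B - K1)" "measure \<nu> (B - (K1 \<union> K2)) \<le> measure \<nu> (B - K2)"
      using B st K1 K2 by (auto intro!: M.finite_measure_mono N.finite_measure_mono simp: borel_compact)
    then show ?thesis using K1 K2 by (intro exI[of _ "K1 \<union> K2"]) auto
  qed
  obtain K where K: "compact K" "K \<subseteq> Y" "measure \<mu> (Y - K) \<le> \<eta>" "measure \<nu> (Y - K) \<le> \<eta>"
    using reg[OF Ym] by blast
  obtain L where L: "compact L" "L \<subseteq> - Y" "measure \<mu> (- Y - L) \<le> \<eta>" "measure \<nu> (- Y - L) \<le> \<eta>"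
    using reg[of "- Y"] Ym by auto
  obtain g :: "real ^ 'd \<Rightarrow> real" where g: "continuous_on UNIV g" "\<And>x. g x \<in> closed_segment 1 (-1)"
    "\<And>x. x \<in> K \<Longrightarrow> g x = 1" "\<And>x. x \<in> L \<Longrightarrow> g x = -1"
    using Urysohn[of K L "1::real" "-1"] K L by (auto simp: compact_imp_closed)
  have g1: "\<bar>g x\<bar> \<le> 1" for x using g(2)[of x] by (auto simp: closed_segment_eq_real_ivl abs_le_iff)
  define D where "D = (Y - K) \<union> (- Y - L)"
  have Dm: "D \<in> sets borel"
    unfolding D_def using Ym borel_compact[OF K(1)] borel_compact[OF L(1)] by auto
  have close: "\<bar>(\<integral>x. g x \<partial>m) - (2 * measure m Y - 1)\<bar> \<le> 4 * \<eta>"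
    if m: "prob_space m" "sets m = sets borel" and le: "measure m (Y - K) \<le> \<eta>" "measure m (- Y - L) \<le> \<eta>" for m
  proof -
    interpret m: prob_space m by (rule m)
    have [measurable]: "g \<in> borel_measurable m" "Y \<in> sets m" "D \<in> sets m"
      using borel_measurable_continuous_onI[OF g(1)] m Ym Dm by (simp_all cong: measurable_cong_sets)
    have iY: "integrable m (indicat_real Y)" "integrable m (indicat_real D)"
      by (intro integrable_real_indicator; simp add: less_top[symmetric])+
    have ig: "integrable m g" by (rule m.integrable_const_bound[where B = 1]) (use g1 in auto)
    have "(\<integral>x. g x \<partial>m) - (2 * measure m Y - 1) = (\<integral>x. g x - (2 * indicator Y x - 1) \<partial>m)"
      using ig iY by (simp add: m.prob_space)
    also have "\<bar>\<dots>\<bar> \<le> (\<integral>x. \<bar>g x - (2 * indicator Y x - 1)\<bar> \<partial>m)" by (rule integral_abs_bound)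
    also have "\<dots> \<le> (\<integral>x. 2 * indicator D x \<partial>m)"
    proof (rule integral_mono)
      fix x
      show "\<bar>g x - (2 * indicator Y x - 1)\<bar> \<le> 2 * indicator D x"
        using g1[of x] g(3,4)[of x] K(2) L(2) by (auto simp: D_def indicator_def abs_le_iff)
    qed (use ig iY in auto)
    also have "\<dots> = 2 * measure m D" by simp
    also have "measure m D \<le> measure m (Y - K) + measure m (- Y - L)"
      unfolding D_def using Ym m borel_compact[OF K(1)] borel_compact[OF L(1)] by (intro measure_Un_le) auto
    finally show ?thesis using le by simp
  qed
  have "2 * measure \<mu> Y - 1 - 4 * \<eta> \<le> (\<integral>x. g x \<partial>\<mu>)"
    using close[OF st(3,1) K(3) L(3)] by linarith
  moreover have "(\<integral>x. g x \<partial>\<nu>) \<le> 2 * measure \<nu> Y - 1 + 4 * \<eta>"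
    using close[OF st(4,2) K(4) L(4)] by linarith
  ultimately have "tv_dist S \<mu> \<nu> - \<epsilon> \<le> (\<integral>x. g x \<partial>\<mu>) - (\<integral>x. g x \<partial>\<nu>)"
    unfolding tv_dist_hahn[OF \<mu> \<nu> Y] \<eta>_def by argo
  then show ?thesis using g(1) g1 by blast
qed

text \<open>Half of \<open>\<epsilon>\<close> is spent on the continuous test function, a quarter on
  its ridge approximation under each of the two measures.\<close>

lemma tv_dist_nets_star_witness:
  fixes \<mu> \<nu> :: "(real ^ 'd) measure"
  assumes \<mu>: "prob_measure_on unit_cube \<mu>" and \<nu>: "prob_measure_on unit_cube \<nu>"
    and \<phi>: "\<phi> \<in> {sigmoid, relu}" and \<epsilon>: "0 < \<epsilon>"
  shows "\<exists>k0. \<forall>k\<ge>k0. \<exists>g\<in>clipped_nets_star k \<phi>.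
    tv_dist unit_cube \<mu> \<nu> - \<epsilon> \<le> (\<integral>x. g x \<partial>\<mu>) - (\<integral>x. g x \<partial>\<nu>)"
proof -
  obtain f where f: "continuous_on UNIV f" "\<And>x. \<bar>f x\<bar> \<le> 1"
    "tv_dist unit_cube \<mu> \<nu> - \<epsilon> / 2 \<le> (\<integral>x. f x \<partial>\<mu>) - (\<integral>x. f x \<partial>\<nu>)"
    using tv_dist_continuous_witness[OF \<mu> \<nu>, of "\<epsilon> / 2"] \<epsilon> by auto
  have "ridge_approximable \<phi> f"
    using \<phi> continuous_on_subset[OF f(1)] by (intro ridge_approximable_continuous) auto
  moreover have "0 < \<epsilon> / 4" using \<epsilon> by simp
  ultimately obtain ps where ps: "\<forall>(\<gamma>, w, b)\<in>set ps. norm1 w \<le> 1 \<and> \<bar>b\<bar> \<le> 1"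
    "\<And>x. x \<in> unit_cube \<Longrightarrow> \<bar>f x - ridge_sum \<phi> ps x\<bar> \<le> \<epsilon> / 4"
    unfolding ridge_approximable_def by meson
  let ?g = "\<lambda>x. clip (ridge_sum \<phi> ps x)"
  have \<phi>c: "continuous_on UNIV \<phi>" using \<phi> sigmoid_continuous relu_continuous by auto
  have gc: "continuous_on UNIV ?g" by (intro clipped_continuous ridge_sum_continuous \<phi>c)
  have close: "\<bar>(\<integral>x. ?g x \<partial>m) - (\<integral>x. f x \<partial>m)\<bar> \<le> \<epsilon> / 4" if m: "prob_measure_on unit_cube m" for m
  proof -
    interpret m: prob_space m using m by (simp add: prob_measure_on_def)
    have [measurable]: "?g \<in> borel_measurable m" "f \<in> borel_measurable m"
      using borel_measurable_continuous_onI[OF gc] borel_measurable_continuous_onI[OF f(1)] m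
      by (simp_all add: prob_measure_on_def cong: measurable_cong_sets)
    have i: "integrable m ?g" "integrable m f"
      by (rule m.integrable_const_bound[where B = 1]; use f(2) in auto)+
    have "(\<integral>x. ?g x \<partial>m) - (\<integral>x. f x \<partial>m) = (\<integral>x. ?g x - f x \<partial>m)" using i by simp
    also have "\<bar>\<dots>\<bar> \<le> (\<integral>x. \<bar>?g x - f x\<bar> \<partial>m)" by (rule integral_abs_bound)
    also have "\<dots> \<le> (\<integral>x. \<epsilon> / 4 \<partial>m)"
    proof (rule integral_mono_AE)
      show "AE x in m. \<bar>?g x - f x\<bar> \<le> \<epsilon> / 4"
        using prob_measure_on_AE(1)[OF m]
      proof eventually_elim
        case (elim x)
        \<comment> \<open>Clipping leaves \<open>f\<close> unchanged and is 1-Lipschitz, so it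
          cannot enlarge the error.\<close>
        have "\<bar>clip (ridge_sum \<phi> ps x) - clip (f x)\<bar> \<le> \<bar>ridge_sum \<phi> ps x - f x\<bar>" by (rule clip_lipschitz)
        with ps(2)[OF elim] clip_id[OF f(2)[of x]] show ?case by (simp add: abs_minus_commute)
      qed
    qed (use i in auto)
    finally show ?thesis by (simp add: m.prob_space)
  qed
  have tv: "tv_dist unit_cube \<mu> \<nu> - \<epsilon> \<le> (\<integral>x. ?g x \<partial>\<mu>) - (\<integral>x. ?g x \<partial>\<nu>)"
    using close[OF \<mu>] close[OF \<nu>] f(3) unfolding abs_le_iff by linarith
  obtain k0 where "\<forall>k\<ge>k0. ridge_sum \<phi> ps \<in> nets k 1 1 1 0 \<phi>"
    using ridge_sum_in_nets_star[OF ps(1)] by blast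
  then have "\<forall>k\<ge>k0. ?g \<in> clipped_nets_star k \<phi>"
    unfolding clipped_nets_star_def clipped_nets_eq by blast
  with tv show ?thesis by blast
qed

lemma sigmoid_lipschitz: "\<bar>sigmoid x - sigmoid y\<bar> \<le> \<bar>x - y\<bar>"
proof -
  have "norm (sigmoid x - sigmoid y) \<le> 1 * norm (x - y)"
  proof (rule field_differentiable_bound[of UNIV])
    show "norm (sigmoid z * (1 - sigmoid z)) \<le> 1" for z
      using sigmoid_bounds[of z] by (simp add: abs_mult mult_le_one)
  qed (auto intro: sigmoid_has_derivative)
  then show ?thesis by simp
qed

lemma relu_lipschitz: "\<bar>relu x - relu y\<bar> \<le> \<bar>x - y\<bar>"
  by (auto simp: relu_def)

lemma tv_estimator_consistent:
  fixes \<mu> \<nu> :: "(real ^ 'd) measure" and P :: "'w measure"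
  assumes \<mu>: "prob_measure_on unit_cube \<mu>" and \<nu>: "prob_measure_on unit_cube \<nu>"
    and \<phi>: "\<phi> \<in> {sigmoid, relu}" and \<rho>: "0 < \<rho>"
    and k: "filterlim k at_top sequentially"
      "(\<lambda>n. real (k n)) \<in> O(\<lambda>n. real n powr ((1 - \<rho>) / 2))"
    and iid: "iid_samples P \<mu> \<nu> X Y"
  shows "AE \<omega> in P. (\<lambda>n. tv_estimator (clipped_nets_star (k n) \<phi>) n (\<lambda>i. X i \<omega>) (\<lambda>i. Y i \<omega>))
    \<longlonglongrightarrow> tv_dist unit_cube \<mu> \<nu>"
proof -
  define W where "W \<omega> j = case_sum X Y j \<omega>" for \<omega> j
  define G :: "nat \<Rightarrow> (real ^ 'd \<Rightarrow> real) set" where "G n = clipped_nets_star (k n) \<phi>" for n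
  define B where "B n = 10 * real (k n)" for n
  define U where "U n = deviation_sup \<mu> \<nu> (G n) (B n) n" for n
  define K where "K = 8 * (real CARD('d) + 1) * exp 16"
  \<comment> \<open>The factor \<open>1 / n\<^sup>2\<close> makes the moments summable. Indices with
    \<open>k n = 0\<close> or \<open>n = 0\<close> are set to 0, as the moment bound requires
    positive \<open>B\<close> and \<open>n\<close>.\<close>
  define V where "V n w = (if 0 < k n \<and> 0 < n then U n w * ennreal (1 / (real n)\<^sup>2) else 0)" for n and w :: "nat + nat \<Rightarrow> real ^ 'd"
  have \<phi>c: "continuous_on UNIV \<phi>" using \<phi> sigmoid_continuous relu_continuous by auto
  have Gc: "continuous_on UNIV g" if "g \<in> G n" for g n
    using that \<phi>c clipped_nets_continuous unfolding G_def clipped_nets_star_def by blast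
  have Gb: "\<bar>g x\<bar> \<le> 1" if "g \<in> G n" for g n x
    using that clipped_nets_bounded unfolding G_def clipped_nets_star_def by blast
  have Um: "U n \<in> borel_measurable borel" for n
    unfolding U_def by (rule deviation_sup_measurable[OF Gc])
  have sB: "sets (\<Pi>\<^sub>M j\<in>(UNIV :: (nat + nat) set). (borel :: (real ^ 'd) measure)) = sets borel"
    by (rule sets_PiM_equal_borel)
  have Wm: "W \<in> P \<rightarrow>\<^sub>M (\<Pi>\<^sub>M j\<in>UNIV. borel)"
    using iid_samples_law(1)[OF iid] by (simp add: W_def[abs_def])
  have law: "distr P (\<Pi>\<^sub>M j\<in>UNIV. borel) W = sample_law \<mu> \<nu>"
    using iid_samples_law(2)[OF iid] by (simp add: W_def[abs_def])
  have Vm: "V n \<in> borel_measurable (\<Pi>\<^sub>M j\<in>UNIV. borel)" for n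
  proof -
    have "V n \<in> borel_measurable borel"
      unfolding V_def using Um by (cases "0 < k n \<and> 0 < n") (simp_all add: borel_measurable_times)
    then show ?thesis by (simp add: measurable_cong_sets[OF sB refl])
  qed
  have VW: "(\<lambda>\<omega>. V n (W \<omega>)) \<in> borel_measurable P" for n
    by (rule measurable_compose[OF Wm Vm])
  have V_int: "(\<integral>\<^sup>+ \<omega>. V n (W \<omega>) \<partial>P) \<le> ennreal (K * (1 / (real n)\<^sup>2))" for n
  proof (cases "0 < k n \<and> 0 < n")
    case True
    have lip: "\<bar>(\<phi> x - \<phi> 0) - (\<phi> y - \<phi> 0)\<bar> \<le> \<bar>x - y\<bar>" for x y
      using \<phi> sigmoid_lipschitz[of x y] relu_lipschitz[of x y] by auto
    have "(\<integral>\<^sup>+ \<omega>. V n (W \<omega>) \<partial>P) = (\<integral>\<^sup>+ w. V n w \<partial>sample_law \<mu> \<nu>)"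
      unfolding law[symmetric] using Vm by (intro nn_integral_distr[symmetric, OF Wm]) simp
    also have "\<dots> = (\<integral>\<^sup>+ w. U n w \<partial>sample_law \<mu> \<nu>) * ennreal (1 / (real n)\<^sup>2)"
      using True Um unfolding V_def
      by (simp add: nn_integral_multc measurable_cong_sets[OF sets_sample_law[OF \<mu> \<nu>] refl])
    also have "\<dots> \<le> ennreal K * ennreal (1 / (real n)\<^sup>2)"
      unfolding U_def G_def clipped_nets_star_def clipped_nets_eq K_def B_def
      using True by (intro mult_right_mono nn_integral_deviation_sup_le[OF \<mu> \<nu> _ lip] nets_star_subset_hull \<phi>) auto
    also have "\<dots> = ennreal (K * (1 / (real n)\<^sup>2))"
    proof -
      have "0 \<le> K" by (simp add: K_def)
      then show ?thesis by (intro ennreal_mult[symmetric]) auto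
    qed
    finally show ?thesis .
  next
    case False
    then have "V n w = 0" for w by (simp only: V_def if_False)
    then show ?thesis by simp
  qed
  \<comment> \<open>In place of tail bounds and Borel-Cantelli: a sum with finite expectation is
    finite almost surely, and then a random constant \<open>s\<close> bounds all its terms.\<close>
  have "(\<integral>\<^sup>+ \<omega>. (\<Sum>n. V n (W \<omega>)) \<partial>P) = (\<Sum>n. \<integral>\<^sup>+ \<omega>. V n (W \<omega>) \<partial>P)"
    by (rule nn_integral_suminf[OF VW])
  also have "\<dots> \<le> (\<Sum>n. ennreal (K * (1 / (real n)\<^sup>2)))"
    by (intro suminf_le V_int) auto
  also have "\<dots> < \<top>"
  proof -
    have "summable (\<lambda>n. K * (1 / (real n)\<^sup>2))"
      using inverse_power_summable[of 2, where 'a = real] by (intro summable_mult) (simp add: inverse_eq_divide power_one_over)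
    then show ?thesis by (subst suminf_ennreal2) (auto simp: K_def)
  qed
  finally have "(\<integral>\<^sup>+ \<omega>. (\<Sum>n. V n (W \<omega>)) \<partial>P) \<noteq> \<infinity>" by simp
  then have "AE \<omega> in P. (\<Sum>n. V n (W \<omega>)) \<noteq> \<infinity>"
    using VW by (intro nn_integral_PInf_AE) auto
  then show ?thesis
  proof eventually_elim
    case (elim \<omega>)
    then obtain s where s: "(\<Sum>n. V n (W \<omega>)) = ennreal s" "0 \<le> s"
      by (cases "\<Sum>n. V n (W \<omega>)") auto
    \<comment> \<open>\<open>V n \<le> s\<close> means that \<open>U n\<close> is at most
      \<open>s * n\<^sup>2\<close>; the shift to \<open>s + 1\<close> keeps the logarithm
      nonnegative.\<close>
    define v where "v n = ln (s + 1) + 2 * ln (real n)" for n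
    have U_le: "U n (W \<omega>) \<le> ennreal (exp (v n))" if n: "0 < k n" "0 < n" for n
    proof -
      have "V n (W \<omega>) \<le> ennreal s"
        using sum_le_suminf[of "\<lambda>n. V n (W \<omega>)" "{n}"] by (simp add: s)
      then have "U n (W \<omega>) * ennreal (1 / (real n)\<^sup>2) * ennreal ((real n)\<^sup>2) \<le> ennreal s * ennreal ((real n)\<^sup>2)"
        using n by (intro mult_right_mono) (auto simp: V_def)
      then have "U n (W \<omega>) \<le> ennreal (s * (real n)\<^sup>2)"
        using n s by (simp add: mult.assoc flip: ennreal_mult)
      also have "\<dots> \<le> ennreal (exp (v n))"
        using n s by (intro ennreal_leI) (simp add: v_def exp_add exp_double mult_right_mono)
      finally show ?thesis .
    qed
    obtain c where c: "0 < c" "eventually (\<lambda>n. norm (real (k n)) \<le> c * norm (real n powr ((1 - \<rho>) / 2))) sequentially"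
      using landau_o.bigE[OF k(2)] by blast
    \<comment> \<open>The deviation is at most \<open>B n / sqrt n * v n\<close>. Since
      \<open>v n\<close> grows like \<open>ln n\<close>, any power of \<open>n\<close> gained from
      \<open>\<rho>\<close> beats it.\<close>
    have lim: "(\<lambda>n. 10 * c * real n powr (- \<rho> / 2) * v n) \<longlonglongrightarrow> 0"
      unfolding v_def using \<rho> by real_asymp
    show ?case
    proof (rule tendstoI)
      fix \<epsilon> :: real assume \<epsilon>: "0 < \<epsilon>"
      then have "0 < \<epsilon> / 2" by simp
      from tv_dist_nets_star_witness[OF \<mu> \<nu> \<phi> this] obtain k0 where
        k0: "\<And>k. k \<ge> k0 \<Longrightarrow> \<exists>g\<in>clipped_nets_star k \<phi>. tv_dist unit_cube \<mu> \<nu> - \<epsilon> / 2 \<le> (\<integral>x. g x \<partial>\<mu>) - (\<integral>x. g x \<partial>\<nu>)"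
        by blast
      have "eventually (\<lambda>n. max k0 1 \<le> k n) sequentially"
        using k(1) unfolding filterlim_at_top by blast
      moreover have "eventually (\<lambda>n. 10 * c * real n powr (- \<rho> / 2) * v n < \<epsilon> / 2) sequentially"
        using \<open>0 < \<epsilon> / 2\<close> by (rule order_tendstoD(2)[OF lim])
      ultimately show "eventually (\<lambda>n. dist (tv_estimator (clipped_nets_star (k n) \<phi>) n (\<lambda>i. X i \<omega>) (\<lambda>i. Y i \<omega>))
          (tv_dist unit_cube \<mu> \<nu>) < \<epsilon>) sequentially"
        using c(2) eventually_gt_at_top[of 0]
      proof eventually_elim
        case (elim n)
        have kn: "0 < k n" and n: "0 < n" using elim by auto
        have v0: "0 \<le> v n" using n s by (simp add: v_def ln_ge_zero)
        obtain g where g: "g \<in> G n" "tv_dist unit_cube \<mu> \<nu> - \<epsilon> / 2 \<le> (\<integral>x. g x \<partial>\<mu>) - (\<integral>x. g x \<partial>\<nu>)"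
          using k0[of "k n"] elim by (auto simp: G_def)
        have "\<bar>tv_estimator (G n) n (\<lambda>i. W \<omega> (Inl i)) (\<lambda>i. W \<omega> (Inr i)) - tv_dist unit_cube \<mu> \<nu>\<bar>
            \<le> \<epsilon> / 2 + B n / sqrt n * v n"
        proof (rule tv_estimator_error_le[OF \<mu> \<nu>, where G = "G n" and ?g0.0 = g])
          show "deviation_sup \<mu> \<nu> (G n) (B n) n (W \<omega>) \<le> ennreal (exp (v n))"
            using U_le[OF kn n] by (simp add: U_def)
        qed (use kn n \<epsilon> v0 g Gc Gb in \<open>auto simp: B_def\<close>)
        also have "B n / sqrt n \<le> 10 * c * real n powr (- \<rho> / 2)"
        proof -
          have "B n \<le> 10 * (c * real n powr ((1 - \<rho>) / 2))" using elim by (simp add: B_def)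
          then have "B n / sqrt n \<le> 10 * (c * real n powr ((1 - \<rho>) / 2)) / sqrt n" by (intro divide_right_mono) auto
          also have "\<dots> = 10 * c * (real n powr ((1 - \<rho>) / 2) / real n powr (1 / 2))" by (simp add: powr_half_sqrt)
          also have "\<dots> = 10 * c * real n powr (- \<rho> / 2)"
          proof -
            have "(1 - \<rho>) / 2 - 1 / 2 = - \<rho> / 2" by (simp add: field_simps)
            then show ?thesis by (simp only: powr_diff[symmetric])
          qed
          finally show ?thesis .
        qed
        finally have "\<bar>tv_estimator (G n) n (\<lambda>i. W \<omega> (Inl i)) (\<lambda>i. W \<omega> (Inr i)) - tv_dist unit_cube \<mu> \<nu>\<bar>
            \<le> \<epsilon> / 2 + 10 * c * real n powr (- \<rho> / 2) * v n" using v0 by (simp add: mult_right_mono)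
        then show ?case using elim by (simp add: W_def G_def dist_real_def)
      qed
    qed
  qed
qed

section \<open>Smoothing kernel\<close>

text \<open>The kernel \<open>cos\<^sup>2\<^sup>m (u / 2)\<close> of de la Vallee Poussin on \<open>[-\<pi>, \<pi>]\<close>.\<close>

definition vp_mass :: "nat \<Rightarrow> real" where
  "vp_mass m = (\<integral>u. cos (u / 2) ^ (2 * m) * indicator {- pi..pi} u \<partial>lborel)"

lemma vp_integrable: "integrable lborel (\<lambda>u. cos (u / 2) ^ (2 * m) * indicator {- pi..pi} u)"
  by (rule borel_integrable_atLeastAtMost) (auto intro!: continuous_intros)

lemma vp_mass_0: "vp_mass 0 = 2 * pi"
  using integral_FTC_Icc_real[of "- pi" pi "\<lambda>x. x" "\<lambda>_. 1"] by (simp add: vp_mass_def)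

text \<open>Wallis recurrence: the antiderivative
  \<open>2 * sin (u / 2) * cos (u / 2) ^ (2 * m + 1)\<close> vanishes at both ends of the
  interval.\<close>

lemma vp_mass_Suc: "(2 * real m + 2) * vp_mass (Suc m) = (2 * real m + 1) * vp_mass m"
proof -
  define F where "F u = 2 * (sin (u / 2) * cos (u / 2) ^ Suc (2 * m))" for u :: real
  have cs: "cos (pi / 2) = 0" "cos (- (pi / 2)) = 0" by simp_all
  have "(\<integral>u. ((2 * real m + 2) * cos (u / 2) ^ (2 * Suc m) - (2 * real m + 1) * cos (u / 2) ^ (2 * m)) * indicator {- pi..pi} u \<partial>lborel) = F pi - F (- pi)"
  proof (rule integral_FTC_Icc_real)
    fix u :: real
    have s: "(sin (u / 2))\<^sup>2 = 1 - (cos (u / 2))\<^sup>2" by (simp add: sin_squared_eq)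
    have "(F has_real_derivative 2 * ((cos (u / 2) * (1 / 2)) * cos (u / 2) ^ Suc (2 * m)
        + sin (u / 2) * ((2 * real m + 1) * cos (u / 2) ^ (2 * m) * (- sin (u / 2) * (1 / 2))))) (at u)"
      unfolding F_def by (rule derivative_eq_intros refl | simp del: power_Suc)+
    also have "2 * ((cos (u / 2) * (1 / 2)) * cos (u / 2) ^ Suc (2 * m)
        + sin (u / 2) * ((2 * real m + 1) * cos (u / 2) ^ (2 * m) * (- sin (u / 2) * (1 / 2))))
      = cos (u / 2) ^ (2 * Suc m) - (2 * real m + 1) * cos (u / 2) ^ (2 * m) * (sin (u / 2))\<^sup>2"
      by (simp add: power2_eq_square algebra_simps)
    also have "\<dots> = (2 * real m + 2) * cos (u / 2) ^ (2 * Suc m) - (2 * real m + 1) * cos (u / 2) ^ (2 * m)"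
      unfolding s by (simp add: power2_eq_square algebra_simps)
    finally show "(F has_real_derivative (2 * real m + 2) * cos (u / 2) ^ (2 * Suc m) - (2 * real m + 1) * cos (u / 2) ^ (2 * m)) (at u)" .
  qed (auto intro!: continuous_intros)
  also have "F pi - F (- pi) = 0" using cs by (simp add: F_def)
  finally have "0 = (\<integral>u. (2 * real m + 2) * (cos (u / 2) ^ (2 * Suc m) * indicator {- pi..pi} u)
      - (2 * real m + 1) * (cos (u / 2) ^ (2 * m) * indicator {- pi..pi} u) \<partial>lborel)"
    by (simp add: left_diff_distrib mult.assoc del: power_Suc mult_Suc_right)
  also have "\<dots> = (2 * real m + 2) * vp_mass (Suc m) - (2 * real m + 1) * vp_mass m"
    unfolding vp_mass_def using vp_integrable[of "Suc m"] vp_integrable[of m]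
    by (simp del: power_Suc mult_Suc_right)
  finally show ?thesis by simp
qed

lemma vp_mass_pos: "0 < vp_mass m"
proof (induction m)
  case (Suc m)
  then have "0 < (2 * real m + 2) * vp_mass (Suc m)" unfolding vp_mass_Suc by simp
  then show ?case by (simp add: zero_less_mult_iff)
qed (simp add: vp_mass_0)

text \<open>The factor \<open>4 m + 1\<close> makes the sequence increasing; any lower bound of order
  \<open>m powr (- 1/2)\<close> would do.\<close>

lemma vp_mass_lower: "1 \<le> (vp_mass m)\<^sup>2 * (real m + 1)"
proof -
  have "4 * pi\<^sup>2 \<le> (vp_mass m)\<^sup>2 * (4 * real m + 1)"
  proof (induction m)
    case 0
    then show ?case by (simp add: vp_mass_0 power_mult_distrib)
  next
    case (Suc m)
    let ?a = "2 * real m + 2" and ?b = "2 * real m + 1"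
    \<comment> \<open>Expanded, the two sides differ by exactly 1.\<close>
    have "(4 * real m + 1) * ?a\<^sup>2 \<le> (4 * real (Suc m) + 1) * ?b\<^sup>2"
      by (simp add: power2_eq_square algebra_simps)
    then have "(vp_mass m)\<^sup>2 * ((4 * real m + 1) * ?a\<^sup>2) \<le> (vp_mass m)\<^sup>2 * ((4 * real (Suc m) + 1) * ?b\<^sup>2)"
      by (intro mult_left_mono) auto
    also have "\<dots> = (4 * real (Suc m) + 1) * (?b * vp_mass m)\<^sup>2"
      by (simp add: power_mult_distrib)
    also have "\<dots> = (vp_mass (Suc m))\<^sup>2 * (4 * real (Suc m) + 1) * ?a\<^sup>2"
      unfolding vp_mass_Suc[symmetric] by (simp add: power_mult_distrib)
    finally have "((vp_mass m)\<^sup>2 * (4 * real m + 1)) * ?a\<^sup>2 \<le> ((vp_mass (Suc m))\<^sup>2 * (4 * real (Suc m) + 1)) * ?a\<^sup>2"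
      by (simp add: mult_ac)
    then have "(vp_mass m)\<^sup>2 * (4 * real m + 1) \<le> (vp_mass (Suc m))\<^sup>2 * (4 * real (Suc m) + 1)"
      by (rule mult_right_le_imp_le) simp
    with Suc show ?case by linarith
  qed
  also have "\<dots> \<le> (vp_mass m)\<^sup>2 * (4 * (real m + 1))" by (intro mult_left_mono) auto
  also have "\<dots> = 4 * ((vp_mass m)\<^sup>2 * (real m + 1))" by simp
  finally have "pi\<^sup>2 \<le> (vp_mass m)\<^sup>2 * (real m + 1)" by simp
  moreover have "1 \<le> pi\<^sup>2" using pi_ge_two by (intro one_le_power) simp
  ultimately show ?thesis by linarith
qed

text \<open>\<open>sin (v / 2)\<close> is concave on \<open>[0, pi]\<close> and therefore lies above
  its chord \<open>v / pi\<close>.\<close>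

lemma abs_le_pi_sin_half:
  assumes "\<bar>u\<bar> \<le> pi"
  shows "\<bar>u\<bar> \<le> pi * \<bar>sin (u / 2)\<bar>"
proof -
  have *: "v \<le> pi * sin (v / 2)" if "0 \<le> v" "v \<le> pi" for v
  proof -
    define f where "f v = - sin (v / 2)" for v :: real
    have "convex_on {0..pi} f"
    proof (rule f''_ge0_imp_convex)
      show "convex {0..pi}" by simp
      show "(f has_real_derivative - (cos (v / 2) / 2)) (at v)" for v
        unfolding f_def by (auto intro!: derivative_eq_intros)
      show "((\<lambda>v. - (cos (v / 2) / 2)) has_real_derivative sin (v / 2) / 4) (at v)" for v
        by (auto intro!: derivative_eq_intros)
      show "0 \<le> sin (v / 2) / 4" if "v \<in> {0..pi}" for v
        using that by (auto intro!: sin_ge_zero)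
    qed
    from convex_onD[OF this, of "v / pi" 0 pi] show ?thesis
      using that by (simp add: f_def field_simps)
  qed
  show ?thesis
  proof (cases "0 \<le> u")
    case True
    then have "0 \<le> sin (u / 2)" using assms by (intro sin_ge_zero) auto
    then show ?thesis using *[of u] True assms by simp
  next
    case False
    then have "0 \<le> sin (- u / 2)" using assms by (intro sin_ge_zero) auto
    then show ?thesis using *[of "- u"] False assms by simp
  qed
qed

definition vp_kernel1 :: "nat \<Rightarrow> real \<Rightarrow> real" where
  "vp_kernel1 m u = cos (u / 2) ^ (2 * m) * indicator {- pi..pi} u / vp_mass m"

lemma vp_kernel1_nonneg: "0 \<le> vp_kernel1 m u"
  using vp_mass_pos[of m] by (simp add: vp_kernel1_def zero_le_even_power)

lemma vp_kernel1_measurable [measurable]: "vp_kernel1 m \<in> borel_measurable borel"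
  unfolding vp_kernel1_def by measurable

lemma nn_integral_vp_kernel1: "(\<integral>\<^sup>+ u. ennreal (vp_kernel1 m u) \<partial>lborel) = 1"
proof -
  have "integrable lborel (vp_kernel1 m)" unfolding vp_kernel1_def using vp_integrable by simp
  then have "(\<integral>\<^sup>+ u. ennreal (vp_kernel1 m u) \<partial>lborel) = ennreal (\<integral>u. vp_kernel1 m u \<partial>lborel)"
    by (rule nn_integral_eq_integral) (simp add: vp_kernel1_nonneg)
  also have "(\<integral>u. vp_kernel1 m u \<partial>lborel) = 1"
    using vp_mass_pos[of m] by (simp add: vp_kernel1_def vp_mass_def[symmetric])
  finally show ?thesis by simp
qed

text \<open>On the support \<open>u\<^sup>2\<close> is at most
  \<open>pi\<^sup>2 * (1 - (cos (u / 2))\<^sup>2)\<close>, and a factor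
  \<open>(cos (u / 2))\<^sup>2\<close> turns the kernel of order \<open>m\<close> into that of order
  \<open>m + 1\<close> up to the ratio of the masses, which the recurrence gives exactly.\<close>

lemma nn_integral_vp_kernel1_square:
  "(\<integral>\<^sup>+ u. ennreal (u\<^sup>2 * vp_kernel1 m u) \<partial>lborel) \<le> ennreal (pi\<^sup>2 / (2 * real m + 2))"
proof -
  let ?g = "\<lambda>u. pi\<^sup>2 * (vp_kernel1 m u - (vp_mass (Suc m) / vp_mass m) * vp_kernel1 (Suc m) u)"
  have c: "0 < vp_mass m" "0 < vp_mass (Suc m)" by (rule vp_mass_pos)+
  have eq: "?g u = pi\<^sup>2 * (sin (u / 2))\<^sup>2 * vp_kernel1 m u" for u
  proof -
    have "vp_mass (Suc m) / vp_mass m * vp_kernel1 (Suc m) u = (cos (u / 2))\<^sup>2 * vp_kernel1 m u"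
      using c by (simp add: vp_kernel1_def power2_eq_square)
    then show ?thesis by (simp add: sin_squared_eq algebra_simps)
  qed
  have le: "u\<^sup>2 * vp_kernel1 m u \<le> ?g u" for u
  proof (cases "\<bar>u\<bar> \<le> pi")
    case True
    have "\<bar>u\<bar>\<^sup>2 \<le> (pi * \<bar>sin (u / 2)\<bar>)\<^sup>2" by (intro power_mono abs_le_pi_sin_half True) auto
    then have "u\<^sup>2 \<le> pi\<^sup>2 * (sin (u / 2))\<^sup>2" by (simp add: power_mult_distrib)
    then show ?thesis unfolding eq by (intro mult_right_mono vp_kernel1_nonneg)
  next
    case False
    then have "vp_kernel1 m u = 0" by (auto simp: vp_kernel1_def indicator_def abs_le_iff)
    then show ?thesis unfolding eq by simp
  qed
  have i: "integrable lborel (vp_kernel1 n)" for n unfolding vp_kernel1_def using vp_integrable by simp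
  have one: "(\<integral>u. vp_kernel1 n u \<partial>lborel) = 1" for n
    using vp_mass_pos[of n] by (simp add: vp_kernel1_def vp_mass_def[symmetric])
  have "(\<integral>\<^sup>+ u. ennreal (u\<^sup>2 * vp_kernel1 m u) \<partial>lborel) \<le> (\<integral>\<^sup>+ u. ennreal (?g u) \<partial>lborel)"
    by (intro nn_integral_mono ennreal_leI le)
  also have "\<dots> = ennreal (\<integral>u. ?g u \<partial>lborel)"
  proof (rule nn_integral_eq_integral)
    show "integrable lborel ?g" using i by simp
    show "AE u in lborel. 0 \<le> ?g u" unfolding eq by (simp add: vp_kernel1_nonneg)
  qed
  also have "(\<integral>u. ?g u \<partial>lborel) = pi\<^sup>2 * (1 - vp_mass (Suc m) / vp_mass m)"
    using i one by simp
  also have "vp_mass (Suc m) / vp_mass m = (2 * real m + 1) / (2 * real m + 2)"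
    using vp_mass_Suc[of m] c by (simp add: field_simps)
  also have "pi\<^sup>2 * (1 - (2 * real m + 1) / (2 * real m + 2)) = pi\<^sup>2 / (2 * real m + 2)"
    by (simp add: field_simps)
  finally show ?thesis .
qed

section \<open>The product kernel in several variables\<close>

lemma Basis_vec_real: "(Basis :: (real ^ 'd) set) = (\<lambda>i. axis i 1) ` UNIV"
  by (auto simp: Basis_vec_def)

lemma nn_integral_lborel_vec_prod:
  fixes f :: "'d::finite \<Rightarrow> real \<Rightarrow> ennreal"
  assumes "\<And>i. f i \<in> borel_measurable borel"
  shows "(\<integral>\<^sup>+ (x :: real ^ 'd). (\<Prod>i\<in>UNIV. f i (x $ i)) \<partial>lborel) = (\<Prod>i\<in>UNIV. \<integral>\<^sup>+ u. f i u \<partial>lborel)"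
proof -
  have inj: "inj (\<lambda>i :: 'd. axis i (1 :: real))" by (auto simp: inj_on_def axis_eq_axis)
  define h where "h b = f (inv (\<lambda>i :: 'd. axis i (1 :: real)) b)" for b :: "real ^ 'd"
  have h: "h (axis i 1) = f i" for i by (simp add: h_def inv_f_f[OF inj])
  have "(\<integral>\<^sup>+ (x :: real ^ 'd). (\<Prod>i\<in>UNIV. f i (x $ i)) \<partial>lborel) = (\<integral>\<^sup>+ (x :: real ^ 'd). (\<Prod>b\<in>Basis. h b (x \<bullet> b)) \<partial>lborel)"
    by (simp add: Basis_vec_real prod.reindex[OF inj] h inner_axis)
  also have "\<dots> = (\<Prod>b\<in>Basis. \<integral>\<^sup>+ u. h b u \<partial>lborel)"
    using assms by (intro nn_integral_lborel_prod) (auto simp: h_def)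
  also have "\<dots> = (\<Prod>i\<in>UNIV. \<integral>\<^sup>+ u. f i u \<partial>lborel)"
    by (simp add: Basis_vec_real prod.reindex[OF inj] h)
  finally show ?thesis .
qed

definition vp_kernel :: "nat \<Rightarrow> real ^ 'd \<Rightarrow> real" where
  "vp_kernel m x = (\<Prod>i\<in>UNIV. vp_kernel1 m (x $ i))"

lemma vp_kernel_nonneg: "0 \<le> vp_kernel m x"
  unfolding vp_kernel_def by (intro prod_nonneg ballI vp_kernel1_nonneg)

lemma vp_kernel_measurable [measurable]: "vp_kernel m \<in> borel_measurable borel"
  unfolding vp_kernel_def by measurable

lemma nn_integral_vp_kernel: "(\<integral>\<^sup>+ (x :: real ^ 'd). ennreal (vp_kernel m x) \<partial>lborel) = 1"
proof -
  have "(\<integral>\<^sup>+ (x :: real ^ 'd). ennreal (vp_kernel m x) \<partial>lborel) = (\<integral>\<^sup>+ (x :: real ^ 'd). (\<Prod>i\<in>UNIV. ennreal (vp_kernel1 m (x $ i))) \<partial>lborel)"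
    unfolding vp_kernel_def by (simp add: prod_ennreal vp_kernel1_nonneg)
  also have "\<dots> = 1"
    by (subst nn_integral_lborel_vec_prod) (simp_all add: nn_integral_vp_kernel1)
  finally show ?thesis .
qed

lemma nn_integral_vp_kernel_square:
  "(\<integral>\<^sup>+ (x :: real ^ 'd). ennreal ((norm x)\<^sup>2 * vp_kernel m x) \<partial>lborel) \<le> ennreal (real CARD('d) * (pi\<^sup>2 / (2 * real m + 2)))"
proof -
  let ?f = "\<lambda>j i u. ennreal ((if i = j then u\<^sup>2 else 1) * vp_kernel1 m u)"
  have "(\<integral>\<^sup>+ (x :: real ^ 'd). ennreal ((norm x)\<^sup>2 * vp_kernel m x) \<partial>lborel)
      = (\<integral>\<^sup>+ (x :: real ^ 'd). (\<Sum>j\<in>UNIV. \<Prod>i\<in>UNIV. ?f j i (x $ i)) \<partial>lborel)"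
  proof (rule nn_integral_cong)
    fix x :: "real ^ 'd"
    have "(norm x)\<^sup>2 * vp_kernel m x = (\<Sum>j\<in>UNIV. (x $ j)\<^sup>2 * vp_kernel m x)"
      by (simp add: norm_vec_def L2_set_def sum_nonneg sum_distrib_right)
    also have "\<dots> = (\<Sum>j\<in>UNIV. \<Prod>i\<in>UNIV. (if i = j then (x $ i)\<^sup>2 else 1) * vp_kernel1 m (x $ i))"
      by (simp add: prod.distrib vp_kernel_def)
    finally show "ennreal ((norm x)\<^sup>2 * vp_kernel m x) = (\<Sum>j\<in>UNIV. \<Prod>i\<in>UNIV. ?f j i (x $ i))"
      by (simp add: prod_ennreal sum_ennreal vp_kernel1_nonneg prod_nonneg)
  qed
  also have "\<dots> = (\<Sum>j\<in>(UNIV :: 'd set). \<integral>\<^sup>+ (x :: real ^ 'd). (\<Prod>i\<in>UNIV. ?f j i (x $ i)) \<partial>lborel)"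
    by (intro nn_integral_sum) simp
  also have "\<dots> = (\<Sum>j\<in>(UNIV :: 'd set). \<Prod>i\<in>(UNIV :: 'd set). \<integral>\<^sup>+ u. ?f j i u \<partial>lborel)"
    by (intro sum.cong refl nn_integral_lborel_vec_prod) simp
  also have "\<dots> \<le> (\<Sum>j\<in>(UNIV :: 'd set). ennreal (pi\<^sup>2 / (2 * real m + 2)))"
  proof (intro sum_mono)
    fix j :: 'd
    have "(\<Prod>i\<in>UNIV. \<integral>\<^sup>+ u. ?f j i u \<partial>lborel) = (\<Prod>i\<in>UNIV. if i = j then \<integral>\<^sup>+ u. ennreal (u\<^sup>2 * vp_kernel1 m u) \<partial>lborel else 1)"
      by (intro prod.cong refl) (simp add: nn_integral_vp_kernel1)
    also have "\<dots> = (\<integral>\<^sup>+ u. ennreal (u\<^sup>2 * vp_kernel1 m u) \<partial>lborel)" by simp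
    finally show "(\<Prod>i\<in>UNIV. \<integral>\<^sup>+ u. ?f j i u \<partial>lborel) \<le> ennreal (pi\<^sup>2 / (2 * real m + 2))"
      using nn_integral_vp_kernel1_square by simp
  qed
  also have "\<dots> = ennreal (real CARD('d) * (pi\<^sup>2 / (2 * real m + 2)))"
    by (simp add: ennreal_of_nat_eq_real_of_nat flip: ennreal_mult)
  finally show ?thesis .
qed

text \<open>The kernel is even, so this is a convolution. The form with \<open>x + u\<close> matches
  the shifts in \<open>L1_modulus\<close>.\<close>

definition vp_smooth :: "nat \<Rightarrow> (real ^ 'd \<Rightarrow> real) \<Rightarrow> real ^ 'd \<Rightarrow> real" where
  "vp_smooth m f x = (\<integral>u. f (x + u) * vp_kernel m u \<partial>lborel)"

lemma vp_kernel_integrable: "integrable lborel (vp_kernel m :: real ^ 'd \<Rightarrow> real)"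
  and integral_vp_kernel: "(\<integral>(u :: real ^ 'd). vp_kernel m u \<partial>lborel) = 1"
proof -
  have "has_bochner_integral lborel (vp_kernel m :: real ^ 'd \<Rightarrow> real) 1"
    by (rule has_bochner_integral_nn_integral) (simp_all add: vp_kernel_nonneg nn_integral_vp_kernel)
  then show "integrable lborel (vp_kernel m :: real ^ 'd \<Rightarrow> real)" "(\<integral>(u :: real ^ 'd). vp_kernel m u \<partial>lborel) = 1"
    by (auto simp: has_bochner_integral_iff)
qed

lemma vp_smooth_integrable:
  fixes f :: "real ^ 'd \<Rightarrow> real"
  assumes "f \<in> borel_measurable borel" "\<And>x. \<bar>f x\<bar> \<le> 1"
  shows "integrable lborel (\<lambda>u. f (x + u) * vp_kernel m u)"
  by (rule Bochner_Integration.integrable_bound[OF vp_kernel_integrable[of m]])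
    (use assms in \<open>auto simp: abs_mult vp_kernel_nonneg intro!: mult_right_le_one_le mult_left_le_one_le\<close>)

lemma vp_smooth_bound:
  fixes f :: "real ^ 'd \<Rightarrow> real"
  assumes "f \<in> borel_measurable borel" "\<And>x. \<bar>f x\<bar> \<le> 1"
  shows "\<bar>vp_smooth m f x\<bar> \<le> 1"
proof -
  have "\<bar>vp_smooth m f x\<bar> \<le> (\<integral>u. \<bar>f (x + u) * vp_kernel m u\<bar> \<partial>lborel)"
    unfolding vp_smooth_def by (rule integral_abs_bound)
  also have "\<dots> \<le> (\<integral>(u :: real ^ 'd). vp_kernel m u \<partial>lborel)"
  proof (rule integral_mono)
    show "integrable lborel (\<lambda>u. \<bar>f (x + u) * vp_kernel m u\<bar>)"
      using vp_smooth_integrable[OF assms] by (rule integrable_abs)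
    show "\<bar>f (x + u) * vp_kernel m u\<bar> \<le> vp_kernel m u" for u
      using assms(2)[of "x + u"] vp_kernel_nonneg[of m u] by (simp add: abs_mult mult_left_le_one_le)
  qed (rule vp_kernel_integrable)
  finally show ?thesis by (simp add: integral_vp_kernel)
qed

text \<open>A fractional moment is controlled by the second one at a free scale
  \<open>\<delta>\<close>: for \<open>q = r / \<delta>\<close>, \<open>q powr s\<close> is at most 1
  or at most \<open>q\<^sup>2\<close>.\<close>

lemma powr_le_square_bound:
  fixes r \<delta> s :: real
  assumes "0 \<le> r" "0 < \<delta>" "0 < s" "s \<le> 1"
  shows "r powr s \<le> \<delta> powr s * (1 + r\<^sup>2 / \<delta>\<^sup>2)"
proof -
  define q where "q = r / \<delta>"
  have q: "0 \<le> q" using assms by (simp add: q_def)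
  have "q powr s \<le> 1 + q\<^sup>2"
  proof (cases "q \<le> 1")
    case True
    then have "q powr s \<le> 1" using q assms by (intro powr_le1) auto
    then show ?thesis by (simp add: add_increasing2)
  next
    case False
    then have "q powr s \<le> q powr 2" using assms by (intro powr_mono) auto
    then show ?thesis using False by (simp add: powr_numeral)
  qed
  then have "\<delta> powr s * q powr s \<le> \<delta> powr s * (1 + q\<^sup>2)" by (intro mult_left_mono) auto
  moreover have "\<delta> powr s * q powr s = r powr s"
    using assms by (simp add: q_def powr_divide)
  ultimately show ?thesis by (simp add: q_def power_divide)
qed

text \<open>By Fubini the error is at most the average of the \<open>L1\<close> moduli of continuity
  against the kernel, that is, \<open>b\<close> times its moment of order \<open>s\<close>.\<close>

lemma vp_smooth_L1_error:
  fixes f :: "real ^ 'd \<Rightarrow> real"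
  assumes f: "f \<in> borel_measurable borel" "\<And>x. \<bar>f x\<bar> \<le> 1" and b: "0 \<le> b"
    and mod: "\<And>u. (\<integral>\<^sup>+ x. ennreal \<bar>f (x + u) - f x\<bar> \<partial>lborel) \<le> ennreal (b * norm u powr s)"
    and s: "0 < s" "s \<le> 1"
  shows "(\<integral>\<^sup>+ x. ennreal \<bar>vp_smooth m f x - f x\<bar> \<partial>lborel)
    \<le> ennreal (b * (1 + real CARD('d) * pi\<^sup>2 / 2) * (real m + 1) powr (- (s / 2)))"
proof -
  note [measurable] = f(1)
  have "(\<integral>\<^sup>+ x. ennreal \<bar>vp_smooth m f x - f x\<bar> \<partial>lborel)
      \<le> (\<integral>\<^sup>+ x. (\<integral>\<^sup>+ u. ennreal (\<bar>f (x + u) - f x\<bar> * vp_kernel m u) \<partial>lborel) \<partial>lborel)"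
  proof (rule nn_integral_mono)
    fix x
    have i: "integrable lborel (\<lambda>u :: real ^ 'd. f x * vp_kernel m u)"
      by (intro integrable_mult_right vp_kernel_integrable)
    have "vp_smooth m f x - f x = (\<integral>u. (f (x + u) - f x) * vp_kernel m u \<partial>lborel)"
      using vp_smooth_integrable[OF f, of x m] i by (simp add: vp_smooth_def left_diff_distrib integral_vp_kernel)
    then have "\<bar>vp_smooth m f x - f x\<bar> \<le> (\<integral>u. \<bar>f (x + u) - f x\<bar> * vp_kernel m u \<partial>lborel)"
      using integral_abs_bound[of lborel "\<lambda>u. (f (x + u) - f x) * vp_kernel m u"] by (simp add: abs_mult vp_kernel_nonneg)
    then show "ennreal \<bar>vp_smooth m f x - f x\<bar> \<le> (\<integral>\<^sup>+ u. ennreal (\<bar>f (x + u) - f x\<bar> * vp_kernel m u) \<partial>lborel)"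
      by (intro order_trans[OF ennreal_leI ennreal_integral_le])
  qed
  also have "\<dots> = (\<integral>\<^sup>+ u. (\<integral>\<^sup>+ x. ennreal (\<bar>f (x + u) - f x\<bar> * vp_kernel m u) \<partial>lborel) \<partial>lborel)"
    by (rule lborel_pair.Fubini'[symmetric]) measurable
  also have "\<dots> = (\<integral>\<^sup>+ u. (\<integral>\<^sup>+ x. ennreal \<bar>f (x + u) - f x\<bar> \<partial>lborel) * ennreal (vp_kernel m u) \<partial>lborel)"
    by (simp add: ennreal_mult vp_kernel_nonneg nn_integral_multc)
  also have "\<dots> \<le> (\<integral>\<^sup>+ (u :: real ^ 'd). ennreal (b * norm u powr s) * ennreal (vp_kernel m u) \<partial>lborel)"
    by (intro nn_integral_mono mult_right_mono mod) simp
  also have "\<dots> \<le> (\<integral>\<^sup>+ (u :: real ^ 'd). ennreal (b * (real m + 1) powr (- (s / 2))) * (ennreal (vp_kernel m u)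
      + ennreal (real m + 1) * ennreal ((norm u)\<^sup>2 * vp_kernel m u)) \<partial>lborel)"
  proof (rule nn_integral_mono)
    fix u :: "real ^ 'd"
    \<comment> \<open>The spread of the kernel, whose second moment is of order
      \<open>1 / (m + 1)\<close>.\<close>
    let ?\<delta> = "(real m + 1) powr (- (1 / 2))"
    have d: "?\<delta>\<^sup>2 = 1 / (real m + 1)"
      by (simp add: power2_eq_square powr_minus_divide flip: powr_add)
    have d': "?\<delta> powr s = (real m + 1) powr (- (s / 2))" by (simp add: powr_powr)
    have "norm u powr s \<le> ?\<delta> powr s * (1 + (norm u)\<^sup>2 / ?\<delta>\<^sup>2)"
      using s by (intro powr_le_square_bound) auto
    then have "norm u powr s \<le> (real m + 1) powr (- (s / 2)) * (1 + (real m + 1) * (norm u)\<^sup>2)"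
      unfolding d d' by (simp add: mult.commute)
    then have "(b * norm u powr s) * vp_kernel m u \<le> b * ((real m + 1) powr (- (s / 2)) * (1 + (real m + 1) * (norm u)\<^sup>2)) * vp_kernel m u"
      using b by (intro mult_right_mono mult_left_mono vp_kernel_nonneg)
    also have "\<dots> = (b * (real m + 1) powr (- (s / 2))) * (vp_kernel m u + (real m + 1) * ((norm u)\<^sup>2 * vp_kernel m u))"
      by (simp add: algebra_simps)
    finally show "ennreal (b * norm u powr s) * ennreal (vp_kernel m u) \<le> ennreal (b * (real m + 1) powr (- (s / 2))) * (ennreal (vp_kernel m u)
      + ennreal (real m + 1) * ennreal ((norm u)\<^sup>2 * vp_kernel m u))"
      using b by (simp add: vp_kernel_nonneg ennreal_leI flip: ennreal_mult ennreal_plus)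
  qed
  also have "\<dots> = ennreal (b * (real m + 1) powr (- (s / 2))) * ((\<integral>\<^sup>+ (u :: real ^ 'd). ennreal (vp_kernel m u) \<partial>lborel)
      + ennreal (real m + 1) * (\<integral>\<^sup>+ (u :: real ^ 'd). ennreal ((norm u)\<^sup>2 * vp_kernel m u) \<partial>lborel))"
    by (simp add: nn_integral_cmult nn_integral_add)
  also have "\<dots> \<le> ennreal (b * (real m + 1) powr (- (s / 2))) * (1 + ennreal (real m + 1) * ennreal (real CARD('d) * (pi\<^sup>2 / (2 * real m + 2))))"
    unfolding nn_integral_vp_kernel by (intro mult_left_mono add_mono nn_integral_vp_kernel_square) auto
  also have "\<dots> = ennreal ((b * (real m + 1) powr (- (s / 2))) * (1 + (real m + 1) * (real CARD('d) * (pi\<^sup>2 / (2 * real m + 2)))))"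
    using b by (simp add: flip: ennreal_mult ennreal_plus ennreal_1)
  also have "(real m + 1) * (real CARD('d) * (pi\<^sup>2 / (2 * real m + 2))) = real CARD('d) * pi\<^sup>2 / 2"
    by (simp add: field_simps)
  finally show ?thesis by (simp add: mult_ac)
qed

section \<open>Expansion of the kernel into ridge functions\<close>

text \<open>The Fourier coefficients of \<open>cos (u / 2) ^ (2 * m)\<close>, with \<open>l\<close>
  standing for the frequency \<open>l - m\<close>. They form the binomial distribution of
  \<open>2 * m\<close> fair trials.\<close>

definition vp_weight1 :: "nat \<Rightarrow> nat \<Rightarrow> real" where
  "vp_weight1 m l = real (2 * m choose l) / 4 ^ m"

text \<open>Makes the moment identities of Bernstein polynomials available.\<close>

lemma vp_weight1_Bernstein: "l \<le> 2 * m \<Longrightarrow> vp_weight1 m l = Bernstein (2 * m) l (1 / 2)"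
  by (simp add: vp_weight1_def Bernstein_def power_mult power_divide flip: power_add)

lemma vp_weight1_nonneg: "0 \<le> vp_weight1 m l"
  by (simp add: vp_weight1_def)

lemma sum_vp_weight1: "(\<Sum>l\<le>2 * m. vp_weight1 m l) = 1"
  by (simp add: vp_weight1_Bernstein)

lemma vp_weight1_variance: "(\<Sum>l\<le>2 * m. (real l - real m)\<^sup>2 * vp_weight1 m l) = real m / 2"
proof -
  let ?B = "\<lambda>l. Bernstein (2 * m) l (1 / 2)"
  have "(\<Sum>l\<le>2 * m. (real l - real m)\<^sup>2 * vp_weight1 m l)
      = (\<Sum>l\<le>2 * m. real l * (real l - 1) * ?B l + (1 - 2 * real m) * (real l * ?B l) + (real m)\<^sup>2 * ?B l)"
    by (intro sum.cong refl) (simp add: vp_weight1_Bernstein power2_eq_square algebra_simps)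
  also have "\<dots> = (\<Sum>l\<le>2 * m. real l * (real l - 1) * ?B l) + (1 - 2 * real m) * (\<Sum>l\<le>2 * m. real l * ?B l) + (real m)\<^sup>2 * (\<Sum>l\<le>2 * m. ?B l)"
    by (simp only: sum.distrib sum_distrib_left)
  also have "\<dots> = real m / 2"
    by (simp only: sum_kk_Bernstein sum_k_Bernstein sum_Bernstein) (simp add: power2_eq_square field_simps)
  finally show ?thesis .
qed

lemma cos_power_expansion:
  "complex_of_real (cos (u / 2) ^ (2 * m)) = (\<Sum>l\<le>2 * m. complex_of_real (vp_weight1 m l) * cis ((real l - real m) * u))"
proof -
  have "complex_of_real (cos (u / 2)) = (cis (u / 2) + cis (- (u / 2))) / 2"
    by (simp add: complex_eq_iff)
  then have "complex_of_real (cos (u / 2) ^ (2 * m)) = (cis (u / 2) + cis (- (u / 2))) ^ (2 * m) / 2 ^ (2 * m)"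
    by (simp only: of_real_power power_divide)
  also have "(cis (u / 2) + cis (- (u / 2))) ^ (2 * m)
      = (\<Sum>l\<le>2 * m. of_nat (2 * m choose l) * cis (u / 2) ^ l * cis (- (u / 2)) ^ (2 * m - l))"
    by (rule binomial_ring)
  also have "\<dots> / 2 ^ (2 * m) = (\<Sum>l\<le>2 * m. complex_of_real (vp_weight1 m l) * cis ((real l - real m) * u))"
    unfolding sum_divide_distrib
  proof (intro sum.cong refl)
    fix l assume l: "l \<in> {..2 * m}"
    have "cis (u / 2) ^ l * cis (- (u / 2)) ^ (2 * m - l) = cis (real l * (u / 2) + real (2 * m - l) * (- (u / 2)))"
      by (simp only: Complex.DeMoivre cis_mult)
    also have "real l * (u / 2) + real (2 * m - l) * (- (u / 2)) = (real l - real m) * u"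
      using l by (simp add: of_nat_diff field_simps)
    finally show "of_nat (2 * m choose l) * cis (u / 2) ^ l * cis (- (u / 2)) ^ (2 * m - l) / 2 ^ (2 * m)
        = complex_of_real (vp_weight1 m l) * cis ((real l - real m) * u)"
      by (simp add: vp_weight1_def power_mult mult.assoc)
  qed
  finally show ?thesis .
qed

definition vp_index :: "nat \<Rightarrow> ('d::finite \<Rightarrow> nat) set" where
  "vp_index m = PiE UNIV (\<lambda>_. {..2 * m})"

definition vp_weight :: "nat \<Rightarrow> ('d::finite \<Rightarrow> nat) \<Rightarrow> real" where
  "vp_weight m l = (\<Prod>i\<in>UNIV. vp_weight1 m (l i))"

definition vp_freq :: "nat \<Rightarrow> ('d::finite \<Rightarrow> nat) \<Rightarrow> real ^ 'd" where
  "vp_freq m l = (\<chi> i. real (l i) - real m)"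

lemma finite_vp_index [simp]: "finite (vp_index m)"
  unfolding vp_index_def by (intro finite_PiE) auto

lemma vp_weight_nonneg: "0 \<le> vp_weight m l"
  unfolding vp_weight_def by (intro prod_nonneg ballI vp_weight1_nonneg)

lemma sum_vp_weight: "(\<Sum>l\<in>vp_index m. vp_weight m l) = 1"
  unfolding vp_index_def vp_weight_def
  by (subst prod_sum_PiE[symmetric]) (auto simp: sum_vp_weight1)

lemma prod_cis: "(\<Prod>i\<in>I. cis (f i)) = cis (\<Sum>i\<in>I. f i)"
  by (induction I rule: infinite_finite_induct) (simp_all add: cis_mult)

text \<open>The one-dimensional expansions are multiplied out, one frequency per coordinate; taking
  real parts leaves the cosines.\<close>

lemma prod_cos_expansion:
  fixes z :: "real ^ 'd"
  shows "(\<Prod>i\<in>UNIV. cos (z $ i / 2) ^ (2 * m)) = (\<Sum>l\<in>vp_index m. vp_weight m l * cos (vp_freq m l \<bullet> z))"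
proof -
  have "complex_of_real (\<Prod>i\<in>UNIV. cos (z $ i / 2) ^ (2 * m))
      = (\<Prod>i\<in>UNIV. \<Sum>l\<le>2 * m. complex_of_real (vp_weight1 m l) * cis ((real l - real m) * (z $ i)))"
    unfolding of_real_prod by (intro prod.cong refl cos_power_expansion)
  also have "\<dots> = (\<Sum>l\<in>vp_index m. \<Prod>i\<in>UNIV. complex_of_real (vp_weight1 m (l i)) * cis ((real (l i) - real m) * (z $ i)))"
    unfolding vp_index_def by (rule prod_sum_PiE) auto
  also have "\<dots> = (\<Sum>l\<in>vp_index m. complex_of_real (vp_weight m l) * cis (vp_freq m l \<bullet> z))"
    by (simp add: prod.distrib prod_cis vp_weight_def vp_freq_def inner_vec_def)
  finally have "Re (complex_of_real (\<Prod>i\<in>UNIV. cos (z $ i / 2) ^ (2 * m)))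
      = Re (\<Sum>l\<in>vp_index m. complex_of_real (vp_weight m l) * cis (vp_freq m l \<bullet> z))" by (rule arg_cong)
  then show ?thesis by (simp del: of_real_prod of_real_power)
qed

lemma sum_vp_weight_coordinate:
  fixes i :: "'d::finite"
  shows "(\<Sum>l\<in>vp_index m. vp_weight m l * (vp_freq m l $ i)\<^sup>2) = real m / 2"
proof -
  let ?g = "\<lambda>j l. (if j = i then (real l - real m)\<^sup>2 else 1) * vp_weight1 m l"
  have "vp_weight m l * (vp_freq m l $ i)\<^sup>2 = (\<Prod>j\<in>UNIV. ?g j (l j))" for l :: "'d \<Rightarrow> nat"
    by (simp add: prod.distrib vp_weight_def vp_freq_def mult.commute)
  then have "(\<Sum>l\<in>vp_index m. vp_weight m l * (vp_freq m l $ i)\<^sup>2) = (\<Sum>l\<in>vp_index m. \<Prod>j\<in>UNIV. ?g j (l j))" by simp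
  also have "\<dots> = (\<Prod>j\<in>UNIV. \<Sum>l\<le>2 * m. ?g j l)"
    unfolding vp_index_def by (subst prod_sum_PiE) auto
  also have "\<dots> = (\<Prod>j\<in>UNIV. if j = i then real m / 2 else 1)"
  proof (intro prod.cong refl)
    fix j
    show "(\<Sum>l\<le>2 * m. ?g j l) = (if j = i then real m / 2 else 1)"
      using vp_weight1_variance[of m] sum_vp_weight1[of m] by simp
  qed
  also have "\<dots> = real m / 2" by simp
  finally show ?thesis .
qed

text \<open>Cauchy-Schwarz bounds the square of \<open>norm1\<close> by \<open>CARD('d)\<close>
  times the sum of squares, and each coordinate has second moment \<open>m / 2\<close>.\<close>

lemma sum_vp_weight_norm1_square:
  "(\<Sum>l\<in>(vp_index m :: ('d::finite \<Rightarrow> nat) set). vp_weight m l * (norm1 (vp_freq m l))\<^sup>2) \<le> (real CARD('d))\<^sup>2 * real m / 2"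
proof -
  have "(norm1 v)\<^sup>2 \<le> real CARD('d) * (\<Sum>i\<in>UNIV. (v $ i)\<^sup>2)" for v :: "real ^ 'd"
    using sum_squared_le_sum_of_squares[of "\<lambda>i. \<bar>v $ i\<bar>" UNIV] by (simp add: norm1_def mult.commute)
  then have "(\<Sum>l\<in>(vp_index m :: ('d \<Rightarrow> nat) set). vp_weight m l * (norm1 (vp_freq m l))\<^sup>2)
      \<le> (\<Sum>l\<in>(vp_index m :: ('d \<Rightarrow> nat) set). vp_weight m l * (real CARD('d) * (\<Sum>i\<in>UNIV. (vp_freq m l $ i)\<^sup>2)))"
    by (intro sum_mono mult_left_mono vp_weight_nonneg)
  also have "\<dots> = real CARD('d) * (\<Sum>i\<in>(UNIV :: 'd set). \<Sum>l\<in>vp_index m. vp_weight m l * (vp_freq m l $ i)\<^sup>2)"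
    by (subst sum.swap) (simp add: sum_distrib_left mult_ac)
  also have "\<dots> = (real CARD('d))\<^sup>2 * real m / 2"
    by (simp only: sum_vp_weight_coordinate) (simp add: power2_eq_square)
  finally show ?thesis .
qed

lemma sum_vp_weight_norm1:
  "(\<Sum>l\<in>(vp_index m :: ('d::finite \<Rightarrow> nat) set). vp_weight m l * norm1 (vp_freq m l)) \<le> 1 / 2 + (real CARD('d))\<^sup>2 * real m / 4"
proof -
  have "r \<le> 1 / 2 + r\<^sup>2 / 2" for r :: real
    using zero_le_power2[of "r - 1"] by (simp add: power2_eq_square algebra_simps)
  then have "(\<Sum>l\<in>(vp_index m :: ('d \<Rightarrow> nat) set). vp_weight m l * norm1 (vp_freq m l))
      \<le> (\<Sum>l\<in>(vp_index m :: ('d \<Rightarrow> nat) set). vp_weight m l * (1 / 2 + (norm1 (vp_freq m l))\<^sup>2 / 2))"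
    by (intro sum_mono mult_left_mono vp_weight_nonneg)
  also have "\<dots> = (\<Sum>l\<in>(vp_index m :: ('d \<Rightarrow> nat) set). vp_weight m l) / 2
      + (\<Sum>l\<in>(vp_index m :: ('d \<Rightarrow> nat) set). vp_weight m l * (norm1 (vp_freq m l))\<^sup>2) / 2"
    by (simp add: distrib_left sum.distrib sum_divide_distrib)
  also have "\<dots> \<le> 1 / 2 + (real CARD('d))\<^sup>2 * real m / 4"
    using sum_vp_weight_norm1_square[of m, where 'd = 'd] by (simp add: sum_vp_weight)
  finally show ?thesis .
qed

lemma emeasure_unit_cube: "emeasure lborel (unit_cube :: (real ^ 'd) set) = 1"
proof -
  have "(\<chi> i. 1) \<bullet> b = 1" if "b \<in> Basis" for b :: "real ^ 'd"
    using that by (auto simp: Basis_vec_real inner_axis)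
  then show ?thesis
    by (simp add: unit_cube_eq_cbox emeasure_lborel_cbox_eq)
qed

text \<open>The addition formula for \<open>cos (vp_freq m l \<bullet> (y - x))\<close> separates
  \<open>x\<close> from \<open>y\<close>. \<open>C\<close> and \<open>D\<close> are then Fourier
  coefficients of \<open>f\<close>, bounded by 1 because \<open>f\<close> is bounded by 1 and lives
  on a set of volume 1.\<close>

lemma vp_smooth_ridge:
  fixes f :: "real ^ 'd \<Rightarrow> real"
  assumes f: "f \<in> borel_measurable borel" "\<And>x. \<bar>f x\<bar> \<le> 1" "\<And>x. x \<notin> unit_cube \<Longrightarrow> f x = 0"
  obtains C D :: "('d \<Rightarrow> nat) \<Rightarrow> real" where "\<And>l. \<bar>C l\<bar> \<le> 1" "\<And>l. \<bar>D l\<bar> \<le> 1"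
    "\<And>x. x \<in> unit_cube \<Longrightarrow> vp_smooth m f x = (\<Sum>l\<in>vp_index m. vp_weight m l / vp_mass m ^ CARD('d) *
        (C l * cos (vp_freq m l \<bullet> x) + D l * sin (vp_freq m l \<bullet> x)))"
proof -
  note [measurable] = f(1)
  define C D where "C l = (\<integral>y. f y * cos (vp_freq m l \<bullet> y) \<partial>lborel)"
    and "D l = (\<integral>y. f y * sin (vp_freq m l \<bullet> y) \<partial>lborel)" for l
  have iI: "integrable lborel (indicat_real (unit_cube :: (real ^ 'd) set))"
    by (intro integrable_real_indicator) (auto simp: emeasure_unit_cube)
  have int_cube: "(\<integral>x. indicat_real (unit_cube :: (real ^ 'd) set) x \<partial>lborel) = 1"
    by (simp add: measure_def emeasure_unit_cube)
  have bd: "integrable lborel (\<lambda>y. f y * g y)" "\<bar>\<integral>y. f y * g y \<partial>lborel\<bar> \<le> 1"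
    if g: "g \<in> borel_measurable borel" "\<And>y. \<bar>g y\<bar> \<le> 1" for g :: "real ^ 'd \<Rightarrow> real"
  proof -
    note [measurable] = g(1)
    have le: "\<bar>f y * g y\<bar> \<le> indicator unit_cube y" for y
      using f(2)[of y] f(3)[of y] g(2)[of y] by (cases "y \<in> unit_cube") (auto simp: abs_mult mult_le_one)
    show i: "integrable lborel (\<lambda>y. f y * g y)"
      by (rule Bochner_Integration.integrable_bound[OF iI]) (use le in auto)
    have "\<bar>\<integral>y. f y * g y \<partial>lborel\<bar> \<le> (\<integral>y. \<bar>f y * g y\<bar> \<partial>lborel)" by (rule integral_abs_bound)
    also have "\<dots> \<le> (\<integral>(y :: real ^ 'd). indicat_real unit_cube y \<partial>lborel)"
      using i iI le by (intro integral_mono) auto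
    finally show "\<bar>\<integral>y. f y * g y \<partial>lborel\<bar> \<le> 1" using int_cube by simp
  qed
  have ic: "integrable lborel (\<lambda>y. f y * cos (vp_freq m l \<bullet> y))" and isn: "integrable lborel (\<lambda>y. f y * sin (vp_freq m l \<bullet> y))" for l
    by (intro bd; simp)+
  show ?thesis
  proof (rule that[of C D])
    show "\<bar>C l\<bar> \<le> 1" "\<bar>D l\<bar> \<le> 1" for l unfolding C_def D_def by (intro bd; simp)+
    fix x :: "real ^ 'd" assume x: "x \<in> unit_cube"
    have "vp_smooth m f x = (\<integral>u. f (x + u) * vp_kernel m ((x + u) - x) \<partial>lborel)"
      by (simp add: vp_smooth_def)
    also have "\<dots> = (\<integral>y. f y * vp_kernel m (y - x) \<partial>distr lborel borel ((+) x))"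
      by (subst integral_distr) (auto simp: )
    also have "\<dots> = (\<integral>y. f y * vp_kernel m (y - x) \<partial>lborel)"
      by (simp add: lborel_distr_plus)
    also have "\<dots> = (\<integral>y. (\<Sum>l\<in>vp_index m. vp_weight m l / vp_mass m ^ CARD('d) *
        (f y * cos (vp_freq m l \<bullet> y) * cos (vp_freq m l \<bullet> x) + f y * sin (vp_freq m l \<bullet> y) * sin (vp_freq m l \<bullet> x))) \<partial>lborel)"
    proof (rule Bochner_Integration.integral_cong[OF refl])
      fix y
      show "f y * vp_kernel m (y - x) = (\<Sum>l\<in>vp_index m. vp_weight m l / vp_mass m ^ CARD('d) *
        (f y * cos (vp_freq m l \<bullet> y) * cos (vp_freq m l \<bullet> x) + f y * sin (vp_freq m l \<bullet> y) * sin (vp_freq m l \<bullet> x)))"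
      proof (cases "y \<in> unit_cube")
        case True
        \<comment> \<open>Differences of points of the cube stay in \<open>[-1, 1]\<close>, so the
          cutoff at \<open>pi\<close> is invisible and the kernel is a trigonometric polynomial
          there.\<close>
        have "(y - x) $ i \<in> {- pi..pi}" for i
        proof -
          have "0 \<le> y $ i" "y $ i \<le> 1" "0 \<le> x $ i" "x $ i \<le> 1" using True x by (auto simp: unit_cube_def)
          then show ?thesis using pi_ge_two by simp
        qed
        then have "vp_kernel m (y - x) = (\<Prod>i\<in>UNIV. cos ((y - x) $ i / 2) ^ (2 * m) / vp_mass m)"
          unfolding vp_kernel_def vp_kernel1_def by (simp del: vector_minus_component)
        also have "\<dots> = (\<Sum>l\<in>vp_index m. vp_weight m l * cos (vp_freq m l \<bullet> (y - x))) / vp_mass m ^ CARD('d)"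
          by (simp add: prod_dividef prod_cos_expansion[of "y - x" m, simplified])
        finally show ?thesis
          unfolding sum_divide_distrib
          by (simp add: sum_distrib_left inner_diff_right cos_diff)
            (intro sum.cong refl, simp add: add_divide_distrib algebra_simps)
      qed (simp add: f(3))
    qed
    also have "\<dots> = (\<Sum>l\<in>vp_index m. vp_weight m l / vp_mass m ^ CARD('d) *
        (C l * cos (vp_freq m l \<bullet> x) + D l * sin (vp_freq m l \<bullet> x)))"
      unfolding C_def D_def using ic isn by simp
    finally show "vp_smooth m f x = \<dots>" .
  qed
qed

text \<open>The Taylor formula along \<open>w \<bullet> x\<close>. Two derivatives of a wave of
  frequency \<open>r\<close> bring out \<open>r\<^sup>2\<close>, which is why the total weight is
  governed by second moments of the frequencies. The first-order part goes to \<open>w0\<close> and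
  \<open>b0\<close> instead of the units.\<close>

lemma ridge_relu_approximation:
  fixes w :: "real ^ 'd"
  assumes w: "norm1 w \<le> 1" and ab: "\<bar>\<alpha>\<bar> \<le> c" "\<bar>\<beta>\<bar> \<le> c" and r: "0 \<le> r" and \<epsilon>: "0 < \<epsilon>"
  shows "\<exists>ps w0 b0. ridge_params (4 * (c * r\<^sup>2)) ps \<and> norm1 w0 \<le> 2 * (c * r) \<and> \<bar>b0\<bar> \<le> 2 * c + 2 * (c * r) \<and>
    (\<forall>x\<in>unit_cube. \<bar>(\<alpha> * cos (r * (w \<bullet> x)) + \<beta> * sin (r * (w \<bullet> x))) - (ridge_sum relu ps x + w0 \<bullet> x + b0)\<bar> \<le> \<epsilon>)"
proof -
  have c: "0 \<le> c" using ab by linarith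
  define h h' h'' where "h v = \<alpha> * cos (r * v) + \<beta> * sin (r * v)"
    and "h' v = r * (\<beta> * cos (r * v) - \<alpha> * sin (r * v))" and "h'' v = - (r\<^sup>2) * (\<alpha> * cos (r * v) + \<beta> * sin (r * v))" for v
  have d: "(h has_real_derivative h' v) (at v)" "(h' has_real_derivative h'' v) (at v)"
    "(h'' has_real_derivative - (r\<^sup>2) * (r * (\<beta> * cos (r * v) - \<alpha> * sin (r * v)))) (at v)" for v
    unfolding h_def h'_def h''_def by (auto intro!: derivative_eq_intros simp: power2_eq_square algebra_simps)
  have trig: "\<bar>a * cos v + b * sin v\<bar> \<le> 2 * c" "\<bar>a * cos v - b * sin v\<bar> \<le> 2 * c" if "\<bar>a\<bar> \<le> c" "\<bar>b\<bar> \<le> c" for a b v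
  proof -
    have "\<bar>a * cos v\<bar> \<le> c * 1" "\<bar>b * sin v\<bar> \<le> c * 1"
      using that c unfolding abs_mult by (intro mult_mono; simp)+
    then show "\<bar>a * cos v + b * sin v\<bar> \<le> 2 * c" "\<bar>a * cos v - b * sin v\<bar> \<le> 2 * c" by linarith+
  qed
  have H: "\<bar>h'' v\<bar> \<le> 2 * (c * r\<^sup>2)" for v
    using mult_left_mono[OF trig(1)[OF ab, of "r * v"], of "r\<^sup>2"] by (simp add: h''_def abs_mult mult_ac)
  have lip: "\<bar>h'' u - h'' v\<bar> \<le> (r\<^sup>2 * (r * (2 * c))) * \<bar>u - v\<bar>" for u v
  proof -
    have "norm (h'' u - h'' v) \<le> (r\<^sup>2 * (r * (2 * c))) * norm (u - v)"
    proof (rule field_differentiable_bound[of UNIV])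
      show "norm (- (r\<^sup>2) * (r * (\<beta> * cos (r * z) - \<alpha> * sin (r * z)))) \<le> r\<^sup>2 * (r * (2 * c))" for z
        using trig(2)[OF ab(2,1), of "r * z"] r by (simp add: abs_mult mult_left_mono)
    qed (use d(3) in auto)
    then show ?thesis by simp
  qed
  obtain qs :: "(real \<times> real) list" where qs: "\<And>\<gamma> b. (\<gamma>, b) \<in> set qs \<Longrightarrow> \<bar>b\<bar> \<le> 1"
    "(\<Sum>(\<gamma>, b)\<leftarrow>qs. \<bar>\<gamma>\<bar>) \<le> 2 * (2 * (c * r\<^sup>2))"
    and app: "\<And>v. \<bar>v\<bar> \<le> 1 \<Longrightarrow> \<bar>h v - (h (-1) + h' (-1) * (v + 1) + (\<Sum>(\<gamma>, b)\<leftarrow>qs. \<gamma> * relu (v - b)))\<bar> \<le> \<epsilon>"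
    using taylor_relu_sum[OF d(1,2) H lip \<epsilon>] by metis
  define ps where "ps = map (\<lambda>(\<gamma>, b). (\<gamma>, w, - b)) qs"
  have "ridge_params (4 * (c * r\<^sup>2)) ps"
    using qs w by (auto simp: ridge_params_def ps_def comp_def case_prod_unfold)
  moreover have h'1: "\<bar>h' (-1)\<bar> \<le> 2 * (c * r)"
    using mult_left_mono[OF trig(2)[OF ab(2,1), of "r * (-1)"] r] r by (simp add: h'_def abs_mult mult_ac)
  moreover have "norm1 (h' (-1) *\<^sub>R w) \<le> 2 * (c * r)"
    using mult_mono[OF h'1 w] c r by (simp add: norm1_scale norm1_nonneg)
  moreover have "\<bar>h (-1) + h' (-1)\<bar> \<le> 2 * c + 2 * (c * r)"
    using trig(1)[OF ab, of "r * (-1)"] h'1 by (simp add: h_def)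
  moreover have "\<bar>(\<alpha> * cos (r * (w \<bullet> x)) + \<beta> * sin (r * (w \<bullet> x))) - (ridge_sum relu ps x + (h' (-1) *\<^sub>R w) \<bullet> x + (h (-1) + h' (-1)))\<bar> \<le> \<epsilon>"
    if "x \<in> unit_cube" for x
  proof -
    have "\<bar>w \<bullet> x\<bar> \<le> 1" using inner_abs_le_norm1[of x w] that w by (auto simp: unit_cube_def)
    from app[OF this] show ?thesis
      by (simp add: h_def ridge_sum_def ps_def comp_def case_prod_unfold algebra_simps)
  qed
  ultimately show ?thesis by blast
qed

text \<open>Concatenates the approximations of the single waves. The bounds are kept as sums over
  \<open>L\<close> so that moments of the frequencies can be inserted later.\<close>

lemma ridge_sum_relu_approximation:
  fixes w :: "'l \<Rightarrow> real ^ 'd"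
  assumes "finite L" and w: "\<And>l. norm1 (w l) \<le> 1" and ab: "\<And>l. \<bar>\<alpha> l\<bar> \<le> c l" "\<And>l. \<bar>\<beta> l\<bar> \<le> c l" and r: "\<And>l. 0 \<le> r l" and \<epsilon>: "0 < \<epsilon>"
  shows "\<exists>ps w0 b0. ridge_params (\<Sum>l\<in>L. 4 * (c l * (r l)\<^sup>2)) ps \<and> norm1 w0 \<le> (\<Sum>l\<in>L. 2 * (c l * r l)) \<and>
    \<bar>b0\<bar> \<le> (\<Sum>l\<in>L. 2 * c l + 2 * (c l * r l)) \<and>
    (\<forall>x\<in>unit_cube. \<bar>(\<Sum>l\<in>L. \<alpha> l * cos (r l * (w l \<bullet> x)) + \<beta> l * sin (r l * (w l \<bullet> x))) - (ridge_sum relu ps x + w0 \<bullet> x + b0)\<bar> \<le> real (card L) * \<epsilon>)"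
  using \<open>finite L\<close>
proof induction
  case empty
  show ?case
    by (intro exI[of _ "[]"] exI[of _ 0]) (simp add: ridge_params_def)
next
  case (insert k L)
  obtain ps w0 b0 where IH: "ridge_params (\<Sum>l\<in>L. 4 * (c l * (r l)\<^sup>2)) ps" "norm1 w0 \<le> (\<Sum>l\<in>L. 2 * (c l * r l))"
    "\<bar>b0\<bar> \<le> (\<Sum>l\<in>L. 2 * c l + 2 * (c l * r l))"
    "\<And>x. x\<in>unit_cube \<Longrightarrow> \<bar>(\<Sum>l\<in>L. \<alpha> l * cos (r l * (w l \<bullet> x)) + \<beta> l * sin (r l * (w l \<bullet> x))) - (ridge_sum relu ps x + w0 \<bullet> x + b0)\<bar> \<le> real (card L) * \<epsilon>"
    using insert.IH by blast
  obtain qs v0 d0 where new: "ridge_params (4 * (c k * (r k)\<^sup>2)) qs" "norm1 v0 \<le> 2 * (c k * r k)"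
    "\<bar>d0\<bar> \<le> 2 * c k + 2 * (c k * r k)"
    "\<And>x. x\<in>unit_cube \<Longrightarrow> \<bar>(\<alpha> k * cos (r k * (w k \<bullet> x)) + \<beta> k * sin (r k * (w k \<bullet> x))) - (ridge_sum relu qs x + v0 \<bullet> x + d0)\<bar> \<le> \<epsilon>"
    using ridge_relu_approximation[OF w[of k] ab(1)[of k] ab(2)[of k] r[of k] \<epsilon>] by blast
  have sums: "(\<Sum>l\<in>insert k L. f l) = f k + (\<Sum>l\<in>L. f l)" for f :: "'l \<Rightarrow> real" using insert.hyps by simp
  have "ridge_params (\<Sum>l\<in>insert k L. 4 * (c l * (r l)\<^sup>2)) (qs @ ps)"
    using IH(1) new(1) unfolding sums ridge_params_def by auto
  moreover have "norm1 (v0 + w0) \<le> (\<Sum>l\<in>insert k L. 2 * (c l * r l))"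
    unfolding sums using norm1_triangle[of v0 w0] IH(2) new(2) by linarith
  moreover have "\<bar>d0 + b0\<bar> \<le> (\<Sum>l\<in>insert k L. 2 * c l + 2 * (c l * r l))"
    unfolding sums using IH(3) new(3) by linarith
  moreover have "\<bar>(\<Sum>l\<in>insert k L. \<alpha> l * cos (r l * (w l \<bullet> x)) + \<beta> l * sin (r l * (w l \<bullet> x))) - (ridge_sum relu (qs @ ps) x + (v0 + w0) \<bullet> x + (d0 + b0))\<bar>
      \<le> real (card (insert k L)) * \<epsilon>" if "x \<in> unit_cube" for x
  proof -
    have "real (card (insert k L)) * \<epsilon> = \<epsilon> + real (card L) * \<epsilon>" using insert.hyps by (simp add: algebra_simps)
    then show ?thesis
      unfolding sums ridge_sum_simps inner_add_left using IH(4)[OF that] new(4)[OF that] by linarith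
  qed
  ultimately show ?case by blast
qed

section \<open>Compression to few units\<close>

lemma weighted_sum_ge_member:
  fixes q g :: "'i \<Rightarrow> real"
  assumes "finite I" "\<And>i. i \<in> I \<Longrightarrow> 0 \<le> q i" "(\<Sum>i\<in>I. q i) = 1"
  shows "\<exists>i\<in>I. g i \<le> (\<Sum>i\<in>I. q i * g i)"
proof -
  have "I \<noteq> {}" using assms(3) by auto
  from finite_obtains_max[OF assms(1) this, of "\<lambda>i. - g i"] obtain i where
    i: "i \<in> I" "\<And>j. j \<in> I \<Longrightarrow> g i \<le> g j" by auto
  have "g i = (\<Sum>j\<in>I. q j * g i)" using assms(3) by (simp flip: sum_distrib_right)
  also have "\<dots> \<le> (\<Sum>j\<in>I. q j * g j)" using i assms(2) by (intro sum_mono mult_left_mono) auto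
  finally show ?thesis using i(1) by blast
qed

text \<open>Maurey's sampling argument, derandomized: the indices are chosen one at a time, each keeping
  the squared \<open>L\<^sup>2\<close> error below its average over the weights.\<close>

lemma maurey_selection:
  fixes \<psi> :: "'i \<Rightarrow> 'x \<Rightarrow> real"
  assumes "prob_space m" and I: "finite I" and q: "\<And>i. i \<in> I \<Longrightarrow> 0 \<le> q i" "(\<Sum>i\<in>I. q i) = 1"
    and \<psi>: "\<And>i. i \<in> I \<Longrightarrow> \<psi> i \<in> borel_measurable m" "\<And>i x. i \<in> I \<Longrightarrow> \<bar>\<psi> i x\<bar> \<le> V"
  defines "G x \<equiv> \<Sum>i\<in>I. q i * \<psi> i x"
  shows "\<exists>js. length js = n \<and> set js \<subseteq> I \<and> (\<integral>x. ((\<Sum>j\<leftarrow>js. \<psi> j x) - real n * G x)\<^sup>2 \<partial>m) \<le> real n * V\<^sup>2"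
proof (induction n)
  case 0
  then show ?case by (intro exI[of _ "[]"]) simp
next
  case (Suc n)
  interpret prob_space m by fact
  have G_meas: "G \<in> borel_measurable m" unfolding G_def using \<psi>(1) by measurable
  have G_bd: "\<bar>G x\<bar> \<le> V" for x
  proof -
    have "\<bar>G x\<bar> \<le> (\<Sum>i\<in>I. \<bar>q i * \<psi> i x\<bar>)" unfolding G_def by (rule sum_abs)
    also have "\<dots> \<le> (\<Sum>i\<in>I. q i * V)" using q(1) \<psi>(2) by (intro sum_mono) (auto simp: abs_mult intro!: mult_left_mono)
    also have "\<dots> = V" using q(2) by (simp flip: sum_distrib_right)
    finally show ?thesis .
  qed
  obtain js where js: "length js = n" "set js \<subseteq> I" "(\<integral>x. ((\<Sum>j\<leftarrow>js. \<psi> j x) - real n * G x)\<^sup>2 \<partial>m) \<le> real n * V\<^sup>2"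
    using Suc by blast
  define R where "R x = (\<Sum>j\<leftarrow>js. \<psi> j x) - real n * G x" for x
  have list_meas: "(\<lambda>x. \<Sum>j\<leftarrow>ls. \<psi> j x) \<in> borel_measurable m" if "set ls \<subseteq> I" for ls
    using that by (induction ls) (auto intro!: borel_measurable_add \<psi>(1))
  have list_bd: "\<bar>\<Sum>j\<leftarrow>ls. \<psi> j x\<bar> \<le> real (length ls) * V" if "set ls \<subseteq> I" for ls x
    using that
  proof (induction ls)
    case (Cons l ls)
    then show ?case using \<psi>(2)[of l x] by (simp add: algebra_simps)
  qed simp
  have [measurable]: "R \<in> borel_measurable m"
    unfolding R_def using list_meas[OF js(2)] G_meas by measurable
  note [measurable] = G_meas
  have R_bd: "\<bar>R x\<bar> \<le> 2 * real n * V" for x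
  proof -
    have "\<bar>real n * G x\<bar> \<le> real n * V" using G_bd[of x] by (simp add: abs_mult mult_left_mono)
    then show ?thesis using list_bd[OF js(2), of x, unfolded js(1)] unfolding R_def by linarith
  qed
  have sq_int: "integrable m (\<lambda>x. (h x)\<^sup>2)" if "h \<in> borel_measurable m" "\<And>x. \<bar>h x\<bar> \<le> K" for h and K :: real
  proof (rule integrable_const_bound[where B = "K\<^sup>2"])
    have "\<bar>h x\<bar>\<^sup>2 \<le> K\<^sup>2" for x using that(2) by (intro power_mono) auto
    then show "AE x in m. norm ((h x)\<^sup>2) \<le> K\<^sup>2" by simp
  qed (use that in measurable)
  have step_int: "integrable m (\<lambda>x. (R x + \<psi> i x - G x)\<^sup>2)" if "i \<in> I" for i
  proof (rule sq_int)
    show "(\<lambda>x. R x + \<psi> i x - G x) \<in> borel_measurable m" using \<psi>(1)[OF that] by measurable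
    show "\<bar>R x + \<psi> i x - G x\<bar> \<le> 2 * real n * V + 2 * V" for x
      using R_bd[of x] G_bd[of x] \<psi>(2)[OF that, of x] by linarith
  qed
  \<comment> \<open>The mean of \<open>\<psi> i x\<close> over the weights is \<open>G x\<close>, so
    the cross term in the average of the squares leaves \<open>(R x)\<^sup>2\<close> plus a
    variance, and the variance is at most \<open>V\<^sup>2\<close>.\<close>
  have point: "(\<Sum>i\<in>I. q i * (R x + \<psi> i x - G x)\<^sup>2) \<le> (R x)\<^sup>2 + V\<^sup>2" for x
  proof -
    have "(\<Sum>i\<in>I. q i * (R x + \<psi> i x - G x)\<^sup>2)
        = (\<Sum>i\<in>I. q i * (R x - G x)\<^sup>2 + 2 * (R x - G x) * (q i * \<psi> i x) + q i * (\<psi> i x)\<^sup>2)"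
      by (intro sum.cong refl) (simp add: power2_eq_square algebra_simps)
    also have "\<dots> = (\<Sum>i\<in>I. q i) * (R x - G x)\<^sup>2 + 2 * (R x - G x) * G x + (\<Sum>i\<in>I. q i * (\<psi> i x)\<^sup>2)"
      by (simp add: sum.distrib sum_distrib_right sum_distrib_left G_def)
    also have "\<dots> = (R x)\<^sup>2 - (G x)\<^sup>2 + (\<Sum>i\<in>I. q i * (\<psi> i x)\<^sup>2)"
      unfolding q(2) by (simp add: power2_eq_square algebra_simps)
    also have "(\<Sum>i\<in>I. q i * (\<psi> i x)\<^sup>2) \<le> (\<Sum>i\<in>I. q i * V\<^sup>2)"
    proof (intro sum_mono mult_left_mono q(1))
      fix i assume "i \<in> I"
      then have "\<bar>\<psi> i x\<bar>\<^sup>2 \<le> V\<^sup>2" using \<psi>(2) by (intro power_mono) auto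
      then show "(\<psi> i x)\<^sup>2 \<le> V\<^sup>2" by simp
    qed
    also have "\<dots> = V\<^sup>2" using q(2) by (simp flip: sum_distrib_right)
    finally show ?thesis using zero_le_power2[of "G x"] by linarith
  qed
  obtain i where i: "i \<in> I" "(\<integral>x. (R x + \<psi> i x - G x)\<^sup>2 \<partial>m) \<le> (\<Sum>i\<in>I. q i * (\<integral>x. (R x + \<psi> i x - G x)\<^sup>2 \<partial>m))"
    using weighted_sum_ge_member[OF I q, of "\<lambda>i. \<integral>x. (R x + \<psi> i x - G x)\<^sup>2 \<partial>m"] by blast
  have "(\<Sum>i\<in>I. q i * (\<integral>x. (R x + \<psi> i x - G x)\<^sup>2 \<partial>m)) = (\<integral>x. (\<Sum>i\<in>I. q i * (R x + \<psi> i x - G x)\<^sup>2) \<partial>m)"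
    using step_int by simp
  also have "\<dots> \<le> (\<integral>x. (R x)\<^sup>2 + V\<^sup>2 \<partial>m)"
    using step_int sq_int[of R, OF _ R_bd] point by (intro integral_mono) auto
  also have "\<dots> = (\<integral>x. (R x)\<^sup>2 \<partial>m) + V\<^sup>2"
    using sq_int[of R, OF _ R_bd] by (simp add: prob_space)
  also have "\<dots> \<le> real (Suc n) * V\<^sup>2" using js(3) by (simp add: R_def algebra_simps)
  finally have "(\<integral>x. (R x + \<psi> i x - G x)\<^sup>2 \<partial>m) \<le> real (Suc n) * V\<^sup>2" using i(2) by linarith
  moreover have "R x + \<psi> i x - G x = (\<Sum>j\<leftarrow>i # js. \<psi> j x) - real (Suc n) * G x" for x
    by (simp add: R_def algebra_simps)
  ultimately show ?case using i(1) js(1,2) by (intro exI[of _ "i # js"]) simp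
qed

text \<open>Integrates \<open>\<bar>y\<bar> \<le> \<tau> / 2 + y\<^sup>2 / (2 * \<tau>)\<close>,
  which gives the Cauchy-Schwarz bound with its sharp constant.\<close>

lemma integral_abs_le_of_square:
  assumes "prob_space m" "g \<in> borel_measurable m" "integrable m (\<lambda>x. (g x)\<^sup>2)" "(\<integral>x. (g x)\<^sup>2 \<partial>m) \<le> \<tau>\<^sup>2" "0 < \<tau>"
  shows "(\<integral>\<^sup>+ x. ennreal \<bar>g x\<bar> \<partial>m) \<le> ennreal \<tau>"
proof -
  interpret prob_space m by fact
  have le: "\<bar>y\<bar> \<le> \<tau> / 2 + y\<^sup>2 / (2 * \<tau>)" for y :: real
  proof -
    have "0 \<le> (\<bar>y\<bar> - \<tau>)\<^sup>2" by simp
    then have "2 * \<tau> * \<bar>y\<bar> \<le> \<tau>\<^sup>2 + y\<^sup>2" by (simp add: power2_eq_square algebra_simps)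
    then show ?thesis using \<open>0 < \<tau>\<close> by (simp add: field_simps power2_eq_square)
  qed
  have "(\<integral>\<^sup>+ x. ennreal \<bar>g x\<bar> \<partial>m) \<le> (\<integral>\<^sup>+ x. ennreal (\<tau> / 2 + (g x)\<^sup>2 / (2 * \<tau>)) \<partial>m)"
    by (intro nn_integral_mono ennreal_leI le)
  also have "\<dots> = ennreal (\<integral>x. \<tau> / 2 + (g x)\<^sup>2 / (2 * \<tau>) \<partial>m)"
    using assms(3,5) by (intro nn_integral_eq_integral) auto
  also have "(\<integral>x. \<tau> / 2 + (g x)\<^sup>2 / (2 * \<tau>) \<partial>m) = \<tau> / 2 + (\<integral>x. (g x)\<^sup>2 \<partial>m) / (2 * \<tau>)"
    using assms(3) by (simp add: prob_space)
  also have "\<dots> \<le> \<tau> / 2 + \<tau>\<^sup>2 / (2 * \<tau>)" using assms(4,5) by (intro add_left_mono divide_right_mono) auto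
  also have "\<dots> = \<tau>" using \<open>0 < \<tau>\<close> by (simp add: power2_eq_square)
  finally show ?thesis by (simp add: ennreal_leI)
qed

text \<open>Units are sampled with probability proportional to
  \<open>\<bar>\<gamma> i\<bar>\<close>, and each of the \<open>k\<close> samples gets weight
  \<open>W / k\<close> up to sign, where \<open>W\<close> is the total weight. Repetitions are
  allowed, so exactly \<open>k\<close> samples can always be drawn.\<close>

lemma ridge_sum_compression:
  fixes ps :: "(real \<times> (real ^ 'd) \<times> real) list"
  assumes ps: "ridge_params B ps" and B: "0 < B" and k: "0 < k"
  obtains qs where "length qs \<le> k" "\<forall>(\<gamma>, w, b)\<in>set qs. norm1 w \<le> 1 \<and> \<bar>b\<bar> \<le> 1 \<and> \<bar>\<gamma>\<bar> \<le> B / k"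
    "(\<integral>\<^sup>+ x. ennreal (\<bar>ridge_sum relu ps x - ridge_sum relu qs x\<bar> * indicator unit_cube x) \<partial>lborel) \<le> ennreal (2 * B / sqrt k)"
proof -
  define I where "I = {..<length ps}"
  define \<gamma> w b where "\<gamma> i = fst (ps ! i)" and "w i = fst (snd (ps ! i))" and "b i = snd (snd (ps ! i))" for i
  define W where "W = (\<Sum>i\<in>I. \<bar>\<gamma> i\<bar>)"
  have rs: "ridge_sum relu ps x = (\<Sum>i\<in>I. \<gamma> i * relu (w i \<bullet> x + b i))" for x
    by (simp add: ridge_sum_def case_prod_unfold sum_list_sum_nth atLeast0LessThan I_def \<gamma>_def w_def b_def)
  have W: "0 \<le> W" "W \<le> B"
    using ps by (auto simp: W_def ridge_params_def case_prod_unfold sum_list_sum_nth atLeast0LessThan I_def \<gamma>_def sum_nonneg)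
  have wb: "norm1 (w i) \<le> 1" "\<bar>b i\<bar> \<le> 1" if "i \<in> I" for i
    using ps that nth_mem[of i ps] by (auto simp: ridge_params_def I_def w_def b_def case_prod_unfold)
  show ?thesis
  proof (cases "W = 0")
    case True
    then have "\<forall>i\<in>I. \<gamma> i = 0" by (simp add: W_def sum_nonneg_eq_0_iff I_def)
    then show ?thesis by (intro that[of "[]"]) (auto simp: rs)
  next
    case False
    then have W0: "0 < W" using W by simp
    \<comment> \<open>The factor \<open>sgn (\<gamma> i) * W\<close> makes the mean equal to the
      given sum on the cube. The cutoff keeps the function bounded everywhere; as a unit is at most
      2 on the cube, the bound is \<open>2 * B\<close>.\<close>
    define \<psi> where "\<psi> i x = sgn (\<gamma> i) * W * relu (w i \<bullet> x + b i) * indicator unit_cube x" for i x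
    define m where "m = density lborel (indicator (unit_cube :: (real ^ 'd) set))"
    have m: "prob_space m"
      unfolding m_def by (rule prob_spaceI) (simp add: emeasure_density emeasure_unit_cube)
    have sm: "borel_measurable m = (borel_measurable borel :: (real ^ 'd \<Rightarrow> real) set)"
      by (simp add: m_def cong: measurable_cong_sets)
    have relu_m: "(\<lambda>x. relu (v \<bullet> x + c)) \<in> borel_measurable borel" for v :: "real ^ 'd" and c
      by (intro borel_measurable_continuous_onI continuous_on_compose2[OF relu_continuous[of UNIV]] continuous_intros) auto
    have \<psi>m: "\<psi> i \<in> borel_measurable m" for i unfolding sm \<psi>_def using relu_m by measurable
    have relu_bd: "\<bar>relu (w i \<bullet> x + b i)\<bar> \<le> 2" if "i \<in> I" "x \<in> unit_cube" for i x
    proof -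
      have "\<bar>w i \<bullet> x\<bar> \<le> 1" using inner_abs_le_norm1[of x "w i"] wb(1)[OF that(1)] that(2) by (auto simp: unit_cube_def)
      then show ?thesis using wb(2)[OF that(1)] by (auto simp: relu_def)
    qed
    have sg: "\<bar>sgn (\<gamma> i)\<bar> \<le> 1" for i by (simp add: abs_sgn_eq)
    have \<psi>b: "\<bar>\<psi> i x\<bar> \<le> 2 * B" if "i \<in> I" for i x
    proof (cases "x \<in> unit_cube")
      case True
      have "\<bar>\<psi> i x\<bar> = \<bar>sgn (\<gamma> i)\<bar> * W * \<bar>relu (w i \<bullet> x + b i)\<bar>" using True W0 by (simp add: \<psi>_def abs_mult)
      also have "\<dots> \<le> 1 * B * 2" using sg relu_bd[OF that True] W W0 by (intro mult_mono) auto
      finally show ?thesis by simp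
    qed (use B in \<open>simp add: \<psi>_def\<close>)
    define q where "q i = \<bar>\<gamma> i\<bar> / W" for i
    have q: "\<And>i. i \<in> I \<Longrightarrow> 0 \<le> q i" "(\<Sum>i\<in>I. q i) = 1"
      using W0 by (auto simp: q_def W_def simp flip: sum_divide_distrib)
    have G: "(\<Sum>i\<in>I. q i * \<psi> i x) = ridge_sum relu ps x" if "x \<in> unit_cube" for x
      unfolding rs using that W0 by (intro sum.cong refl) (simp add: q_def \<psi>_def mult.assoc[symmetric] abs_mult_sgn)
    obtain js where js: "length js = k" "set js \<subseteq> I"
      "(\<integral>x. ((\<Sum>j\<leftarrow>js. \<psi> j x) - real k * (\<Sum>i\<in>I. q i * \<psi> i x))\<^sup>2 \<partial>m) \<le> real k * (2 * B)\<^sup>2"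
      using maurey_selection[where \<psi> = \<psi> and V = "2 * B" and n = k and I = I and q = q, OF m _ q \<psi>m \<psi>b]
      by (auto simp: I_def)
    define qs where "qs = map (\<lambda>j. (sgn (\<gamma> j) * W / k, w j, b j)) js"
    have rq: "ridge_sum relu qs x = (\<Sum>j\<leftarrow>js. \<psi> j x) / k" if "x \<in> unit_cube" for x
    proof -
      have "ridge_sum relu qs x = (\<Sum>j\<leftarrow>js. (1 / k) * \<psi> j x)"
        using that by (simp add: qs_def ridge_sum_def comp_def \<psi>_def mult_ac)
      then show ?thesis unfolding sum_list_const_mult by simp
    qed
    define h where "h x = ((\<Sum>j\<leftarrow>js. \<psi> j x) - real k * (\<Sum>i\<in>I. q i * \<psi> i x)) / k" for x
    have hm: "h \<in> borel_measurable m"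
    proof -
      have "(\<lambda>x. \<Sum>j\<leftarrow>ls. \<psi> j x) \<in> borel_measurable m" for ls
        by (induction ls) (auto intro!: borel_measurable_add \<psi>m)
      then show ?thesis unfolding h_def using \<psi>m by measurable
    qed
    have hb: "\<bar>h x\<bar> \<le> 4 * B" for x
    proof -
      have "\<bar>\<Sum>j\<leftarrow>js. 1 * \<psi> j x\<bar> \<le> (\<Sum>j\<leftarrow>js. \<bar>1\<bar>) * (2 * B)"
        using js(2) \<psi>b B by (intro sum_list_weighted_le) auto
      then have 1: "\<bar>\<Sum>j\<leftarrow>js. \<psi> j x\<bar> \<le> real k * (2 * B)" by (simp add: sum_list_triv js(1))
      have "\<bar>\<Sum>i\<in>I. q i * \<psi> i x\<bar> \<le> (\<Sum>i\<in>I. q i * (2 * B))"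
        using q(1) \<psi>b by (intro order_trans[OF sum_abs] sum_mono) (auto simp: abs_mult intro!: mult_left_mono)
      also have "\<dots> = 2 * B" using q(2) by (simp flip: sum_distrib_right)
      finally have "real k * \<bar>\<Sum>i\<in>I. q i * \<psi> i x\<bar> \<le> real k * (2 * B)" by (intro mult_left_mono) auto
      then have 2: "\<bar>real k * (\<Sum>i\<in>I. q i * \<psi> i x)\<bar> \<le> real k * (2 * B)" by (simp add: abs_mult)
      have "\<bar>(\<Sum>j\<leftarrow>js. \<psi> j x) - real k * (\<Sum>i\<in>I. q i * \<psi> i x)\<bar> \<le> 4 * B * real k"
        using 1 2 by (intro order_trans[OF abs_triangle_ineq4]) (simp add: algebra_simps)
      then show ?thesis using k by (simp add: h_def abs_divide divide_le_eq)
    qed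
    have hi: "integrable m (\<lambda>x. (h x)\<^sup>2)"
    proof -
      interpret prob_space m by (rule m)
      have "\<bar>h x\<bar>\<^sup>2 \<le> (4 * B)\<^sup>2" for x using hb by (intro power_mono) auto
      then show ?thesis using hm by (intro integrable_const_bound[where B = "(4 * B)\<^sup>2"]) auto
    qed
    have "(\<integral>x. (h x)\<^sup>2 \<partial>m) = (\<integral>x. ((\<Sum>j\<leftarrow>js. \<psi> j x) - real k * (\<Sum>i\<in>I. q i * \<psi> i x))\<^sup>2 \<partial>m) / (real k)\<^sup>2"
      by (simp add: h_def power_divide)
    also have "\<dots> \<le> real k * (2 * B)\<^sup>2 / (real k)\<^sup>2" by (intro divide_right_mono js(3)) auto
    also have "\<dots> = (2 * B / sqrt k)\<^sup>2" using k by (simp add: power_divide power2_eq_square)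
    finally have hsq: "(\<integral>x. (h x)\<^sup>2 \<partial>m) \<le> (2 * B / sqrt k)\<^sup>2" .
    have hmb: "h \<in> borel_measurable borel" using hm sm by simp
    have "(\<integral>\<^sup>+ x. ennreal (\<bar>ridge_sum relu ps x - ridge_sum relu qs x\<bar> * indicator unit_cube x) \<partial>lborel)
        = (\<integral>\<^sup>+ x. indicator unit_cube x * ennreal \<bar>h x\<bar> \<partial>lborel)"
    proof (rule nn_integral_cong)
      fix x :: "real ^ 'd"
      show "ennreal (\<bar>ridge_sum relu ps x - ridge_sum relu qs x\<bar> * indicator unit_cube x) = indicator unit_cube x * ennreal \<bar>h x\<bar>"
      proof (cases "x \<in> unit_cube")
        case True
        have "h x = ridge_sum relu qs x - ridge_sum relu ps x"
          using k by (simp add: h_def rq[OF True] G[OF True] diff_divide_distrib)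
        then show ?thesis using True by (simp add: abs_minus_commute)
      qed simp
    qed
    also have "\<dots> = (\<integral>\<^sup>+ x. ennreal \<bar>h x\<bar> \<partial>m)"
      unfolding m_def using hmb by (subst nn_integral_density) auto
    also have "\<dots> \<le> ennreal (2 * B / sqrt k)"
      using B k by (intro integral_abs_le_of_square[OF m hm hi hsq]) auto
    finally have "(\<integral>\<^sup>+ x. ennreal (\<bar>ridge_sum relu ps x - ridge_sum relu qs x\<bar> * indicator unit_cube x) \<partial>lborel) \<le> \<dots>" .
    moreover have "\<forall>(\<gamma>, w, b)\<in>set qs. norm1 w \<le> 1 \<and> \<bar>b\<bar> \<le> 1 \<and> \<bar>\<gamma>\<bar> \<le> B / k"
    proof -
      have "\<bar>sgn (\<gamma> j) * W / k\<bar> \<le> B / k" for j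
        using mult_mono[OF sg[of j] W(2)] W0 by (simp add: abs_mult abs_divide divide_right_mono)
      then show ?thesis using wb js(2) by (auto simp: qs_def)
    qed
    ultimately show ?thesis using js(1) by (intro that[of qs]) (auto simp: qs_def)
  qed
qed

lemma vp_mass_power_bound: "1 / vp_mass m ^ d \<le> (real m + 1) powr (real d / 2)"
proof -
  have "(1 / vp_mass m)\<^sup>2 \<le> real m + 1"
    using vp_mass_lower[of m] vp_mass_pos[of m] by (simp add: power_divide divide_le_eq mult.commute)
  then have "1 / vp_mass m \<le> sqrt (real m + 1)" by (rule real_le_rsqrt)
  then have "(1 / vp_mass m) ^ d \<le> sqrt (real m + 1) ^ d"
    using vp_mass_pos[of m] by (intro power_mono) auto
  also have "\<dots> = (real m + 1) powr (real d / 2)"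
    by (simp add: powr_half_sqrt[symmetric] powr_realpow[symmetric] powr_powr)
  finally show ?thesis by (simp add: power_one_over)
qed

text \<open>Three errors add up: smoothing, discretization of the waves (\<open>a / sqrt k\<close>),
  and compression of a sum of total weight \<open>2 * a\<close> (\<open>4 * a / sqrt k\<close>). The
  condition on \<open>a\<close> makes the total weight, \<open>w0\<close> and \<open>b0\<close> fit
  the constraints of the network.\<close>

lemma relu_network_L1_approximation:
  fixes f :: "real ^ 'd \<Rightarrow> real"
  assumes f: "f \<in> borel_measurable borel" "\<And>x. \<bar>f x\<bar> \<le> 1" "\<And>x. x \<notin> unit_cube \<Longrightarrow> f x = 0"
    and mod: "\<And>u. (\<integral>\<^sup>+ x. ennreal \<bar>f (x + u) - f x\<bar> \<partial>lborel) \<le> ennreal (b * norm u powr s)"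
    and b: "0 \<le> b" and s: "0 < s" "s \<le> 1" and k: "0 < k"
    and a: "4 * (real CARD('d))\<^sup>2 * (real m + 1) powr (real CARD('d) / 2 + 1) \<le> a"
  obtains g where "g \<in> clipped_nets_relu k a"
    "(\<integral>\<^sup>+ x. ennreal (\<bar>f x - g x\<bar> * indicator unit_cube x) \<partial>lborel)
      \<le> ennreal (b * (1 + real CARD('d) * pi\<^sup>2 / 2) * (real m + 1) powr (- (s / 2)) + 5 * a / sqrt k)"
proof -
  let ?d = "real CARD('d)"
  \<comment> \<open>The normalization of the kernel, at most \<open>(m + 1) powr (d / 2)\<close>.
    The second moment of the frequencies supplies one more factor of order \<open>m\<close>.\<close>
  define A where "A = 1 / vp_mass m ^ CARD('d)"
  have A0: "0 < A" using vp_mass_pos[of m] by (simp add: A_def)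
  have d1: "1 \<le> ?d" by simp
  have "A * (real m + 1) \<le> (real m + 1) powr (?d / 2) * (real m + 1)"
    unfolding A_def by (intro mult_right_mono vp_mass_power_bound) auto
  also have "\<dots> = (real m + 1) powr (?d / 2 + 1)" by (simp add: powr_add)
  finally have "4 * ?d\<^sup>2 * (A * (real m + 1)) \<le> 4 * ?d\<^sup>2 * (real m + 1) powr (?d / 2 + 1)" by (intro mult_left_mono) auto
  also have "4 * ?d\<^sup>2 * (A * (real m + 1)) = 4 * (A * (?d\<^sup>2 * (real m + 1)))" by (simp only: mult_ac)
  finally have key: "4 * (A * (?d\<^sup>2 * (real m + 1))) \<le> a" using a by linarith
  have AA: "A \<le> A * (?d\<^sup>2 * (real m + 1))" "0 \<le> A * (?d\<^sup>2 * real m)"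
  proof -
    have "1 * 1 \<le> ?d\<^sup>2 * (real m + 1)" using d1 by (intro mult_mono one_le_power) auto
    then show "A \<le> A * (?d\<^sup>2 * (real m + 1))" using A0 mult_left_mono[of 1 "?d\<^sup>2 * (real m + 1)" A] by simp
  qed (use A0 in simp)
  have Am: "A * (?d\<^sup>2 * real m) \<le> A * (?d\<^sup>2 * (real m + 1))" using A0 by (intro mult_left_mono) auto
  have a0: "0 < a" using key AA A0 by linarith
  let ?L = "vp_index m :: ('d \<Rightarrow> nat) set"
  define c r where "c l = vp_weight m l / vp_mass m ^ CARD('d)" and "r l = norm1 (vp_freq m l)" for l :: "'d \<Rightarrow> nat"
  have c: "c l = A * vp_weight m l" for l by (simp add: c_def A_def)
  have c0: "0 \<le> c l" for l using A0 vp_weight_nonneg[of m l] by (simp add: c)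
  have S0: "(\<Sum>l\<in>?L. c l) = A" by (simp add: c sum_vp_weight flip: sum_distrib_left)
  have S1: "(\<Sum>l\<in>?L. c l * r l) \<le> A * (1 / 2 + ?d\<^sup>2 * real m / 4)"
    using mult_left_mono[OF sum_vp_weight_norm1[of m, where 'd = 'd], of A] A0 by (simp add: c r_def sum_distrib_left mult.assoc)
  have S2: "(\<Sum>l\<in>?L. c l * (r l)\<^sup>2) \<le> A * (?d\<^sup>2 * real m / 2)"
    using mult_left_mono[OF sum_vp_weight_norm1_square[of m, where 'd = 'd], of A] A0 by (simp add: c r_def sum_distrib_left mult.assoc)
  obtain C D :: "('d \<Rightarrow> nat) \<Rightarrow> real" where CD: "\<And>l. \<bar>C l\<bar> \<le> 1" "\<And>l. \<bar>D l\<bar> \<le> 1"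
    and rep0: "\<And>x. x \<in> unit_cube \<Longrightarrow> vp_smooth m f x = (\<Sum>l\<in>?L. vp_weight m l / vp_mass m ^ CARD('d) *
        (C l * cos (vp_freq m l \<bullet> x) + D l * sin (vp_freq m l \<bullet> x)))"
    using vp_smooth_ridge[OF f, where m = m] by blast
  note rep = rep0[folded c_def]
  define w where "w l = (1 / r l) *\<^sub>R vp_freq m l" for l :: "'d \<Rightarrow> nat"
  have r0: "0 \<le> r l" for l by (simp add: r_def norm1_nonneg)
  have w1: "norm1 (w l) \<le> 1" for l using r0[of l] by (simp add: w_def norm1_scale r_def divide_le_eq_1)
  have rw: "r l * (w l \<bullet> x) = vp_freq m l \<bullet> x" for l x
  proof (cases "r l = 0")
    case True
    then have "vp_freq m l = 0" by (simp add: r_def norm1_eq_0_iff)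
    then show ?thesis by (simp add: True)
  qed (simp add: w_def)
  have bnd: "\<bar>c l * C l\<bar> \<le> c l" "\<bar>c l * D l\<bar> \<le> c l" for l
    using CD[of l] c0[of l] by (simp_all add: abs_mult mult_left_le)
  \<comment> \<open>A finer discretization adds units but no total weight, and compression forgets
    the number of units. So the error of each wave can be as small as the number of waves
    demands.\<close>
  define \<epsilon> where "\<epsilon> = a / sqrt k / (real (card ?L) + 1)"
  have \<epsilon>: "0 < \<epsilon>" "real (card ?L) * \<epsilon> \<le> a / sqrt k"
  proof -
    have "real (card ?L) * \<epsilon> \<le> (real (card ?L) + 1) * \<epsilon>" using a0 by (intro mult_right_mono) (auto simp: \<epsilon>_def)
    then show "real (card ?L) * \<epsilon> \<le> a / sqrt k" by (simp add: \<epsilon>_def add_nonneg_eq_0_iff)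
  qed (use a0 k in \<open>simp add: \<epsilon>_def\<close>)
  obtain ps w0 b0 where ps: "ridge_params (\<Sum>l\<in>?L. 4 * (c l * (r l)\<^sup>2)) ps" and w0: "norm1 w0 \<le> (\<Sum>l\<in>?L. 2 * (c l * r l))"
    and b0: "\<bar>b0\<bar> \<le> (\<Sum>l\<in>?L. 2 * c l + 2 * (c l * r l))"
    and app: "\<And>x. x\<in>unit_cube \<Longrightarrow> \<bar>(\<Sum>l\<in>?L. c l * C l * cos (r l * (w l \<bullet> x)) + c l * D l * sin (r l * (w l \<bullet> x)))
        - (ridge_sum relu ps x + w0 \<bullet> x + b0)\<bar> \<le> real (card ?L) * \<epsilon>"
    using ridge_sum_relu_approximation[where L = "?L" and w = w and c = c and r = r and \<alpha> = "\<lambda>l. c l * C l" and \<beta> = "\<lambda>l. c l * D l",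
        OF finite_vp_index w1 bnd r0 \<epsilon>(1)] by blast
  have w0a: "norm1 w0 \<le> a"
  proof -
    have "(\<Sum>l\<in>?L. 2 * (c l * r l)) = 2 * (\<Sum>l\<in>?L. c l * r l)" by (simp add: sum_distrib_left)
    also have "\<dots> \<le> A + A * (?d\<^sup>2 * real m) / 2" using S1 by (simp add: algebra_simps)
    finally show ?thesis using w0 key AA Am by linarith
  qed
  have b0a: "\<bar>b0\<bar> \<le> a"
  proof -
    have "(\<Sum>l\<in>?L. 2 * c l + 2 * (c l * r l)) = 2 * A + 2 * (\<Sum>l\<in>?L. c l * r l)"
      by (simp add: sum.distrib S0[symmetric] sum_distrib_left)
    also have "\<dots> \<le> 3 * A + A * (?d\<^sup>2 * real m) / 2" using S1 by (simp add: algebra_simps)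
    finally show ?thesis using b0 key AA Am by linarith
  qed
  have "(\<Sum>l\<in>?L. 4 * (c l * (r l)\<^sup>2)) = 4 * (\<Sum>l\<in>?L. c l * (r l)\<^sup>2)" by (simp add: sum_distrib_left)
  also have "\<dots> \<le> 2 * a" using S2 key AA Am by linarith
  finally have "ridge_params (2 * a) ps" using ps by (auto simp: ridge_params_def)
  then obtain qs where qs: "length qs \<le> k" "\<forall>(\<gamma>, w, b)\<in>set qs. norm1 w \<le> 1 \<and> \<bar>b\<bar> \<le> 1 \<and> \<bar>\<gamma>\<bar> \<le> 2 * a / k"
    and comp: "(\<integral>\<^sup>+ x. ennreal (\<bar>ridge_sum relu ps x - ridge_sum relu qs x\<bar> * indicator unit_cube x) \<partial>lborel) \<le> ennreal (2 * (2 * a) / sqrt k)"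
    using ridge_sum_compression[of "2 * a" ps k] a0 k by auto
  define h where "h x = ridge_sum relu qs x + w0 \<bullet> x + b0" for x
  have "h \<in> nets k 1 (2 * a / k) a a relu"
    unfolding h_def using qs a0 w0a b0a by (intro ridge_sum_affine_in_nets) auto
  then have g: "(\<lambda>x. clip (h x)) \<in> clipped_nets_relu k a"
    unfolding clipped_nets_relu_def clipped_nets_eq by blast
  have rsm: "ridge_sum relu zs \<in> borel_measurable borel" for zs :: "(real \<times> (real ^ 'd) \<times> real) list"
    by (intro borel_measurable_continuous_onI ridge_sum_continuous relu_continuous)
  have point: "\<bar>f x - clip (h x)\<bar> * indicator unit_cube x \<le> \<bar>vp_smooth m f x - f x\<bar>
      + a / sqrt k * indicator unit_cube x + \<bar>ridge_sum relu ps x - ridge_sum relu qs x\<bar> * indicator unit_cube x" for x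
  proof (cases "x \<in> unit_cube")
    case True
    have "vp_smooth m f x = (\<Sum>l\<in>?L. c l * C l * cos (r l * (w l \<bullet> x)) + c l * D l * sin (r l * (w l \<bullet> x)))"
      unfolding rep[OF True] rw by (simp add: distrib_left mult.assoc)
    then have "\<bar>vp_smooth m f x - (ridge_sum relu ps x + w0 \<bullet> x + b0)\<bar> \<le> a / sqrt k"
      using app[OF True] \<epsilon>(2) by linarith
    then have "\<bar>vp_smooth m f x - h x\<bar> \<le> a / sqrt k + \<bar>ridge_sum relu ps x - ridge_sum relu qs x\<bar>"
      unfolding h_def by linarith
    \<comment> \<open>The smoothed function is bounded by 1 like \<open>f\<close>, hence fixed by
      clipping.\<close>
    moreover have "\<bar>vp_smooth m f x - clip (h x)\<bar> \<le> \<bar>vp_smooth m f x - h x\<bar>"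
      using clip_lipschitz[of "vp_smooth m f x" "h x"] clip_id[OF vp_smooth_bound[OF f(1,2)]] by simp
    ultimately show ?thesis using True by simp
  qed simp
  note [measurable] = f(1)
  have vm[measurable]: "vp_smooth m f \<in> borel_measurable borel"
    unfolding vp_smooth_def by measurable
  note [measurable] = rsm[of ps] rsm[of qs]
  have "(\<integral>\<^sup>+ x. ennreal (\<bar>f x - clip (h x)\<bar> * indicator unit_cube x) \<partial>lborel)
      \<le> (\<integral>\<^sup>+ x. ennreal \<bar>vp_smooth m f x - f x\<bar> + ennreal (a / sqrt k) * indicator unit_cube x
          + ennreal (\<bar>ridge_sum relu ps x - ridge_sum relu qs x\<bar> * indicator unit_cube x) \<partial>lborel)"
  proof (rule nn_integral_mono)
    fix x
    have "ennreal (\<bar>f x - clip (h x)\<bar> * indicator unit_cube x) \<le> ennreal (\<bar>vp_smooth m f x - f x\<bar>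
      + a / sqrt k * indicator unit_cube x + \<bar>ridge_sum relu ps x - ridge_sum relu qs x\<bar> * indicator unit_cube x)"
      by (rule ennreal_leI[OF point])
    also have "\<dots> = ennreal \<bar>vp_smooth m f x - f x\<bar> + ennreal (a / sqrt k) * indicator unit_cube x
          + ennreal (\<bar>ridge_sum relu ps x - ridge_sum relu qs x\<bar> * indicator unit_cube x)"
      using a0 by (simp add: indicator_def)
    finally show "ennreal (\<bar>f x - clip (h x)\<bar> * indicator unit_cube x) \<le> \<dots>" .
  qed
  also have "\<dots> = (\<integral>\<^sup>+ x. ennreal \<bar>vp_smooth m f x - f x\<bar> \<partial>lborel) + ennreal (a / sqrt k)
      + (\<integral>\<^sup>+ x. ennreal (\<bar>ridge_sum relu ps x - ridge_sum relu qs x\<bar> * indicator unit_cube x) \<partial>lborel)"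
    by (simp add: nn_integral_add nn_integral_cmult_indicator emeasure_unit_cube)
  also have "\<dots> \<le> ennreal (b * (1 + ?d * pi\<^sup>2 / 2) * (real m + 1) powr (- (s / 2))) + ennreal (a / sqrt k) + ennreal (2 * (2 * a) / sqrt k)"
    by (intro add_mono vp_smooth_L1_error f mod b s comp order_refl)
  also have "\<dots> = ennreal (b * (1 + ?d * pi\<^sup>2 / 2) * (real m + 1) powr (- (s / 2)) + 5 * a / sqrt k)"
    using a0 b by (simp flip: ennreal_plus)
  finally show ?thesis by (rule that[OF g])
qed

section \<open>The constants and the rate\<close>

lemma set_sup_norm_unit_cube: "set_sup_norm (unit_cube :: (real ^ 'd) set) = 1"
proof -
  have le: "infnorm x \<le> 1" if "x \<in> unit_cube" for x :: "real ^ 'd"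
    using that unfolding infnorm_Max Basis_vec_real by (auto simp: unit_cube_def inner_axis)
  have "(\<chi> i. 1) \<in> (unit_cube :: (real ^ 'd) set)" by (simp add: unit_cube_def)
  moreover have "1 \<le> infnorm ((\<chi> i. 1) :: real ^ 'd)"
    using component_le_infnorm_cart[of "(\<chi> i. 1) :: real ^ 'd" undefined] by simp
  ultimately show ?thesis
    unfolding set_sup_norm_def using le by (intro cSup_eq_maximum) (force intro!: antisym)+
qed

definition gauss_moment :: "'d::finite itself \<Rightarrow> real" where
  "gauss_moment _ = (\<integral>\<omega>. (norm (\<omega> :: real ^ 'd))\<^sup>2 * exp (- ((norm \<omega>)\<^sup>2 / 2)) \<partial>lborel)"

text \<open>Guards against the default value 0 of a divergent Bochner integral. The positive value
  of the moment gives \<open>c_tilde\<close> its lower bound.\<close>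

lemma gauss_moment_integrable:
  "integrable lborel (\<lambda>\<omega> :: real ^ 'd. (norm \<omega>)\<^sup>2 * exp (- ((norm \<omega>)\<^sup>2 / 2)))"
proof -
  let ?f = "\<lambda>j i u :: real. (if i = j then u\<^sup>2 else 1) * exp (- (u\<^sup>2 / 2))"
  have fin: "\<exists>r. 0 \<le> r \<and> (\<integral>\<^sup>+ u. ennreal (?f j i u) \<partial>lborel) = ennreal r" for i j :: 'd
  proof -
    define k :: nat where "k = (if i = j then 2 else 0)"
    have f: "?f j i u = sqrt (2 * pi) * (std_normal_density u * u ^ k)" for u
      by (simp add: normal_density_def k_def)
    have "integrable lborel (?f j i)"
      unfolding f by (intro integrable_mult_right integrable_std_normal_moment)
    then have "(\<integral>\<^sup>+ u. ennreal (?f j i u) \<partial>lborel) = ennreal (\<integral>u. ?f j i u \<partial>lborel)"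
      by (rule nn_integral_eq_integral) simp
    then show ?thesis by (intro exI[of _ "\<integral>u. ?f j i u \<partial>lborel"]) simp
  qed
  then obtain r where r: "\<And>i j :: 'd. 0 \<le> r i j" "\<And>i j :: 'd. (\<integral>\<^sup>+ u. ennreal (?f j i u) \<partial>lborel) = ennreal (r i j)"
    by metis
  have "(\<integral>\<^sup>+ (\<omega> :: real ^ 'd). ennreal ((norm \<omega>)\<^sup>2 * exp (- ((norm \<omega>)\<^sup>2 / 2))) \<partial>lborel)
      = (\<integral>\<^sup>+ (\<omega> :: real ^ 'd). (\<Sum>j\<in>UNIV. \<Prod>i\<in>UNIV. ennreal (?f j i (\<omega> $ i))) \<partial>lborel)"
  proof (rule nn_integral_cong)
    fix \<omega> :: "real ^ 'd"
    have n: "(norm \<omega>)\<^sup>2 = (\<Sum>j\<in>UNIV. (\<omega> $ j)\<^sup>2)" by (simp add: norm_vec_def L2_set_def sum_nonneg)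
    have e: "exp (- ((norm \<omega>)\<^sup>2 / 2)) = (\<Prod>i\<in>UNIV. exp (- ((\<omega> $ i)\<^sup>2 / 2)))"
      by (simp add: n exp_sum[symmetric] sum_divide_distrib sum_negf)
    have "(norm \<omega>)\<^sup>2 * exp (- ((norm \<omega>)\<^sup>2 / 2)) = (\<Sum>j\<in>UNIV. (\<omega> $ j)\<^sup>2 * exp (- ((norm \<omega>)\<^sup>2 / 2)))"
      by (simp add: n sum_distrib_right)
    also have "\<dots> = (\<Sum>j\<in>UNIV. \<Prod>i\<in>UNIV. ?f j i (\<omega> $ i))"
      unfolding e by (simp add: prod.distrib)
    finally show "ennreal ((norm \<omega>)\<^sup>2 * exp (- ((norm \<omega>)\<^sup>2 / 2))) = (\<Sum>j\<in>UNIV. \<Prod>i\<in>UNIV. ennreal (?f j i (\<omega> $ i)))"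
      by (simp add: prod_ennreal sum_ennreal prod_nonneg)
  qed
  also have "\<dots> = (\<Sum>j\<in>(UNIV :: 'd set). \<integral>\<^sup>+ (\<omega> :: real ^ 'd). (\<Prod>i\<in>UNIV. ennreal (?f j i (\<omega> $ i))) \<partial>lborel)"
    by (intro nn_integral_sum) simp
  also have "\<dots> = (\<Sum>j\<in>(UNIV :: 'd set). \<Prod>i\<in>(UNIV :: 'd set). \<integral>\<^sup>+ u. ennreal (?f j i u) \<partial>lborel)"
    by (intro sum.cong refl nn_integral_lborel_vec_prod) simp
  also have "\<dots> = ennreal (\<Sum>j\<in>(UNIV :: 'd set). \<Prod>i\<in>(UNIV :: 'd set). r i j)"
    unfolding r(2) using r(1) by (simp add: prod_ennreal sum_ennreal prod_nonneg)
  finally show ?thesis by (intro integrableI_nonneg) auto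
qed

lemma gauss_moment_pos: "0 < gauss_moment TYPE('d::finite)"
proof -
  let ?f = "\<lambda>\<omega> :: real ^ 'd. (norm \<omega>)\<^sup>2 * exp (- ((norm \<omega>)\<^sup>2 / 2))"
  have "gauss_moment TYPE('d) \<noteq> 0"
  proof
    assume "gauss_moment TYPE('d) = 0"
    then have "AE \<omega> in lborel. ?f \<omega> = 0"
      using integral_nonneg_eq_0_iff_AE[OF gauss_moment_integrable[where 'd = 'd]] by (simp add: gauss_moment_def)
    then have "AE \<omega> in (lborel :: (real ^ 'd) measure). False"
      using AE_lborel_singleton[of "0 :: real ^ 'd"] by eventually_elim simp
    then show False by (simp add: trivial_limit_def[symmetric] ae_filter_eq_bot_iff)
  qed
  moreover have "0 \<le> gauss_moment TYPE('d)" unfolding gauss_moment_def by (intro integral_nonneg_AE) simp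
  ultimately show ?thesis by linarith
qed

text \<open>Substitution \<open>\<omega> = x / t\<close>: \<open>CARD('d)\<close> powers of
  \<open>1 / t\<close> come from the volume and two from the squared norm.\<close>

lemma gauss_moment_scale:
  assumes t: "0 < t"
  shows "(\<integral>\<omega>. (norm (\<omega> :: real ^ 'd))\<^sup>2 * exp (- (t\<^sup>2 * (norm \<omega>)\<^sup>2 / 2)) \<partial>lborel)
    = (1 / t) ^ (CARD('d) + 2) * gauss_moment TYPE('d)"
proof -
  let ?g = "\<lambda>\<omega> :: real ^ 'd. (norm \<omega>)\<^sup>2 * exp (- (t\<^sup>2 * (norm \<omega>)\<^sup>2 / 2))"
  have "1 / t \<noteq> 0" using t by simp
  from lborel_affine[OF this, of "0 :: real ^ 'd"]
  have "(\<integral>\<omega>. ?g \<omega> \<partial>lborel) = (\<integral>\<omega>. ?g \<omega> \<partial>density (distr lborel borel (\<lambda>x :: real ^ 'd. 0 + (1 / t) *\<^sub>R x)) (\<lambda>_. ennreal (\<bar>1 / t\<bar> ^ DIM(real ^ 'd))))"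
    by (rule arg_cong)
  also have "\<dots> = (\<integral>\<omega>. \<bar>1 / t\<bar> ^ DIM(real ^ 'd) * ?g \<omega> \<partial>distr lborel borel (\<lambda>x :: real ^ 'd. 0 + (1 / t) *\<^sub>R x))"
    by (subst integral_density) auto
  also have "\<dots> = (\<integral>x. \<bar>1 / t\<bar> ^ DIM(real ^ 'd) * ?g (0 + (1 / t) *\<^sub>R x) \<partial>lborel)"
    by (subst integral_distr) auto
  also have "\<dots> = (\<integral>x. (1 / t) ^ (CARD('d) + 2) * ((norm (x :: real ^ 'd))\<^sup>2 * exp (- ((norm x)\<^sup>2 / 2))) \<partial>lborel)"
    using t by (intro Bochner_Integration.integral_cong refl) (simp add: power_divide power_add power2_eq_square)
  also have "\<dots> = (1 / t) ^ (CARD('d) + 2) * gauss_moment TYPE('d)"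
    by (simp add: gauss_moment_def)
  finally show ?thesis .
qed

text \<open>Both suprema in the norm are tested at \<open>t = norm u\<close> and at the shift
  \<open>u\<close> itself.\<close>

lemma Lip1_norm_modulus:
  fixes f :: "real ^ 'd \<Rightarrow> real"
  assumes "Lip1_norm s f \<le> ennreal b" "0 \<le> b"
  shows "(\<integral>\<^sup>+ x. ennreal \<bar>f (x + u) - f x\<bar> \<partial>lborel) \<le> ennreal (b * norm u powr s)"
proof (cases "u = 0")
  case False
  let ?I = "\<integral>\<^sup>+ x. ennreal \<bar>f (x + u) - f x\<bar> \<partial>lborel"
  let ?t = "norm u"
  have t: "0 < ?t" using False by simp
  have "?I \<le> L1_modulus f ?t" unfolding L1_modulus_def by (rule SUP_upper) simp
  then have "ennreal (?t powr (- s)) * ?I \<le> ennreal (?t powr (- s)) * L1_modulus f ?t" by (rule mult_left_mono) simp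
  also have "\<dots> \<le> (SUP t\<in>{0<..}. ennreal (t powr (- s)) * L1_modulus f t)" using t by (intro SUP_upper) simp
  also have "\<dots> \<le> ennreal b" using assms(1) unfolding Lip1_norm_def by (rule order_trans[rotated]) (simp add: add_increasing)
  finally have "ennreal (?t powr s) * (ennreal (?t powr (- s)) * ?I) \<le> ennreal (?t powr s) * ennreal b" by (rule mult_left_mono) simp
  moreover have "ennreal (?t powr s) * (ennreal (?t powr (- s)) * ?I) = ?I"
    using t by (simp add: mult.assoc[symmetric] powr_minus flip: ennreal_mult)
  ultimately show ?thesis using assms(2) by (simp add: mult.commute flip: ennreal_mult)
qed simp

lemma tv_pairs_density:
  fixes \<mu> \<nu> :: "(real ^ 'd) measure"
  assumes "(\<mu>, \<nu>) \<in> tv_pairs M unit_cube"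
  shows "prob_measure_on unit_cube \<mu>" "prob_measure_on unit_cube \<nu>"
    "density lborel (RN_deriv lborel \<mu>) = \<mu>" "density lborel (RN_deriv lborel \<nu>) = \<nu>"
    "AE x in lborel. x \<in> unit_cube \<longrightarrow> RN_deriv lborel \<mu> x \<le> ennreal M \<and> RN_deriv lborel \<nu> x \<le> ennreal M"
proof -
  show ps: "prob_measure_on unit_cube \<mu>" "prob_measure_on unit_cube \<nu>"
    using assms by (auto simp: tv_pairs_def)
  then have st: "sets \<mu> = sets lborel" "sets \<nu> = sets lborel" by (auto simp: prob_measure_on_def)
  show "density lborel (RN_deriv lborel \<mu>) = \<mu>" "density lborel (RN_deriv lborel \<nu>) = \<nu>"
    using assms st by (auto simp: tv_pairs_def intro!: sigma_finite_measure.density_RN_deriv[OF sigma_finite_lborel])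
  have "AE x in restrict_space lborel unit_cube. max (RN_deriv lborel \<mu> x) (RN_deriv lborel \<nu> x)
      \<le> esssup (restrict_space lborel unit_cube) (\<lambda>x. max (RN_deriv lborel \<mu> x) (RN_deriv lborel \<nu> x))"
    by (rule esssup_AE)
  moreover have "esssup (restrict_space lborel unit_cube) (\<lambda>x. max (RN_deriv lborel \<mu> x) (RN_deriv lborel \<nu> x)) \<le> ennreal M"
    using assms by (auto simp: tv_pairs_def)
  ultimately have "AE x in restrict_space lborel unit_cube. max (RN_deriv lborel \<mu> x) (RN_deriv lborel \<nu> x) \<le> ennreal M"
    by (auto elim: eventually_mono)
  then have "AE x in lborel. x \<in> unit_cube \<longrightarrow> max (RN_deriv lborel \<mu> x) (RN_deriv lborel \<nu> x) \<le> ennreal M"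
    by (subst (asm) AE_restrict_space_iff) auto
  then show "AE x in lborel. x \<in> unit_cube \<longrightarrow> RN_deriv lborel \<mu> x \<le> ennreal M \<and> RN_deriv lborel \<nu> x \<le> ennreal M"
    by (auto elim: eventually_mono)
qed

lemma nn_integral_density_bound:
  fixes p :: "real ^ 'd \<Rightarrow> ennreal"
  assumes p: "p \<in> borel_measurable lborel" and bd: "AE x in lborel. x \<in> unit_cube \<longrightarrow> p x \<le> ennreal M"
    and h: "h \<in> borel_measurable borel" and S: "S \<in> sets borel" "S \<subseteq> unit_cube"
  shows "(\<integral>\<^sup>+ x. h x * indicator S x \<partial>density lborel p) \<le> ennreal M * (\<integral>\<^sup>+ x. h x * indicator S x \<partial>lborel)"
proof -
  note [measurable] = h S(1) p
  have "(\<integral>\<^sup>+ x. h x * indicator S x \<partial>density lborel p) = (\<integral>\<^sup>+ x. p x * (h x * indicator S x) \<partial>lborel)"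
    by (rule nn_integral_density) measurable
  also have "\<dots> \<le> (\<integral>\<^sup>+ x. ennreal M * (h x * indicator S x) \<partial>lborel)"
    using bd by (intro nn_integral_mono_AE, eventually_elim) (use S(2) in \<open>auto simp: indicator_def intro!: mult_right_mono\<close>)
  also have "\<dots> = ennreal M * (\<integral>\<^sup>+ x. h x * indicator S x \<partial>lborel)"
    by (rule nn_integral_cmult) measurable
  finally show ?thesis .
qed

text \<open>A density bounded by \<open>M\<close> has mass at most \<open>M\<close> on a set of
  volume 1. For smaller \<open>M\<close> the supremum in (ii) is over an empty set; otherwise the
  leading term of \<open>c_tilde\<close> is positive.\<close>

lemma tv_pairs_one_le:
  fixes \<mu> \<nu> :: "(real ^ 'd) measure"
  assumes "(\<mu>, \<nu>) \<in> tv_pairs M unit_cube" "0 \<le> M"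
  shows "1 \<le> M"
proof -
  note D = tv_pairs_density[OF assms(1)]
  have pm: "RN_deriv lborel \<mu> \<in> borel_measurable lborel" by simp
  have bd: "AE x in lborel. x \<in> unit_cube \<longrightarrow> RN_deriv lborel \<mu> x \<le> ennreal M"
    using D(5) by (auto elim: eventually_mono)
  interpret prob_space \<mu> using D(1) by (simp add: prob_measure_on_def)
  have su: "unit_cube \<in> sets \<mu>" using D(1) unit_cube_sets by (simp add: prob_measure_on_def)
  have "1 = emeasure \<mu> unit_cube" using D(1) by (simp add: prob_measure_on_def emeasure_eq_measure)
  also have "\<dots> = (\<integral>\<^sup>+ x. 1 * indicator unit_cube x \<partial>\<mu>)" using su by simp
  also have "\<dots> \<le> ennreal M * (\<integral>\<^sup>+ (x :: real ^ 'd). 1 * indicator unit_cube x \<partial>lborel)"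
    using nn_integral_density_bound[OF pm bd, of "\<lambda>_. 1" unit_cube] unfolding D(3) by simp
  also have "\<dots> = ennreal M" by (simp add: emeasure_unit_cube)
  finally show ?thesis using assms(2) by (simp flip: ennreal_1)
qed

text \<open>The function \<open>f_tv\<close> is the sign function of a Hahn set \<open>Y\<close>. In
  the split of the two integrals the excess under \<open>\<mu>\<close> and the deficit under
  \<open>\<nu>\<close> help, so only the deficit \<open>a\<close> on \<open>Y\<close> under
  \<open>\<mu>\<close> and the excess \<open>b\<close> off \<open>Y\<close> under
  \<open>\<nu>\<close> are lost. They live on disjoint sets, which gives \<open>M * E\<close>
  without a factor 2.\<close>

lemma tv_pairs_gap:
  fixes \<mu> \<nu> :: "(real ^ 'd) measure" and g :: "real ^ 'd \<Rightarrow> real"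
  assumes pair: "(\<mu>, \<nu>) \<in> tv_pairs M unit_cube" and M: "0 \<le> M"
    and g: "g \<in> borel_measurable borel" "\<And>x. \<bar>g x\<bar> \<le> 1"
    and E: "(\<integral>\<^sup>+ x. ennreal (\<bar>f_tv unit_cube \<mu> \<nu> x - g x\<bar> * indicator unit_cube x) \<partial>lborel) \<le> ennreal E" "0 \<le> E"
  shows "tv_dist unit_cube \<mu> \<nu> - M * E \<le> (\<integral>x. g x \<partial>\<mu>) - (\<integral>x. g x \<partial>\<nu>)"
proof -
  note D = tv_pairs_density[OF pair]
  define p q where "p = RN_deriv lborel \<mu>" and "q = RN_deriv lborel \<nu>"
  have pq[measurable]: "p \<in> borel_measurable lborel" "q \<in> borel_measurable lborel" by (simp_all add: p_def q_def)
  have dp: "density lborel p = \<mu>" and dq: "density lborel q = \<nu>" using D(3,4) by (simp_all add: p_def q_def)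
  have bd: "AE x in lborel. x \<in> unit_cube \<longrightarrow> p x \<le> ennreal M" "AE x in lborel. x \<in> unit_cube \<longrightarrow> q x \<le> ennreal M"
    using D(5) by (auto simp: p_def q_def elim: eventually_mono)
  have st: "sets \<mu> = sets borel" "sets \<nu> = sets borel" and ps: "prob_space \<mu>" "prob_space \<nu>"
    using D(1,2) by (auto simp: prob_measure_on_def)
  have sp: "space \<mu> = UNIV" "space \<nu> = UNIV" using st[THEN sets_eq_imp_space_eq] by auto
  interpret Mu: prob_space \<mu> by fact
  interpret Nu: prob_space \<nu> by fact
  \<comment> \<open>Off the cube both measures vanish, so \<open>Y\<close> can be cut to the cube
    and still be a Hahn set.\<close>
  define Y where "Y = {x \<in> unit_cube. q x \<le> p x}"
  have Ym[measurable]: "Y \<in> sets borel"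
  proof -
    have "{x \<in> space lborel. q x \<le> p x} \<in> sets lborel" by measurable
    moreover have "Y = unit_cube \<inter> {x \<in> space lborel. q x \<le> p x}" by (auto simp: Y_def)
    ultimately show ?thesis by simp
  qed
  define X :: "(real ^ 'd) set" where "X = unit_cube - Y"
  have Xm[measurable]: "X \<in> sets borel" by (simp add: X_def)
  have YX: "Y \<subseteq> unit_cube" "X \<subseteq> unit_cube" by (auto simp: Y_def X_def)
  have em: "emeasure \<mu> A = (\<integral>\<^sup>+ x. p x * indicator A x \<partial>lborel)" "emeasure \<nu> A = (\<integral>\<^sup>+ x. q x * indicator A x \<partial>lborel)"
    if "A \<in> sets borel" for A
    unfolding dp[symmetric] dq[symmetric] using that by (auto simp: emeasure_density)
  have hahn: "hahn_set \<mu> \<nu> Y"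
    unfolding hahn_set_def
  proof (intro conjI ballI impI)
    show "Y \<in> sets \<mu>" using st by simp
    show "emeasure \<nu> A \<le> emeasure \<mu> A" if "A \<in> sets \<mu>" "A \<subseteq> Y" for A
    proof -
      have "(\<integral>\<^sup>+ x. q x * indicator A x \<partial>lborel) \<le> (\<integral>\<^sup>+ x. p x * indicator A x \<partial>lborel)"
        using that(2) by (intro nn_integral_mono) (auto simp: indicator_def Y_def)
      then show ?thesis using em[of A] that st by simp
    qed
    show "emeasure \<mu> A \<le> emeasure \<nu> A" if "A \<in> sets \<mu>" "A \<inter> Y = {}" for A
    proof -
      have A: "A \<in> sets borel" using that st by simp
      have "emeasure \<mu> A = emeasure \<mu> (A \<inter> unit_cube)"
        using prob_measure_on_AE(1)[OF D(1)] A st by (intro emeasure_eq_AE) auto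
      also have "\<dots> = (\<integral>\<^sup>+ x. p x * indicator (A \<inter> unit_cube) x \<partial>lborel)" using A by (intro em) auto
      also have "\<dots> \<le> (\<integral>\<^sup>+ x. q x * indicator A x \<partial>lborel)"
        using that(2) by (intro nn_integral_mono) (auto simp: indicator_def Y_def)
      finally show ?thesis using em(2)[OF A] by simp
    qed
  qed
  have gm: "g \<in> borel_measurable \<mu>" "g \<in> borel_measurable \<nu>" using g(1) st by (simp_all cong: measurable_cong_sets)
  note [measurable] = g(1)
  have gi: "0 \<le> 1 - g x" "1 - g x \<le> 2" "0 \<le> 1 + g x" "1 + g x \<le> 2" for x using g(2)[of x] by linarith+
  define a where "a = (\<integral>x. (1 - g x) * indicator Y x \<partial>\<mu>)"
  define b where "b = (\<integral>x. (1 + g x) * indicator (space \<nu> - Y) x \<partial>\<nu>)"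
  have pos: "0 \<le> (\<integral>x. (1 + g x) * indicator (space \<mu> - Y) x \<partial>\<mu>)" "0 \<le> (\<integral>x. (1 - g x) * indicator Y x \<partial>\<nu>)"
    "0 \<le> a" "0 \<le> b"
    unfolding a_def b_def using gi by (auto intro!: integral_nonneg_AE)
  have f: "f_tv unit_cube \<mu> \<nu> x = indicator Y x - indicator X x" for x
    by (simp add: f_tv_def Let_def Y_def X_def p_def q_def)
  have "ennreal a = (\<integral>\<^sup>+ x. ennreal (1 - g x) * indicator Y x \<partial>\<mu>)"
  proof -
    have "integrable \<mu> (\<lambda>x. (1 - g x) * indicator Y x)"
      by (rule Mu.integrable_const_bound[where B = 2]) (use gi gm st in \<open>auto simp: indicator_def\<close>)
    then show ?thesis unfolding a_def using gi
      by (subst nn_integral_eq_integral[symmetric]) (auto simp: ennreal_mult' ennreal_indicator)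
  qed
  also have "\<dots> \<le> ennreal M * (\<integral>\<^sup>+ x. ennreal (1 - g x) * indicator Y x \<partial>lborel)"
    using nn_integral_density_bound[OF pq(1) bd(1) _ Ym YX(1), of "\<lambda>x. ennreal (1 - g x)"] dp by simp
  finally have a: "ennreal a \<le> \<dots>" .
  have "ennreal b = (\<integral>\<^sup>+ x. ennreal (1 + g x) * indicator X x \<partial>\<nu>)"
  proof -
    have i: "integrable \<nu> (\<lambda>x. (1 + g x) * indicator X x)"
      by (rule Nu.integrable_const_bound[where B = 2]) (use gi gm st in \<open>auto simp: indicator_def\<close>)
    have "b = (\<integral>x. (1 + g x) * indicator X x \<partial>\<nu>)"
      unfolding b_def
    proof (rule integral_cong_AE)
      show "AE x in \<nu>. (1 + g x) * indicator (space \<nu> - Y) x = (1 + g x) * indicator X x"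
        using prob_measure_on_AE(1)[OF D(2)] by eventually_elim (auto simp: X_def indicator_def sp)
      show "(\<lambda>x. (1 + g x) * indicator (space \<nu> - Y) x) \<in> borel_measurable \<nu>" using gm(2) st by measurable
      show "(\<lambda>x. (1 + g x) * indicator X x) \<in> borel_measurable \<nu>" using i by simp
    qed
    then show ?thesis using gi i
      by (subst nn_integral_eq_integral[symmetric, OF i, THEN subst, of "\<lambda>z. ennreal b = z"])
         (auto simp: ennreal_mult' ennreal_indicator nn_integral_eq_integral[OF i, symmetric] intro!: nn_integral_cong)
  qed
  also have "\<dots> \<le> ennreal M * (\<integral>\<^sup>+ x. ennreal (1 + g x) * indicator X x \<partial>lborel)"
    using nn_integral_density_bound[OF pq(2) bd(2) _ Xm YX(2), of "\<lambda>x. ennreal (1 + g x)"] dq by simp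
  finally have b: "ennreal b \<le> \<dots>" .
  have "ennreal (a + b) = ennreal a + ennreal b" using pos by simp
  also have "\<dots> \<le> ennreal M * (\<integral>\<^sup>+ x. ennreal (1 - g x) * indicator Y x \<partial>lborel) + ennreal M * (\<integral>\<^sup>+ x. ennreal (1 + g x) * indicator X x \<partial>lborel)"
    by (intro add_mono a b)
  also have "\<dots> = ennreal M * (\<integral>\<^sup>+ x. ennreal (1 - g x) * indicator Y x + ennreal (1 + g x) * indicator X x \<partial>lborel)"
    by (simp add: distrib_left nn_integral_add)
  also have "(\<integral>\<^sup>+ x. ennreal (1 - g x) * indicator Y x + ennreal (1 + g x) * indicator X x \<partial>lborel)
      = (\<integral>\<^sup>+ x. ennreal (\<bar>f_tv unit_cube \<mu> \<nu> x - g x\<bar> * indicator unit_cube x) \<partial>lborel)"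
  proof (rule nn_integral_cong)
    fix x
    show "ennreal (1 - g x) * indicator Y x + ennreal (1 + g x) * indicator X x = ennreal (\<bar>f_tv unit_cube \<mu> \<nu> x - g x\<bar> * indicator unit_cube x)"
      using gi[of x] YX unfolding f by (auto simp: X_def indicator_def abs_if)
  qed
  also have "ennreal M * \<dots> \<le> ennreal M * ennreal E" by (intro mult_left_mono E) auto
  also have "\<dots> = ennreal (M * E)" using M E(2) by (simp add: ennreal_mult)
  finally have ab: "a + b \<le> M * E" using M E(2) by simp
  have "(\<integral>x. g x \<partial>\<mu>) = 2 * measure \<mu> Y - 1 - a + (\<integral>x. (1 + g x) * indicator (space \<mu> - Y) x \<partial>\<mu>)"
    unfolding a_def using Ym st by (intro integral_split_set ps gm g(2)) auto
  moreover have "(\<integral>x. g x \<partial>\<nu>) = 2 * measure \<nu> Y - 1 - (\<integral>x. (1 - g x) * indicator Y x \<partial>\<nu>) + b"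
    unfolding b_def using Ym st by (intro integral_split_set ps gm g(2)) auto
  ultimately show ?thesis
    unfolding tv_dist_hahn[OF D(1,2) hahn] using ab pos by argo
qed

section \<open>Size of \<open>c_tilde\<close> and balance of the errors\<close>

lemma c_tilde_eq:
  fixes s M :: real and k :: nat
  assumes k: "0 < k"
  defines "T \<equiv> real k powr (1 / (2 * (s + real CARD('d::finite) + 2)))"
  shows "c_tilde (unit_cube :: (real ^ 'd) set) s M k =
    max (max (M * real CARD('d) * gauss_moment TYPE('d) * T powr (real CARD('d) + 2)) 1)
      (sqrt (2 * real CARD('d) / pi ^ CARD('d)) * Gamma ((real CARD('d) + 1) / 2) * T)"
proof -
  let ?t = "real k powr (- (1 / (2 * (s + real CARD('d) + 2))))"
  have t: "0 < ?t" using k by simp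
  have T: "1 / ?t = T" by (simp add: T_def powr_minus_divide)
  have T0: "0 < T" using k by (simp add: T_def)
  have "c_const (unit_cube :: (real ^ 'd) set) M ?t = M * real CARD('d) * ((1 / ?t) ^ (CARD('d) + 2) * gauss_moment TYPE('d))"
    unfolding c_const_def set_sup_norm_unit_cube gauss_moment_scale[OF t] by simp
  also have "\<dots> = M * real CARD('d) * gauss_moment TYPE('d) * T powr (real CARD('d) + 2)"
  proof -
    have "T ^ (CARD('d) + 2) = T powr (real CARD('d) + 2)"
      using powr_realpow[OF T0, of "CARD('d) + 2"] by (simp only: of_nat_add of_nat_numeral)
    then show ?thesis unfolding T by simp
  qed
  finally have c: "c_const (unit_cube :: (real ^ 'd) set) M ?t = \<dots>" .
  have "x / ?t = x * T" for x
    unfolding T[symmetric] by (simp only: times_divide_eq_right mult_1_right)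
  then show ?thesis unfolding c_tilde_def c_hat_def c by (simp only:)
qed

text \<open>Since \<open>T\<close> is at least 1, the constant and the linear term of the maximum
  are dominated by multiples of \<open>T powr (d + 2)\<close>, so the first term determines the
  order. The lower bound keeps the explicit constant of that term, which later fixes the order of
  the kernel.\<close>

lemma c_tilde_bounds:
  fixes s M :: real
  assumes s: "0 < s" and M: "0 \<le> M"
  obtains c1 where "0 < c1"
    "\<And>k. 0 < k \<Longrightarrow> c_tilde (unit_cube :: (real ^ 'd::finite) set) s M k
      \<le> c1 * (real k powr (1 / (2 * (s + real CARD('d) + 2)))) powr (real CARD('d) + 2)"
    "\<And>k. 0 < k \<Longrightarrow> M * real CARD('d) * gauss_moment TYPE('d) *
      (real k powr (1 / (2 * (s + real CARD('d) + 2)))) powr (real CARD('d) + 2) \<le> c_tilde (unit_cube :: (real ^ 'd) set) s M k"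
    "\<And>k. 0 < k \<Longrightarrow> 1 \<le> c_tilde (unit_cube :: (real ^ 'd) set) s M k"
proof -
  let ?d = "real CARD('d)"
  define c0 where "c0 = M * ?d * gauss_moment TYPE('d)"
  define \<Gamma> where "\<Gamma> = sqrt (2 * ?d / pi ^ CARD('d)) * Gamma ((?d + 1) / 2)"
  have c0: "0 \<le> c0" using M gauss_moment_pos[where 'd = 'd] by (simp add: c0_def)
  show ?thesis
  proof (rule that[of "c0 + 1 + \<bar>\<Gamma>\<bar>"])
    fix k :: nat assume k: "0 < k"
    define T where "T = real k powr (1 / (2 * (s + ?d + 2)))"
    define y where "y = T powr (?d + 2)"
    have T1: "1 \<le> T" unfolding T_def using k s by (intro ge_one_powr_ge_zero) auto
    have eq: "c_tilde (unit_cube :: (real ^ 'd) set) s M k = max (max (c0 * y) 1) (\<Gamma> * T)"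
      unfolding c_tilde_eq[OF k] c0_def \<Gamma>_def T_def y_def ..
    have y: "1 \<le> y" unfolding y_def using T1 by (intro ge_one_powr_ge_zero) auto
    have "T powr 1 \<le> y" unfolding y_def using T1 by (intro powr_mono) auto
    then have "\<Gamma> * T \<le> \<bar>\<Gamma>\<bar> * y" using T1 by (intro mult_mono) auto
    moreover have p: "0 \<le> c0 * y" "0 \<le> \<bar>\<Gamma>\<bar> * y" using c0 y by auto
    moreover have "(c0 + 1 + \<bar>\<Gamma>\<bar>) * y = c0 * y + y + \<bar>\<Gamma>\<bar> * y" by (simp add: distrib_right)
    ultimately show "c_tilde (unit_cube :: (real ^ 'd) set) s M k
        \<le> (c0 + 1 + \<bar>\<Gamma>\<bar>) * (real k powr (1 / (2 * (s + ?d + 2)))) powr (?d + 2)"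
      unfolding eq T_def[symmetric] y_def[symmetric] using y by linarith
    show "M * ?d * gauss_moment TYPE('d) * (real k powr (1 / (2 * (s + ?d + 2)))) powr (?d + 2)
        \<le> c_tilde (unit_cube :: (real ^ 'd) set) s M k"
      unfolding eq T_def[symmetric] y_def[symmetric] c0_def[symmetric] by simp
    show "1 \<le> c_tilde (unit_cube :: (real ^ 'd) set) s M k" unfolding eq by simp
  qed (use c0 in simp)
qed

lemma tv_dist_le_2:
  assumes "prob_measure_on S \<mu>" "prob_measure_on S \<nu>"
  shows "tv_dist S \<mu> \<nu> \<le> 2"
proof -
  interpret M: prob_space \<mu> using assms by (simp add: prob_measure_on_def)
  have st: "sets \<nu> = sets \<mu>" "prob_space \<nu>" using assms by (auto simp: prob_measure_on_def)
  obtain Y where Y: "hahn_set \<mu> \<nu> Y" using hahn_set_exists[of \<mu> \<nu>] st M.prob_space_axioms by blast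
  show ?thesis
    unfolding tv_dist_hahn[OF assms Y] using M.prob_le_1[of Y] measure_nonneg[of \<nu> Y] by argo
qed

lemma clipped_nets_relu_witness:
  fixes s M :: real
  assumes s: "0 < s" "s \<le> 1" and M: "1 \<le> M"
  obtains E where "0 \<le> E"
    "\<And>k (\<mu> :: (real ^ 'd) measure) \<nu>. 0 < k \<Longrightarrow> (\<mu>, \<nu>) \<in> tv_pairs M unit_cube \<Longrightarrow>
      f_tv unit_cube \<mu> \<nu> \<in> Lip1_class s M unit_cube \<Longrightarrow>
      \<exists>g\<in>clipped_nets_relu k (c_tilde (unit_cube :: (real ^ 'd) set) s M k).
        tv_dist unit_cube \<mu> \<nu> - E * real k powr (- (s / (2 * (s + real CARD('d) + 2)))) \<le> (\<integral>x. g x \<partial>\<mu>) - (\<integral>x. g x \<partial>\<nu>)"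
proof -
  let ?d = "real CARD('d)"
  define e where "e = 1 / (2 * (s + ?d + 2))"
  define c0 where "c0 = M * ?d * gauss_moment TYPE('d)"
  have M0: "0 \<le> M" using M by simp
  obtain c1 where c1: "0 < c1"
    "\<And>k. 0 < k \<Longrightarrow> c_tilde (unit_cube :: (real ^ 'd) set) s M k \<le> c1 * (real k powr e) powr (?d + 2)"
    "\<And>k. 0 < k \<Longrightarrow> c0 * (real k powr e) powr (?d + 2) \<le> c_tilde (unit_cube :: (real ^ 'd) set) s M k"
    "\<And>k. 0 < k \<Longrightarrow> 1 \<le> c_tilde (unit_cube :: (real ^ 'd) set) s M k"
    using c_tilde_bounds[OF s(1) M0, where 'd = 'd] unfolding e_def c0_def by blast
  have c0: "0 < c0" using M gauss_moment_pos[where 'd = 'd] by (simp add: c0_def)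
  \<comment> \<open>Solves \<open>4 * d\<^sup>2 * \<kappa> powr (d / 2 + 1) = c0\<close>, so that a
    kernel with \<open>m + 1 \<le> \<kappa> * T\<^sup>2\<close> satisfies the weight condition for
    \<open>c_tilde\<close>.\<close>
  define \<kappa> where "\<kappa> = (c0 / (4 * ?d\<^sup>2)) powr (2 / (?d + 2))"
  have \<kappa>: "0 < \<kappa>" using c0 by (simp add: \<kappa>_def)
  have \<kappa>p: "4 * ?d\<^sup>2 * \<kappa> powr (?d / 2 + 1) = c0"
  proof -
    have "2 / (?d + 2) * (?d / 2 + 1) = 1" by (simp add: field_simps)
    then have "\<kappa> powr (?d / 2 + 1) = c0 / (4 * ?d\<^sup>2)" using c0 by (simp add: \<kappa>_def powr_powr)
    then show ?thesis by simp
  qed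
  \<comment> \<open>\<open>E1\<close> bounds the \<open>L1\<close> error in units of
    \<open>T powr (- s)\<close>; halving \<open>\<kappa>\<close> pays for rounding \<open>m\<close>.
    In \<open>E\<close> the density bound adds a factor \<open>M\<close>, and the last term covers
    the small \<open>k\<close> for which no kernel fits.\<close>
  define E1 where "E1 = M * (1 + ?d * pi\<^sup>2 / 2) * (\<kappa> / 2) powr (- (s / 2)) + 5 * c1"
  define E where "E = M * E1 + 4 * \<kappa> powr (- (s / 2))"
  have E1: "0 \<le> E1" using M c1(1) by (simp add: E1_def)
  have E: "0 \<le> E" using M E1 by (simp add: E_def)
  show ?thesis
  proof (rule that[OF E])
    fix k :: nat and \<mu> \<nu> :: "(real ^ 'd) measure"
    assume k: "0 < k" and pair: "(\<mu>, \<nu>) \<in> tv_pairs M unit_cube" and Lip: "f_tv unit_cube \<mu> \<nu> \<in> Lip1_class s M unit_cube"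
    define T where "T = real k powr e"
    define a where "a = c_tilde (unit_cube :: (real ^ 'd) set) s M k"
    have T1: "1 \<le> T" unfolding T_def e_def using k s by (intro ge_one_powr_ge_zero) auto
    have a_ge: "c0 * T powr (?d + 2) \<le> a" "1 \<le> a" and a_le: "a \<le> c1 * T powr (?d + 2)"
      using c1(2-4)[OF k] by (simp_all add: a_def T_def)
    have sqk: "sqrt k = T powr (s + ?d + 2)"
    proof -
      have "e * (s + ?d + 2) = 1 / 2" using s by (simp add: e_def field_simps)
      then show ?thesis using powr_half_sqrt[of "real k"] by (simp only: T_def powr_powr of_nat_0_le_iff)
    qed
    have rate: "real k powr (- (s / (2 * (s + ?d + 2)))) = T powr (- s)"
      by (simp add: T_def powr_powr e_def)
    have ak: "a / sqrt k \<le> c1 * T powr (- s)"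
    proof -
      have "a / sqrt k \<le> c1 * T powr (?d + 2) / T powr (s + ?d + 2)"
        unfolding sqk by (intro divide_right_mono a_le) simp
      also have "\<dots> = c1 * T powr ((?d + 2) - (s + ?d + 2))" by (simp only: powr_diff times_divide_eq_right)
      also have "(?d + 2) - (s + ?d + 2) = - s" by simp
      finally show ?thesis .
    qed
    have T2p: "(T\<^sup>2) powr x = T powr (2 * x)" for x
    proof -
      have "T\<^sup>2 = T powr 2" using T1 by simp
      then show ?thesis by (simp only: powr_powr)
    qed
    define f where "f = f_tv unit_cube \<mu> \<nu>"
    have fm: "f \<in> borel_measurable borel"
      using Lip by (auto simp: Lip1_class_def f_def dest: borel_measurable_integrable)
    have fb: "\<bar>f x\<bar> \<le> 1" "x \<notin> unit_cube \<Longrightarrow> f x = 0" for x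
      by (auto simp: f_def f_tv_def Let_def indicator_def)
    have mod: "(\<integral>\<^sup>+ x. ennreal \<bar>f (x + u) - f x\<bar> \<partial>lborel) \<le> ennreal (M * norm u powr s)" for u
      using Lip M unfolding f_def by (intro Lip1_norm_modulus) (auto simp: Lip1_class_def)
    note D = tv_pairs_density[OF pair]
    show "\<exists>g\<in>clipped_nets_relu k (c_tilde (unit_cube :: (real ^ 'd) set) s M k).
        tv_dist unit_cube \<mu> \<nu> - E * real k powr (- (s / (2 * (s + ?d + 2)))) \<le> (\<integral>x. g x \<partial>\<mu>) - (\<integral>x. g x \<partial>\<nu>)"
      unfolding a_def[symmetric] rate
    proof (cases "1 \<le> \<kappa> * T\<^sup>2")
      case True
      \<comment> \<open>The estimates are in terms of \<open>m + 1\<close>, which is the rounded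
        value of \<open>\<kappa> * T\<^sup>2\<close> and, being at least 1, loses at most half of
        it.\<close>
      define m where "m = nat \<lfloor>\<kappa> * T\<^sup>2\<rfloor> - 1"
      have fl: "1 \<le> \<lfloor>\<kappa> * T\<^sup>2\<rfloor>" using True by (simp add: le_floor_iff)
      have m: "real m + 1 = of_int \<lfloor>\<kappa> * T\<^sup>2\<rfloor>" using fl by (simp add: m_def of_nat_diff nat_le_iff le_nat_iff)
      have m_le: "real m + 1 \<le> \<kappa> * T\<^sup>2" unfolding m by (rule of_int_floor_le)
      have m_ge: "\<kappa> / 2 * T\<^sup>2 \<le> real m + 1"
      proof -
        have "\<kappa> * T\<^sup>2 < of_int \<lfloor>\<kappa> * T\<^sup>2\<rfloor> + 1" by (rule floor_less_cancel) simp
        then have "\<kappa> * T\<^sup>2 < real m + 2" unfolding m[symmetric] by simp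
        then show ?thesis by simp
      qed
      have "(real m + 1) powr (?d / 2 + 1) \<le> (\<kappa> * T\<^sup>2) powr (?d / 2 + 1)"
        using m_le by (intro powr_mono2) auto
      also have "\<dots> = \<kappa> powr (?d / 2 + 1) * T powr (?d + 2)"
        using \<kappa> by (simp add: powr_mult T2p distrib_left)
      finally have "4 * ?d\<^sup>2 * (real m + 1) powr (?d / 2 + 1) \<le> 4 * ?d\<^sup>2 * (\<kappa> powr (?d / 2 + 1) * T powr (?d + 2))"
        by (intro mult_left_mono) auto
      also have "\<dots> = c0 * T powr (?d + 2)" by (simp add: \<kappa>p[symmetric] mult.assoc)
      finally have cond: "4 * ?d\<^sup>2 * (real m + 1) powr (?d / 2 + 1) \<le> a" using a_ge(1) by linarith
      obtain g where g: "g \<in> clipped_nets_relu k a"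
        and err: "(\<integral>\<^sup>+ x. ennreal (\<bar>f x - g x\<bar> * indicator unit_cube x) \<partial>lborel)
          \<le> ennreal (M * (1 + ?d * pi\<^sup>2 / 2) * (real m + 1) powr (- (s / 2)) + 5 * a / sqrt k)"
        using relu_network_L1_approximation[OF fm fb mod M0 s k cond] by blast
      have "(real m + 1) powr (- (s / 2)) \<le> (\<kappa> / 2 * T\<^sup>2) powr (- (s / 2))"
        using m_ge \<kappa> T1 s by (intro powr_mono2') auto
      also have "\<dots> = (\<kappa> / 2) powr (- (s / 2)) * T powr (- s)"
        using \<kappa> by (subst powr_mult) (auto simp: T2p)
      finally have "M * (1 + ?d * pi\<^sup>2 / 2) * (real m + 1) powr (- (s / 2))
          \<le> M * (1 + ?d * pi\<^sup>2 / 2) * ((\<kappa> / 2) powr (- (s / 2)) * T powr (- s))"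
        using M0 by (intro mult_left_mono) auto
      moreover have "5 * a / sqrt k \<le> 5 * (c1 * T powr (- s))" using ak by simp
      ultimately have tot: "M * (1 + ?d * pi\<^sup>2 / 2) * (real m + 1) powr (- (s / 2)) + 5 * a / sqrt k \<le> E1 * T powr (- s)"
        by (simp add: E1_def algebra_simps)
      have gc: "g \<in> borel_measurable borel" "\<bar>g x\<bar> \<le> 1" for x
        using g clipped_nets_continuous[OF relu_continuous] clipped_nets_bounded
        unfolding clipped_nets_relu_def by (blast intro: borel_measurable_continuous_onI)+
      have "tv_dist unit_cube \<mu> \<nu> - M * (E1 * T powr (- s)) \<le> (\<integral>x. g x \<partial>\<mu>) - (\<integral>x. g x \<partial>\<nu>)"
        using err tot E1 by (intro tv_pairs_gap[OF pair M0 gc]) (auto simp: f_def intro: order_trans[OF _ ennreal_leI])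
      moreover have "M * (E1 * T powr (- s)) \<le> E * T powr (- s)"
        by (simp add: E_def distrib_right)
      ultimately show "\<exists>g\<in>clipped_nets_relu k a. tv_dist unit_cube \<mu> \<nu> - E * T powr (- s) \<le> (\<integral>x. g x \<partial>\<mu>) - (\<integral>x. g x \<partial>\<nu>)"
        using g by (intro bexI[of _ g]) auto
    next
      case False
      \<comment> \<open>For \<open>\<kappa> * T\<^sup>2 < 1\<close> the rate is bounded below by a
        constant. The zero network then suffices, because the total variation is at most 2.\<close>
      have "(\<lambda>x :: real ^ 'd. ridge_sum relu [] x + 0 \<bullet> x + 0) \<in> nets k 1 (2 * a / k) a a relu"
        using a_ge(2) by (intro ridge_sum_affine_in_nets) auto
      then have g: "(\<lambda>x. 0) \<in> (clipped_nets_relu k a :: (real ^ 'd \<Rightarrow> real) set)"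
        unfolding clipped_nets_relu_def clipped_nets_eq by (force simp: image_iff)
      have "1 \<le> (\<kappa> * T\<^sup>2) powr (- (s / 2))"
        using powr_mono2'[of "- (s / 2)" "\<kappa> * T\<^sup>2" 1] False s \<kappa> T1 by auto
      also have "\<dots> = \<kappa> powr (- (s / 2)) * T powr (- s)"
        using \<kappa> by (simp add: powr_mult T2p)
      finally have "2 \<le> 4 * (\<kappa> powr (- (s / 2)) * T powr (- s))" by linarith
      also have "\<dots> \<le> E * T powr (- s)" using M E1 by (simp add: E_def distrib_right)
      finally show "\<exists>g\<in>clipped_nets_relu k a. tv_dist unit_cube \<mu> \<nu> - E * T powr (- s) \<le> (\<integral>x. g x \<partial>\<mu>) - (\<integral>x. g x \<partial>\<nu>)"
        using g tv_dist_le_2[OF D(1,2)] by (intro bexI[of _ "\<lambda>x. 0"]) auto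
    qed
  qed
qed

lemma tv_estimator_rate:
  fixes s M :: real
  assumes s: "0 < s" "s \<le> 1" and M: "0 \<le> M"
  shows "\<exists>C. \<forall>k\<ge>1. \<forall>n\<ge>1.
    (SUP (\<mu>, \<nu>) \<in> {(\<mu>, \<nu>) \<in> tv_pairs M (unit_cube :: (real ^ 'd) set). f_tv unit_cube \<mu> \<nu> \<in> Lip1_class s M unit_cube}.
      expected_error unit_cube (clipped_nets_relu k (c_tilde (unit_cube :: (real ^ 'd) set) s M k)) n \<mu> \<nu>)
    \<le> ennreal (C * (real k powr (- (s / (2 * (s + real CARD('d) + 2)))) +
        real k powr ((real CARD('d) + 2) / (2 * (s + real CARD('d) + 2))) * real n powr (- (1 / 2))))"
proof (cases "1 \<le> M")
  case False
  \<comment> \<open>The supremum is over the empty set and equals 0 in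
    \<open>ennreal\<close>.\<close>
  then have "tv_pairs M (unit_cube :: (real ^ 'd) set) = {}" using tv_pairs_one_le[OF _ M] by fastforce
  then show ?thesis by simp
next
  case True
  let ?d = "real CARD('d)"
  obtain E where E: "0 \<le> E"
    "\<And>k (\<mu> :: (real ^ 'd) measure) \<nu>. 0 < k \<Longrightarrow> (\<mu>, \<nu>) \<in> tv_pairs M unit_cube \<Longrightarrow>
      f_tv unit_cube \<mu> \<nu> \<in> Lip1_class s M unit_cube \<Longrightarrow>
      \<exists>g\<in>clipped_nets_relu k (c_tilde (unit_cube :: (real ^ 'd) set) s M k).
        tv_dist unit_cube \<mu> \<nu> - E * real k powr (- (s / (2 * (s + ?d + 2)))) \<le> (\<integral>x. g x \<partial>\<mu>) - (\<integral>x. g x \<partial>\<nu>)"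
    using clipped_nets_relu_witness[OF s True] by blast
  obtain c1 where c1: "0 < c1"
    "\<And>k. 0 < k \<Longrightarrow> c_tilde (unit_cube :: (real ^ 'd) set) s M k
      \<le> c1 * (real k powr (1 / (2 * (s + ?d + 2)))) powr (?d + 2)"
    "\<And>k. 0 < k \<Longrightarrow> 1 \<le> c_tilde (unit_cube :: (real ^ 'd) set) s M k"
    using c_tilde_bounds[OF s(1) M, where 'd = 'd] by metis
  define K where "K = 8 * (?d + 1) * exp 16"
  have K: "0 \<le> K" by (simp add: K_def)
  define C where "C = E + 4 * c1 * K"
  have "expected_error unit_cube (clipped_nets_relu k (c_tilde (unit_cube :: (real ^ 'd) set) s M k)) n \<mu> \<nu>
      \<le> ennreal (C * (real k powr (- (s / (2 * (s + ?d + 2)))) +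
          real k powr ((?d + 2) / (2 * (s + ?d + 2))) * real n powr (- (1 / 2))))"
    if k: "1 \<le> k" and n: "1 \<le> n" and pair: "(\<mu>, \<nu>) \<in> tv_pairs M unit_cube"
      and Lip: "f_tv unit_cube \<mu> \<nu> \<in> Lip1_class s M unit_cube" for k n and \<mu> \<nu> :: "(real ^ 'd) measure"
  proof -
    have k0: "0 < k" and n0: "0 < n" using k n by auto
    define a where "a = c_tilde (unit_cube :: (real ^ 'd) set) s M k"
    define T where "T = real k powr (1 / (2 * (s + ?d + 2)))"
    have a1: "0 < a" and a_le: "a \<le> c1 * T powr (?d + 2)"
      using c1(2,3)[OF k0] by (simp_all add: a_def T_def)
    define G :: "(real ^ 'd \<Rightarrow> real) set" where "G = clipped_nets_relu k a"
    define e where "e = E * real k powr (- (s / (2 * (s + ?d + 2))))"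
    have e0: "0 \<le> e" using E(1) by (simp add: e_def)
    note \<mu> = tv_pairs_density(1)[OF pair] and \<nu> = tv_pairs_density(2)[OF pair]
    obtain g where g: "g \<in> G" "tv_dist unit_cube \<mu> \<nu> - e \<le> (\<integral>x. g x \<partial>\<mu>) - (\<integral>x. g x \<partial>\<nu>)"
      using E(2)[OF k0 pair Lip] unfolding G_def a_def e_def by blast
    have Gc: "\<And>g. g \<in> G \<Longrightarrow> continuous_on UNIV g" and Gb: "\<And>g x. g \<in> G \<Longrightarrow> \<bar>g x\<bar> \<le> 1"
      using clipped_nets_continuous[OF relu_continuous] clipped_nets_bounded
      unfolding G_def clipped_nets_relu_def by blast+
    define U where "U = deviation_sup \<mu> \<nu> G (4 * a) n"
    have Um: "U \<in> borel_measurable (sample_law \<mu> \<nu>)"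
      unfolding measurable_cong_sets[OF sets_sample_law[OF \<mu> \<nu>] refl] U_def
      by (rule deviation_sup_measurable[OF Gc])
    have U_int: "(\<integral>\<^sup>+ w. U w \<partial>sample_law \<mu> \<nu>) \<le> ennreal K"
      unfolding U_def G_def clipped_nets_relu_def clipped_nets_eq K_def
      using a1 n0 relu_lipschitz
      by (intro nn_integral_deviation_sup_le[OF \<mu> \<nu> _ _ nets_relu_subset_hull[OF a1 k0]]) (auto simp: relu_def)
    have ps: "prob_space (sample_law \<mu> \<nu>)"
      using sample_law_iid_samples[OF \<mu> \<nu>] by (simp add: iid_samples_def)
    let ?err = "\<lambda>w. \<bar>tv_estimator G n (\<lambda>i. w (Inl i)) (\<lambda>i. w (Inr i)) - tv_dist unit_cube \<mu> \<nu>\<bar>"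
    have point: "ennreal (?err w) \<le> ennreal e + ennreal (4 * a / sqrt n) * U w" for w
    proof (cases "U w")
      case (real u)
      \<comment> \<open>The exponent is nonnegative and \<open>G\<close> contains \<open>g\<close>,
        so the logarithm of \<open>U w\<close> is an admissible level \<open>v\<close>.\<close>
      have "1 \<le> U w"
      proof -
        have "ennreal 1 \<le> ennreal (exp (\<bar>deviation \<mu> \<nu> n w g\<bar> / (4 * a * sqrt n)))"
          using a1 by (intro ennreal_leI) simp
        also have "\<dots> \<le> U w"
          unfolding U_def deviation_sup_def exp_sup_def by (rule SUP_upper[OF g(1)])
        finally show ?thesis by simp
      qed
      then have u1: "1 \<le> u" using real by (simp flip: ennreal_1)
      have "?err w \<le> e + 4 * a / sqrt n * ln u"
        using real u1 a1 g e0 unfolding U_def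
        by (intro tv_estimator_error_le[OF \<mu> \<nu>, where G = G and ?g0.0 = g] Gc Gb n0) auto
      \<comment> \<open>An expectation needs only the first moment of \<open>U\<close>, so the
        logarithm is given up for a bound linear in \<open>U w\<close>. Where \<open>U w\<close> is
        infinite that bound is trivial.\<close>
      also have "4 * a / sqrt n * ln u \<le> 4 * a / sqrt n * u"
        using a1 u1 ln_le_minus_one[of u] by (intro mult_left_mono) auto
      finally have "ennreal (?err w) \<le> ennreal (e + 4 * a / sqrt n * u)" by (intro ennreal_leI) simp
      also have "\<dots> = ennreal e + ennreal (4 * a / sqrt n) * U w"
        using e0 a1 u1 unfolding real by (subst ennreal_plus, simp, simp, subst ennreal_mult, simp_all del: times_divide_eq_left)
      finally show ?thesis .
    next
      case top
      have "0 < 4 * a / sqrt n" using a1 n0 by simp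
      then have "ennreal (4 * a / sqrt n) * U w = \<top>" using top a1 n0 by (simp add: ennreal_mult_top)
      then show ?thesis by simp
    qed
    have "expected_error unit_cube G n \<mu> \<nu> \<le> (\<integral>\<^sup>+ w. ennreal e + ennreal (4 * a / sqrt n) * U w \<partial>sample_law \<mu> \<nu>)"
      unfolding expected_error_def by (intro nn_integral_mono point)
    also have "\<dots> = ennreal e + ennreal (4 * a / sqrt n) * (\<integral>\<^sup>+ w. U w \<partial>sample_law \<mu> \<nu>)"
      using Um prob_space.emeasure_space_1[OF ps] by (simp add: nn_integral_add nn_integral_cmult)
    also have "\<dots> \<le> ennreal e + ennreal (4 * a / sqrt n) * ennreal K"
      by (intro add_left_mono mult_left_mono U_int) simp
    also have "\<dots> = ennreal (e + 4 * a / sqrt n * K)"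
      using e0 a1 K by (subst ennreal_plus, simp, simp, subst ennreal_mult, simp_all del: times_divide_eq_left)
    also have "\<dots> \<le> ennreal (C * (real k powr (- (s / (2 * (s + ?d + 2)))) +
          real k powr ((?d + 2) / (2 * (s + ?d + 2))) * real n powr (- (1 / 2))))"
    proof (rule ennreal_leI)
      define x y z where "x = real k powr (- (s / (2 * (s + ?d + 2))))" and "y = T powr (?d + 2)" and "z = real n powr (- (1 / 2))"
      have y: "real k powr ((?d + 2) / (2 * (s + ?d + 2))) = y"
        unfolding y_def T_def powr_powr by simp
      have z: "z = 1 / sqrt n" using n0 unfolding z_def by (subst powr_minus_divide, subst powr_half_sqrt) simp_all
      have pos: "0 \<le> x" "0 \<le> y" "0 \<le> z" by (simp_all add: x_def y_def z_def)
      have "4 * a / sqrt n * K = 4 * (a * z) * K" by (simp add: z)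
      also have "\<dots> \<le> 4 * ((c1 * y) * z) * K"
        using a_le pos K unfolding y_def[symmetric] by (intro mult_right_mono mult_left_mono) auto
      also have "\<dots> = (4 * c1 * K) * (y * z)" by algebra
      finally have "e + 4 * a / sqrt n * K \<le> E * x + (4 * c1 * K) * (y * z)"
        unfolding e_def x_def[symmetric] by (rule add_left_mono)
      also have "\<dots> \<le> (E + 4 * c1 * K) * x + (E + 4 * c1 * K) * (y * z)"
        using E(1) c1(1) K pos by (intro add_mono mult_right_mono) auto
      also have "\<dots> = C * (x + y * z)" by (simp add: C_def distrib_left)
      finally show "e + 4 * a / sqrt n * K \<le> C * (real k powr (- (s / (2 * (s + ?d + 2)))) +
          real k powr ((?d + 2) / (2 * (s + ?d + 2))) * real n powr (- (1 / 2)))"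
        unfolding y by (simp add: x_def z_def)
    qed
    finally show ?thesis unfolding G_def a_def .
  qed
  then show ?thesis by (intro exI[of _ C] allI impI SUP_least) auto
qed

theorem theorem32:
  shows
    "(\<forall>(\<mu> :: (real ^ 'd) measure) (\<nu> :: (real ^ 'd) measure) (\<phi> :: real \<Rightarrow> real) (\<rho> :: real)
        (k :: nat \<Rightarrow> nat) (P :: 'w measure) X Y.
        prob_measure_on unit_cube \<mu> \<longrightarrow> prob_measure_on unit_cube \<nu> \<longrightarrow>
        \<phi> \<in> {sigmoid, relu} \<longrightarrow> 0 < \<rho> \<longrightarrow> \<rho> < 1 \<longrightarrow>
        filterlim k at_top sequentially \<longrightarrow>
        (\<lambda>n. real (k n)) \<in> O(\<lambda>n. real n powr ((1 - \<rho>) / 2)) \<longrightarrow>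
        iid_samples P \<mu> \<nu> X Y \<longrightarrow>
        (AE \<omega> in P.
          (\<lambda>n. tv_estimator (clipped_nets_star (k n) \<phi>) n (\<lambda>i. X i \<omega>) (\<lambda>i. Y i \<omega>))
            \<longlonglongrightarrow> tv_dist unit_cube \<mu> \<nu>)) \<and>
     (\<forall>(s :: real) (M :: real). 0 < s \<longrightarrow> s \<le> 1 \<longrightarrow> 0 \<le> M \<longrightarrow>
        (\<exists>C :: real. \<forall>k \<ge> 1. \<forall>n \<ge> 1.
          (SUP (\<mu>, \<nu>) \<in> {(\<mu>, \<nu>) \<in> tv_pairs M (unit_cube :: (real ^ 'd) set).
                            f_tv unit_cube \<mu> \<nu> \<in> Lip1_class s M unit_cube}.
             expected_error unit_cube
               (clipped_nets_relu k (c_tilde (unit_cube :: (real ^ 'd) set) s M k)) n \<mu> \<nu>)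
          \<le> ennreal (C *
               (real k powr (- (s / (2 * (s + real CARD('d) + 2)))) +
                real k powr ((real CARD('d) + 2) / (2 * (s + real CARD('d) + 2)))
                  * real n powr (- (1 / 2))))))"
  by (intro conjI allI impI tv_estimator_consistent tv_estimator_rate)

end
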